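(* Let $\Omega=\mathcal{C}([0,1])$ be equipped with the Wiener measure $\mathbb{P}$, with coordinate Brownian motion $B$. Let $\alpha=(\alpha(\omega,t))_{t\in[0,1]}$ be a measurable, non-negative random process on the Wiener space (not necessarily adapted) such that $\mathbb{E}\int_0^1\alpha(t)\,dt<+\infty$ and $\alpha(\omega,t)\ge k(t)>0$ for $\mathbb{P}\times dt$-a.e. $(\omega,t)$, where $k$ is a deterministic measurable function on $[0,1]$. Let $\mathbb{D}_{ou}^k\subset L^2(\mathbb{P})$ be the domain of the Ornstein-Uhlenbeck structure with deterministic weight $k$ and let $D_{ou}^k$ be its gradient with values in $L^2([0,1],dt)$. Put $$\mathbb{D}=\Big\{Y\in\mathbb{D}_{ou}^k:\ \int_0^1\mathbb{E}\Big[(D_{ou}^k[Y](t))^2\,\frac{\alpha(t)}{k(t)}\Big]dt<+\infty\Big\},\qquad \mathcal{E}[Y]=\frac12\int_0^1\mathbb{E}\Big[(D_{ou}^k[Y](t))^2\,\frac{\alpha(t)}{k(t)}\Big]dt\quad(Y\in\mathbb{D}).$$ Then $\mathbb{D}$ is dense in $L^2(\mathbb{P})$, the form $(\mathcal{E},\mathbb{D})$ is a Dirichlet form on $L^2(\mathbb{P})$, and it admits the carr\'e du champ operator $$\Gamma[Y]=\int_0^1 (D_{ou}^k[Y](t))^2\,\frac{\alpha(t)}{k(t)}\,dt,\qquad Y\in\mathbb{D}.$$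
   Context: Ornstein-Uhlenbeck structure with deterministic weight $k$ ($k>0$ measurable and in $L^1[0,1]$): it is the closed quadratic form on $L^2(\mathbb{P})$ whose carr\'e du champ satisfies $\Gamma_{ou}^k[\int_0^1 u\,dB]=\int_0^1 k(s)u^2(s)\,ds$ for deterministic $u$. Concretely, for $Y=\Phi(\int_0^1 h_1dB,\dots,\int_0^1 h_mdB)$ with $\Phi$ of class $\mathcal{C}^1$ and Lipschitz on $\mathbb{R}^m$ and deterministic $h_i\in L^2([0,1],(1+k)dt)$, set $D_{ou}^k[Y](t)=\sum_i \partial_i\Phi(\int_0^1 h_1dB,\dots,\int_0^1 h_mdB)\,h_i(t)\sqrt{k(t)}$; this operator from $L^2(\mathbb{P})$ to $L^2(\mathbb{P};L^2([0,1],dt))$ is closable, and $D_{ou}^k$ with domain $\mathbb{D}_{ou}^k$ denotes its closure. One has $\Gamma_{ou}^k[Y]=\int_0^1(D_{ou}^k[Y](t))^2dt$. Dirichlet form on $L^2(\mathbb{P})$: a non-negative symmetric bilinear form $\mathcal{E}$ with dense domain $\mathbb{D}$, closed (i.e. $\mathbb{D}$ is complete for the norm $(\|u\|_{L^2(\mathbb{P})}^2+\mathcal{E}[u])^{1/2}$), and on which contractions operate: if $u\in\mathbb{D}$ and $\varphi:\mathbb{R}\to\mathbb{R}$ satisfies $\varphi(0)=0$ and $|\varphi(x)-\varphi(y)|\le|x-y|$, then $\varphi(u)\in\mathbb{D}$ and $\mathcal{E}[\varphi(u)]\le\mathcal{E}[u]$. Here $\mathcal{E}[u]=\mathcal{E}[u,u]$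 and $\Gamma[u]=\Gamma[u,u]$, the bilinear versions being obtained by polarization. The form admits $\Gamma$ as carr\'e du champ operator if $\Gamma$ is a positive symmetric bilinear map from $\mathbb{D}\times\mathbb{D}$ to $L^1(\mathbb{P})$ such that $2\mathcal{E}[fh,f]-\mathcal{E}[h,f^2]=\mathbb{E}[h\,\Gamma[f]]$ for all $f,h\in\mathbb{D}\cap L^\infty(\mathbb{P})$. *)

theory Defs
  imports "HOL-Probability.Probability"
begin

section \<open>Square-integrable functions\<close>

text \<open>Elements of \<open>L\<^sup>2\<close> are represented by functions; compatibility with identification
  modulo null sets is required explicitly where it matters.\<close>

definition L2_space :: "'a measure \<Rightarrow> ('a \<Rightarrow> real) set" where
  "L2_space M = {f \<in> borel_measurable M. integrable M (\<lambda>x. (f x)\<^sup>2)}"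

definition L2_norm :: "'a measure \<Rightarrow> ('a \<Rightarrow> real) \<Rightarrow> real" where
  "L2_norm M f = sqrt (\<integral>x. (f x)\<^sup>2 \<partial>M)"

definition L2_dense :: "'a measure \<Rightarrow> ('a \<Rightarrow> real) set \<Rightarrow> bool" where
  "L2_dense M D \<longleftrightarrow> D \<subseteq> L2_space M \<and>
     (\<forall>f\<in>L2_space M. \<forall>e>0. \<exists>u\<in>D. L2_norm M (\<lambda>x. f x - u x) < e)"

definition L2_graph_closure ::
  "'a measure \<Rightarrow> 'b measure \<Rightarrow> (('a \<Rightarrow> real) \<times> ('b \<Rightarrow> real)) set \<Rightarrow>
   (('a \<Rightarrow> real) \<times> ('b \<Rightarrow> real)) set" where
  "L2_graph_closure M N G = {(f, g). f \<in> L2_space M \<and> g \<in> L2_space N \<and>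
     (\<exists>F H. (\<forall>n. (F n, H n) \<in> G) \<and>
        (\<lambda>n::nat. L2_norm M (\<lambda>x. F n x - f x)) \<longlonglongrightarrow> 0 \<and>
        (\<lambda>n. L2_norm N (\<lambda>y. H n y - g y)) \<longlonglongrightarrow> 0)}"

definition essentially_bounded :: "'a measure \<Rightarrow> ('a \<Rightarrow> real) \<Rightarrow> bool" where
  "essentially_bounded M f \<longleftrightarrow> (\<exists>C. AE x in M. \<bar>f x\<bar> \<le> C)"


section \<open>Dirichlet forms and carr\'e du champ operators\<close>

definition polarize :: "(('a \<Rightarrow> real) \<Rightarrow> real) \<Rightarrow> ('a \<Rightarrow> real) \<Rightarrow> ('a \<Rightarrow> real) \<Rightarrow> real" where
  "polarize q u v = (q (\<lambda>x. u x + v x) - q (\<lambda>x. u x - v x)) / 4"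

definition L2_subspace :: "'a measure \<Rightarrow> ('a \<Rightarrow> real) set \<Rightarrow> bool" where
  "L2_subspace M D \<longleftrightarrow> D \<subseteq> L2_space M \<and> (\<lambda>_. 0) \<in> D \<and>
     (\<forall>u\<in>D. \<forall>v\<in>D. (\<lambda>x. u x + v x) \<in> D) \<and>
     (\<forall>c. \<forall>u\<in>D. (\<lambda>x. c * u x) \<in> D) \<and>
     (\<forall>u\<in>D. \<forall>v\<in>borel_measurable M. (AE x in M. u x = v x) \<longrightarrow> v \<in> D)"

text \<open>A form is given by its quadratic functional \<open>q\<close>, a function of classes modulo null sets.\<close>

definition nonneg_quadratic_form ::
  "'a measure \<Rightarrow> ('a \<Rightarrow> real) set \<Rightarrow> (('a \<Rightarrow> real) \<Rightarrow> real) \<Rightarrow> bool" where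
  "nonneg_quadratic_form M D q \<longleftrightarrow> L2_subspace M D \<and>
     (\<forall>u\<in>D. \<forall>v\<in>D. (AE x in M. u x = v x) \<longrightarrow> q u = q v) \<and>
     (\<forall>u\<in>D. q u = polarize q u u \<and> 0 \<le> q u) \<and>
     (\<forall>u\<in>D. \<forall>v\<in>D. polarize q u v = polarize q v u) \<and>
     (\<forall>u\<in>D. \<forall>v\<in>D. \<forall>w\<in>D.
        polarize q (\<lambda>x. u x + v x) w = polarize q u w + polarize q v w) \<and>
     (\<forall>c. \<forall>u\<in>D. \<forall>v\<in>D. polarize q (\<lambda>x. c * u x) v = c * polarize q u v)"

definition form_norm :: "'a measure \<Rightarrow> (('a \<Rightarrow> real) \<Rightarrow> real) \<Rightarrow> ('a \<Rightarrow> real) \<Rightarrow> real" where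
  "form_norm M q u = sqrt ((L2_norm M u)\<^sup>2 + q u)"

definition closed_form ::
  "'a measure \<Rightarrow> ('a \<Rightarrow> real) set \<Rightarrow> (('a \<Rightarrow> real) \<Rightarrow> real) \<Rightarrow> bool" where
  "closed_form M D q \<longleftrightarrow>
     (\<forall>U. (\<forall>n::nat. U n \<in> D) \<and>
        (\<forall>e>0. \<exists>N. \<forall>m\<ge>N. \<forall>n\<ge>N. form_norm M q (\<lambda>x. U m x - U n x) < e) \<longrightarrow>
        (\<exists>u\<in>D. (\<lambda>n. form_norm M q (\<lambda>x. U n x - u x)) \<longlonglongrightarrow> 0))"

definition dirichlet_form ::
  "'a measure \<Rightarrow> ('a \<Rightarrow> real) set \<Rightarrow> (('a \<Rightarrow> real) \<Rightarrow> real) \<Rightarrow> bool" where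
  "dirichlet_form M D q \<longleftrightarrow>
     nonneg_quadratic_form M D q \<and> L2_dense M D \<and> closed_form M D q \<and>
     (\<forall>u\<in>D. \<forall>\<phi>. \<phi> 0 = 0 \<and> (\<forall>x y. \<bar>\<phi> x - \<phi> y\<bar> \<le> \<bar>x - y\<bar>) \<longrightarrow>
        (\<lambda>x. \<phi> (u x)) \<in> D \<and> q (\<lambda>x. \<phi> (u x)) \<le> q u)"

definition polarize_ptw ::
  "(('a \<Rightarrow> real) \<Rightarrow> 'a \<Rightarrow> real) \<Rightarrow> ('a \<Rightarrow> real) \<Rightarrow> ('a \<Rightarrow> real) \<Rightarrow> 'a \<Rightarrow> real" where
  "polarize_ptw G u v x = polarize (\<lambda>w. G w x) u v"

text \<open>The memberships \<open>f h \<in> D\<close> and \<open>f\<^sup>2 \<in> D\<close>, automatic for a Dirichlet form, are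
  recorded because the defining identity only makes sense with them.\<close>

definition carre_du_champ ::
  "'a measure \<Rightarrow> ('a \<Rightarrow> real) set \<Rightarrow> (('a \<Rightarrow> real) \<Rightarrow> real) \<Rightarrow>
   (('a \<Rightarrow> real) \<Rightarrow> 'a \<Rightarrow> real) \<Rightarrow> bool" where
  "carre_du_champ M D q G \<longleftrightarrow>
     (\<forall>u\<in>D. \<forall>v\<in>D. integrable M (polarize_ptw G u v)) \<and>
     (\<forall>u\<in>D. \<forall>v\<in>D. (AE x in M. u x = v x) \<longrightarrow> (AE x in M. G u x = G v x)) \<and>
     (\<forall>u\<in>D. AE x in M. G u x = polarize_ptw G u u x \<and> 0 \<le> G u x) \<and>
     (\<forall>u\<in>D. \<forall>v\<in>D. AE x in M. polarize_ptw G u v x = polarize_ptw G v u x) \<and>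
     (\<forall>u\<in>D. \<forall>v\<in>D. \<forall>w\<in>D. AE x in M.
        polarize_ptw G (\<lambda>y. u y + v y) w x = polarize_ptw G u w x + polarize_ptw G v w x) \<and>
     (\<forall>c. \<forall>u\<in>D. \<forall>v\<in>D. AE x in M.
        polarize_ptw G (\<lambda>y. c * u y) v x = c * polarize_ptw G u v x) \<and>
     (\<forall>f\<in>D. \<forall>h\<in>D. essentially_bounded M f \<and> essentially_bounded M h \<longrightarrow>
        (\<lambda>x. f x * h x) \<in> D \<and> (\<lambda>x. (f x)\<^sup>2) \<in> D \<and>
        2 * polarize q (\<lambda>x. f x * h x) f - polarize q h (\<lambda>x. (f x)\<^sup>2) = (\<integral>x. h x * G f x \<partial>M))"


section \<open>Wiener space and the Wiener integral\<close>

type_synonym path = "real \<Rightarrow> real"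

definition time01 :: "real measure" where
  "time01 = restrict_space lborel {0..1}"

definition C01 :: "path set" where
  "C01 = {\<omega> \<in> extensional {0..1}. continuous_on {0..1} \<omega>}"

text \<open>On \<open>C01\<close> the \<open>\<sigma>\<close>-algebra generated by the coordinates is the Borel \<open>\<sigma>\<close>-algebra of
  the uniform norm. The coordinate Brownian motion is \<open>B t \<omega> = \<omega> t\<close>. The conditions below
  determine the measure uniquely.\<close>

definition wiener_measure :: "path measure \<Rightarrow> bool" where
  "wiener_measure P \<longleftrightarrow> prob_space P \<and>
     sets P = sets (restrict_space (\<Pi>\<^sub>M t\<in>{0..1}. borel) C01) \<and>
     (AE \<omega> in P. \<omega> 0 = 0) \<and>
     (\<forall>s t. 0 \<le> s \<and> s < t \<and> t \<le> 1 \<longrightarrow>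
        distributed P lborel (\<lambda>\<omega>. \<omega> t - \<omega> s) (normal_density 0 (sqrt (t - s)))) \<and>
     (\<forall>(n::nat) (\<tau>::nat \<Rightarrow> real). 0 \<le> \<tau> 0 \<and> \<tau> n \<le> 1 \<and> (\<forall>i<n. \<tau> i \<le> \<tau> (Suc i)) \<longrightarrow>
        prob_space.indep_vars P (\<lambda>_. borel) (\<lambda>i \<omega>. \<omega> (\<tau> (Suc i)) - \<omega> (\<tau> i)) {..<n})"

definition step_integrals :: "((real \<Rightarrow> real) \<times> (path \<Rightarrow> real)) set" where
  "step_integrals =
     {(\<lambda>s. \<Sum>i<n. c i * indicator {\<tau> i<..\<tau> (Suc i)} s,
       \<lambda>\<omega>. \<Sum>i<n. c i * (\<omega> (\<tau> (Suc i)) - \<omega> (\<tau> i))) | (n::nat) c \<tau>.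
      0 \<le> \<tau> 0 \<and> \<tau> n \<le> 1 \<and> (\<forall>i<n. \<tau> i \<le> \<tau> (Suc i))}"

text \<open>\<open>has_wiener_integral P h X\<close>: \<open>h\<close> is in \<open>L\<^sup>2[0,1]\<close> and the random variable \<open>X\<close> is a
  version of \<open>\<integral>\<^sub>0\<^sup>1 h dB\<close>.\<close>

definition has_wiener_integral :: "path measure \<Rightarrow> (real \<Rightarrow> real) \<Rightarrow> (path \<Rightarrow> real) \<Rightarrow> bool" where
  "has_wiener_integral P h X \<longleftrightarrow> (h, X) \<in> L2_graph_closure time01 P step_integrals"


section \<open>The Ornstein--Uhlenbeck structure with deterministic weight\<close>

text \<open>A function on \<open>\<real>\<^sup>m\<close> is encoded as a function of a sequence that depends only on the
  coordinates \<open>i < m\<close>; the Lipschitz condition enforces this. For such functions continuity in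
  the product topology of \<^typ>\<open>nat \<Rightarrow> real\<close> is continuity on \<open>\<real>\<^sup>m\<close>. The function \<open>d i\<close> is
  the \<open>i\<close>-th partial derivative of \<open>\<Phi>\<close>.\<close>

definition C1_lipschitz ::
  "nat \<Rightarrow> ((nat \<Rightarrow> real) \<Rightarrow> real) \<Rightarrow> (nat \<Rightarrow> (nat \<Rightarrow> real) \<Rightarrow> real) \<Rightarrow> bool" where
  "C1_lipschitz m \<Phi> d \<longleftrightarrow>
     (\<exists>L. \<forall>x y. \<bar>\<Phi> x - \<Phi> y\<bar> \<le> L * L2_set (\<lambda>i. x i - y i) {..<m}) \<and>
     (\<forall>i<m. continuous_on UNIV (d i) \<and>
        (\<forall>x. ((\<lambda>s. \<Phi> (x(i := s))) has_real_derivative d i x) (at (x i))))"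

text \<open>Graph of the gradient on cylinder functions; \<open>L\<^sup>2(P; L\<^sup>2[0,1])\<close> is read as
  \<open>L\<^sup>2(P \<otimes> dt)\<close>.\<close>

definition ou_cylinder_graph ::
  "path measure \<Rightarrow> (real \<Rightarrow> real) \<Rightarrow> ((path \<Rightarrow> real) \<times> (path \<times> real \<Rightarrow> real)) set" where
  "ou_cylinder_graph P k =
     {(\<lambda>\<omega>. \<Phi> (\<lambda>i. X i \<omega>),
       \<lambda>(\<omega>, t). \<Sum>i<m. d i (\<lambda>j. X j \<omega>) * h i t * sqrt (k t)) | (m::nat) \<Phi> d h X.
      C1_lipschitz m \<Phi> d \<and>
      (\<forall>i<m. h i \<in> L2_space (density time01 (\<lambda>t. ennreal (1 + k t))) \<and>
         has_wiener_integral P (h i) (X i))}"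

definition ou_graph ::
  "path measure \<Rightarrow> (real \<Rightarrow> real) \<Rightarrow> ((path \<Rightarrow> real) \<times> (path \<times> real \<Rightarrow> real)) set" where
  "ou_graph P k = L2_graph_closure P (P \<Otimes>\<^sub>M time01) (ou_cylinder_graph P k)"

definition ou_domain :: "path measure \<Rightarrow> (real \<Rightarrow> real) \<Rightarrow> (path \<Rightarrow> real) set" where
  "ou_domain P k = {Y. \<exists>Z. (Y, Z) \<in> ou_graph P k}"

text \<open>The cylinder operator being closable, the choice is unique up to \<open>P \<otimes> dt\<close>-null sets
  for \<open>Y\<close> in the domain.\<close>

definition ou_gradient ::
  "path measure \<Rightarrow> (real \<Rightarrow> real) \<Rightarrow> (path \<Rightarrow> real) \<Rightarrow> path \<times> real \<Rightarrow> real" where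
  "ou_gradient P k Y = (SOME Z. (Y, Z) \<in> ou_graph P k)"


section \<open>The structure with random weight\<close>

definition random_weight_domain ::
  "path measure \<Rightarrow> (real \<Rightarrow> real) \<Rightarrow> (path \<Rightarrow> real \<Rightarrow> real) \<Rightarrow> (path \<Rightarrow> real) set" where
  "random_weight_domain P k \<alpha> = {Y \<in> ou_domain P k.
     (\<integral>\<^sup>+t. (\<integral>\<^sup>+\<omega>. ennreal ((ou_gradient P k Y (\<omega>, t))\<^sup>2 * (\<alpha> \<omega> t / k t)) \<partial>P) \<partial>time01) < \<infinity>}"

definition random_weight_form ::
  "path measure \<Rightarrow> (real \<Rightarrow> real) \<Rightarrow> (path \<Rightarrow> real \<Rightarrow> real) \<Rightarrow> (path \<Rightarrow> real) \<Rightarrow> real" where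
  "random_weight_form P k \<alpha> Y =
     1 / 2 * (\<integral>t. (\<integral>\<omega>. (ou_gradient P k Y (\<omega>, t))\<^sup>2 * (\<alpha> \<omega> t / k t) \<partial>P) \<partial>time01)"

definition random_weight_gamma ::
  "path measure \<Rightarrow> (real \<Rightarrow> real) \<Rightarrow> (path \<Rightarrow> real \<Rightarrow> real) \<Rightarrow> (path \<Rightarrow> real) \<Rightarrow> path \<Rightarrow> real" where
  "random_weight_gamma P k \<alpha> Y \<omega> =
     (\<integral>t. (ou_gradient P k Y (\<omega>, t))\<^sup>2 * (\<alpha> \<omega> t / k t) \<partial>time01)"

end

theory Submission
  imports Defs "HOL-Real_Asymp.Real_Asymp"
begin

text \<open>The weight \<open>k\<close> is integrable, being dominated by \<open>\<alpha>\<close>. Gaussian integration by parts against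
  directions \<open>sqrt k * 1\<^sub>B\<close> makes the cylinder gradient closable, and by closure the chain rule extends to
  its whole domain. Since \<open>\<alpha> / k \<ge> 1\<close>, convergence in the weighted energy implies convergence of the
  unweighted gradients, so closedness, contractions and the identity defining the carre du champ are
  inherited from the Ornstein--Uhlenbeck gradient. Functions of finitely many coordinates have a gradient
  bounded by a multiple of \<open>sqrt k\<close>, hence a weighted energy bounded by \<open>E \<integral> \<alpha> dt\<close>: this gives density.\<close>

section \<open>Square-integrable functions\<close>

text \<open>The energy is computed from a gradient selected by \<open>SOME\<close>, so nothing shows
  it to be quadratic before two candidates for the same variable are known to agree almost
  everywhere. This is closability. Together with density it is where the Gaussian structure enters;
  everything else concerns a closed linear graph with a C1 chain rule and a weight at least 1, and
  is done for an abstract graph in \<open>weighted_gradient\<close>.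

  Closability tests the gradient against products of cylinder functions, but a product of Lipschitz
  functions is again Lipschitz only under boundedness. The approximants are therefore composed with
  the sine, which is bounded and has derivative 1 at 0.

  General cylinder functions need not lie in the domain: their integrands are in L2((1+k)dt), which
  does not make \<open>h^2 * \<alpha>\<close> integrable. Increments have indicators as integrands;
  these are bounded, so such functions do lie in the domain, and they are still total.\<close>

lemma L2_spaceI:
  "f \<in> borel_measurable M \<Longrightarrow> integrable M (\<lambda>x. (f x)\<^sup>2) \<Longrightarrow> f \<in> L2_space M"
  by (simp add: L2_space_def)

lemma L2_measurable[measurable_dest]: "f \<in> L2_space M \<Longrightarrow> f \<in> borel_measurable M"
  by (simp add: L2_space_def)

lemma L2_integrable_square[intro]: "f \<in> L2_space M \<Longrightarrow> integrable M (\<lambda>x. (f x)\<^sup>2)"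
  by (simp add: L2_space_def)

lemma L2_integrable_mult:
  assumes "f \<in> L2_space M" "g \<in> L2_space M"
  shows "integrable M (\<lambda>x. f x * g x)"
proof (rule Bochner_Integration.integrable_bound)
  show "integrable M (\<lambda>x. (f x)\<^sup>2 + (g x)\<^sup>2)"
    using assms by (auto dest: L2_integrable_square)
  show "(\<lambda>x. f x * g x) \<in> borel_measurable M"
    using assms[THEN L2_measurable] by measurable
  have "\<bar>a * b\<bar> \<le> a\<^sup>2 + b\<^sup>2" for a b :: real
    using sum_squares_bound[of "\<bar>a\<bar>" "\<bar>b\<bar>"] mult_nonneg_nonneg[OF abs_ge_zero[of a] abs_ge_zero[of b]]
      unfolding abs_mult power2_abs by linarith
  then show "AE x in M. norm (f x * g x) \<le> norm ((f x)\<^sup>2 + (g x)\<^sup>2)"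
    by (simp add: abs_mult)
qed

lemma L2_bound:
  assumes "f \<in> borel_measurable M" "g \<in> L2_space M" "AE x in M. \<bar>f x\<bar> \<le> \<bar>g x\<bar>"
  shows "f \<in> L2_space M"
proof (rule L2_spaceI)
  show "integrable M (\<lambda>x. (f x)\<^sup>2)"
  proof (rule Bochner_Integration.integrable_bound[OF L2_integrable_square[OF assms(2)]])
    show "(\<lambda>x. (f x)\<^sup>2) \<in> borel_measurable M" using assms(1) by measurable
    show "AE x in M. norm ((f x)\<^sup>2) \<le> norm ((g x)\<^sup>2)"
      using assms(3) by eventually_elim (simp add: abs_le_square_iff)
  qed
qed fact

lemma L2_zero: "(\<lambda>x. 0) \<in> L2_space M"
  by (simp add: L2_space_def)

lemma L2_cmult: "f \<in> L2_space M \<Longrightarrow> (\<lambda>x. c * f x) \<in> L2_space M"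
  by (auto simp: L2_space_def power_mult_distrib)

lemma L2_add:
  assumes "f \<in> L2_space M" "g \<in> L2_space M"
  shows "(\<lambda>x. f x + g x) \<in> L2_space M"
proof (rule L2_spaceI)
  show "(\<lambda>x. f x + g x) \<in> borel_measurable M"
    using assms[THEN L2_measurable] by measurable
  have "integrable M (\<lambda>x. (f x)\<^sup>2 + (g x)\<^sup>2 + 2 * (f x * g x))"
    by (intro Bochner_Integration.integrable_add integrable_mult_right L2_integrable_square
        L2_integrable_mult assms)
  then show "integrable M (\<lambda>x. (f x + g x)\<^sup>2)"
    by (simp add: power2_sum mult.assoc)
qed

lemma L2_diff:
  assumes "f \<in> L2_space M" "g \<in> L2_space M"
  shows "(\<lambda>x. f x - g x) \<in> L2_space M"
  using L2_add[OF assms(1) L2_cmult[OF assms(2), of "-1"]] by simp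

lemma L2_sum: "(\<And>i. i \<in> I \<Longrightarrow> f i \<in> L2_space M) \<Longrightarrow> (\<lambda>x. \<Sum>i\<in>I. f i x) \<in> L2_space M"
  by (induction I rule: infinite_finite_induct) (auto simp: L2_zero intro: L2_add)

lemma L2_bounded_mult:
  assumes "f \<in> L2_space M" "g \<in> borel_measurable M" "AE x in M. \<bar>g x\<bar> \<le> C"
  shows "(\<lambda>x. g x * f x) \<in> L2_space M"
proof (rule L2_bound[OF _ L2_cmult[OF assms(1), of C]])
  show "(\<lambda>x. g x * f x) \<in> borel_measurable M"
    using assms(2) L2_measurable[OF assms(1)] by measurable
  show "AE x in M. \<bar>g x * f x\<bar> \<le> \<bar>C * f x\<bar>"
    using assms(3) by eventually_elim (auto simp: abs_mult intro!: mult_right_mono)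
qed

lemma L2_AE_cong:
  assumes "f \<in> L2_space M" "g \<in> borel_measurable M" "AE x in M. f x = g x"
  shows "g \<in> L2_space M"
  by (rule L2_bound[OF assms(2,1)]) (use assms(3) in \<open>auto elim!: eventually_mono\<close>)

lemma (in finite_measure) L2_bounded:
  assumes "f \<in> borel_measurable M" "AE x in M. \<bar>f x\<bar> \<le> C"
  shows "f \<in> L2_space M"
proof (rule L2_bound[OF assms(1)])
  show "(\<lambda>x. C) \<in> L2_space M" by (simp add: L2_space_def)
  show "AE x in M. \<bar>f x\<bar> \<le> \<bar>C\<bar>" using assms(2) by eventually_elim auto
qed

lemma (in finite_measure) L2_integrable:
  assumes "f \<in> L2_space M" shows "integrable M f"
proof -
  have "(\<lambda>x. 1) \<in> L2_space M" by (simp add: L2_space_def)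
  from L2_integrable_mult[OF assms this] show ?thesis by simp
qed

lemma L2_norm_nonneg: "0 \<le> L2_norm M f"
  by (simp add: L2_norm_def)

lemma L2_norm_square: "(L2_norm M f)\<^sup>2 = (\<integral>x. (f x)\<^sup>2 \<partial>M)"
  by (simp add: L2_norm_def)

lemma L2_norm_AE_cong:
  assumes "f \<in> borel_measurable M" "g \<in> borel_measurable M" "AE x in M. f x = g x"
  shows "L2_norm M f = L2_norm M g"
  unfolding L2_norm_def
  by (rule arg_cong[where f=sqrt], rule integral_cong_AE) (use assms in auto)

lemma L2_norm_mono:
  assumes "f \<in> borel_measurable M" "g \<in> L2_space M" "AE x in M. \<bar>f x\<bar> \<le> \<bar>g x\<bar>"
  shows "L2_norm M f \<le> L2_norm M g"
  unfolding L2_norm_def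
proof (rule real_sqrt_le_mono, rule integral_mono_AE)
  show "AE x in M. (f x)\<^sup>2 \<le> (g x)\<^sup>2"
    using assms(3) by eventually_elim (simp add: abs_le_square_iff)
qed (use L2_bound[OF assms] assms(2) in auto)

lemma L2_norm_cmult: "L2_norm M (\<lambda>x. c * f x) = \<bar>c\<bar> * L2_norm M f"
  by (simp add: L2_norm_def power_mult_distrib real_sqrt_mult)

lemma L2_norm_minus_commute: "L2_norm M (\<lambda>x. f x - g x) = L2_norm M (\<lambda>x. g x - f x)"
  by (simp add: L2_norm_def power2_commute)

lemma L2_Cauchy_Schwarz:
  assumes f: "f \<in> L2_space M" and g: "g \<in> L2_space M"
  shows "\<bar>\<integral>x. f x * g x \<partial>M\<bar> \<le> L2_norm M f * L2_norm M g"
proof -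
  define a b c where "a = (\<integral>x. (f x)\<^sup>2 \<partial>M)" and "b = (\<integral>x. f x * g x \<partial>M)"
    and "c = (\<integral>x. (g x)\<^sup>2 \<partial>M)"
  have pos: "0 \<le> s\<^sup>2 * a + 2 * s * t * b + t\<^sup>2 * c" for s t
  proof -
    have "0 \<le> (\<integral>x. (s * f x + t * g x)\<^sup>2 \<partial>M)" by simp
    also have "\<dots> = (\<integral>x. s\<^sup>2 * (f x)\<^sup>2 + 2 * s * t * (f x * g x) + t\<^sup>2 * (g x)\<^sup>2 \<partial>M)"
      by (intro Bochner_Integration.integral_cong) (auto simp: power2_eq_square algebra_simps)
    also have "\<dots> = s\<^sup>2 * a + 2 * s * t * b + t\<^sup>2 * c"
      using f g L2_integrable_mult[OF f g]
      by (auto simp: a_def b_def c_def dest!: L2_integrable_square)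
    finally show ?thesis .
  qed
  have nn: "0 \<le> a" "0 \<le> c" by (simp_all add: a_def c_def)
  have "b\<^sup>2 \<le> a * c"
  proof (cases "a = 0")
    case True
    have "b = 0"
    proof (rule ccontr)
      assume "b \<noteq> 0"
      \<comment> \<open>For a = 0 and t = 1 the polynomial is 2sb + c; this s gives it the value
        -1.\<close>
      with pos[of "-(c+1)/(2*b)" 1] True show False by (simp add: field_simps)
    qed
    with nn show ?thesis by simp
  next
    case False
    with nn have "0 < a" by simp
    \<comment> \<open>At s = b, t = -a the polynomial is a times the discriminant
      expression.\<close>
    have "0 \<le> a * (a * c - b\<^sup>2)"
      using pos[of b "-a"] by (simp add: power2_eq_square algebra_simps)
    with \<open>0 < a\<close> show ?thesis by (simp add: zero_le_mult_iff)
  qed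
  then have "sqrt (b\<^sup>2) \<le> sqrt (a * c)" by (rule real_sqrt_le_mono)
  then show ?thesis by (simp add: L2_norm_def a_def b_def c_def real_sqrt_mult)
qed

lemma L2_norm_triangle:
  assumes f: "f \<in> L2_space M" and g: "g \<in> L2_space M"
  shows "L2_norm M (\<lambda>x. f x + g x) \<le> L2_norm M f + L2_norm M g"
proof (rule power2_le_imp_le)
  have "(L2_norm M (\<lambda>x. f x + g x))\<^sup>2 = (\<integral>x. (f x)\<^sup>2 + (g x)\<^sup>2 + 2 * (f x * g x) \<partial>M)"
    unfolding L2_norm_square by (simp add: power2_sum mult.assoc)
  also have "\<dots> = (L2_norm M f)\<^sup>2 + (L2_norm M g)\<^sup>2 + 2 * (\<integral>x. f x * g x \<partial>M)"
    using f g L2_integrable_mult[OF f g] by (auto simp: L2_norm_square dest!: L2_integrable_square)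
  also have "\<dots> \<le> (L2_norm M f)\<^sup>2 + (L2_norm M g)\<^sup>2 + 2 * (L2_norm M f * L2_norm M g)"
    using L2_Cauchy_Schwarz[OF f g] by simp
  also have "\<dots> = (L2_norm M f + L2_norm M g)\<^sup>2" by (simp add: power2_sum)
  finally show "(L2_norm M (\<lambda>x. f x + g x))\<^sup>2 \<le> (L2_norm M f + L2_norm M g)\<^sup>2" .
qed (simp add: L2_norm_nonneg)

lemma L2_norm_triangle_diff:
  assumes "f \<in> L2_space M" "g \<in> L2_space M" "h \<in> L2_space M"
  shows "L2_norm M (\<lambda>x. f x - h x) \<le> L2_norm M (\<lambda>x. f x - g x) + L2_norm M (\<lambda>x. g x - h x)"
  using L2_norm_triangle[OF L2_diff[OF assms(1,2)] L2_diff[OF assms(2,3)]] by simp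

lemma (in prob_space) L1_le_L2_norm:
  assumes "f \<in> L2_space M"
  shows "(\<integral>x. \<bar>f x\<bar> \<partial>M) \<le> L2_norm M f"
proof -
  have "(\<lambda>x. \<bar>f x\<bar>) \<in> L2_space M" "(\<lambda>x. 1) \<in> L2_space M"
    by (rule L2_bound[OF _ assms], use assms in auto) (simp add: L2_space_def)
  from L2_Cauchy_Schwarz[OF this] show ?thesis
    by (auto simp: L2_norm_def prob_space)
qed

lemma L2_norm_zero_AE:
  assumes "f \<in> L2_space M" "L2_norm M f = 0"
  shows "AE x in M. f x = 0"
proof -
  have "(\<integral>x. (f x)\<^sup>2 \<partial>M) = 0" using assms(2) by (simp add: L2_norm_def)
  then have "AE x in M. (f x)\<^sup>2 = 0"
    using assms(1) by (subst (asm) integral_nonneg_eq_0_iff_AE) auto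
  then show ?thesis by simp
qed

section \<open>Convergence and completeness in L2\<close>

definition L2_conv :: "'a measure \<Rightarrow> (nat \<Rightarrow> 'a \<Rightarrow> real) \<Rightarrow> ('a \<Rightarrow> real) \<Rightarrow> bool" where
  "L2_conv M F f \<longleftrightarrow> (\<forall>n. F n \<in> L2_space M) \<and> f \<in> L2_space M \<and>
     (\<lambda>n. L2_norm M (\<lambda>x. F n x - f x)) \<longlonglongrightarrow> 0"

lemma L2_convD:
  assumes "L2_conv M F f"
  shows "F n \<in> L2_space M" "f \<in> L2_space M" "(\<lambda>n. L2_norm M (\<lambda>x. F n x - f x)) \<longlonglongrightarrow> 0"
  using assms by (auto simp: L2_conv_def)

lemma L2_conv_const: "f \<in> L2_space M \<Longrightarrow> L2_conv M (\<lambda>n. f) f"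
  by (simp add: L2_conv_def L2_norm_def)

lemma L2_conv_bound:
  assumes "\<And>n. F n \<in> L2_space M" "f \<in> L2_space M" "b \<longlonglongrightarrow> 0"
    "\<And>n. L2_norm M (\<lambda>x. F n x - f x) \<le> b n"
  shows "L2_conv M F f"
  unfolding L2_conv_def
  using assms by (auto intro: tendsto_sandwich[OF _ _ tendsto_const[of 0] assms(3)] simp: L2_norm_nonneg)

lemma L2_conv_add:
  assumes "L2_conv M F f" "L2_conv M G g"
  shows "L2_conv M (\<lambda>n x. F n x + G n x) (\<lambda>x. f x + g x)"
proof (rule L2_conv_bound)
  show "(\<lambda>n. L2_norm M (\<lambda>x. F n x - f x) + L2_norm M (\<lambda>x. G n x - g x)) \<longlonglongrightarrow> 0"
    using tendsto_add[OF L2_convD(3)[OF assms(1)] L2_convD(3)[OF assms(2)]] by simp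
  show "L2_norm M (\<lambda>x. (F n x + G n x) - (f x + g x)) \<le>
      L2_norm M (\<lambda>x. F n x - f x) + L2_norm M (\<lambda>x. G n x - g x)" for n
    using L2_norm_triangle[OF L2_diff[OF L2_convD(1,2)[OF assms(1)]] L2_diff[OF L2_convD(1,2)[OF assms(2)]]]
    by (simp add: algebra_simps)
qed (use assms in \<open>auto intro: L2_add dest: L2_convD\<close>)

lemma L2_conv_cmult:
  assumes "L2_conv M F f"
  shows "L2_conv M (\<lambda>n x. c * F n x) (\<lambda>x. c * f x)"
proof (rule L2_conv_bound)
  show "(\<lambda>n. \<bar>c\<bar> * L2_norm M (\<lambda>x. F n x - f x)) \<longlonglongrightarrow> 0"
    using tendsto_mult[OF tendsto_const L2_convD(3)[OF assms(1)]] by simp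
qed (use assms in \<open>auto intro: L2_cmult dest: L2_convD simp flip: right_diff_distrib simp: L2_norm_cmult\<close>)

lemma L2_conv_diff:
  assumes "L2_conv M F f" "L2_conv M G g"
  shows "L2_conv M (\<lambda>n x. F n x - G n x) (\<lambda>x. f x - g x)"
  using L2_conv_add[OF assms(1) L2_conv_cmult[OF assms(2), of "-1"]] by simp

lemma L2_conv_subseq: "L2_conv M F f \<Longrightarrow> strict_mono r \<Longrightarrow> L2_conv M (\<lambda>n. F (r n)) f"
  unfolding L2_conv_def
  using LIMSEQ_subseq_LIMSEQ[of "\<lambda>n. L2_norm M (\<lambda>x. F n x - f x)" 0 r] by (auto simp: o_def)

text \<open>The factors \<open>G n\<close> vary with n and need not converge; only their common
  bound enters. The chain rule needs this for derivatives evaluated along an approximating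
  sequence.\<close>

lemma L2_conv_mult_bounded:
  assumes "L2_conv M F f" "\<And>n. G n \<in> borel_measurable M" "\<And>n. AE x in M. \<bar>G n x\<bar> \<le> C"
  shows "L2_conv M (\<lambda>n x. G n x * (F n x - f x)) (\<lambda>x. 0)"
proof (rule L2_conv_bound)
  note d = L2_diff[OF L2_convD(1,2)[OF assms(1)]]
  show "(\<lambda>n. \<bar>C\<bar> * L2_norm M (\<lambda>x. F n x - f x)) \<longlonglongrightarrow> 0"
    using tendsto_mult[OF tendsto_const L2_convD(3)[OF assms(1)]] by simp
  show "(\<lambda>x. G n x * (F n x - f x)) \<in> L2_space M" for n
    by (rule L2_bounded_mult[OF d assms(2,3)])
  show "L2_norm M (\<lambda>x. G n x * (F n x - f x) - 0) \<le> \<bar>C\<bar> * L2_norm M (\<lambda>x. F n x - f x)" for n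
    unfolding L2_norm_cmult[symmetric] diff_zero
  proof (rule L2_norm_mono)
    show "(\<lambda>x. G n x * (F n x - f x)) \<in> borel_measurable M"
      using L2_bounded_mult[OF d assms(2,3)] by auto
    show "(\<lambda>x. C * (F n x - f x)) \<in> L2_space M" by (rule L2_cmult[OF d])
    show "AE x in M. \<bar>G n x * (F n x - f x)\<bar> \<le> \<bar>C * (F n x - f x)\<bar>"
      using assms(3)[of n] by eventually_elim (auto simp: abs_mult intro!: mult_right_mono)
  qed
qed (rule L2_zero)

lemma L2_conv_cmult_fun:
  assumes "L2_conv M F f" "g \<in> borel_measurable M" "AE x in M. \<bar>g x\<bar> \<le> C"
  shows "L2_conv M (\<lambda>n x. g x * F n x) (\<lambda>x. g x * f x)"
proof -
  have "L2_conv M (\<lambda>n x. g x * (F n x - f x) + g x * f x) (\<lambda>x. 0 + g x * f x)"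
    by (intro L2_conv_add L2_conv_mult_bounded L2_conv_const L2_bounded_mult)
      (use assms in \<open>auto dest: L2_convD\<close>)
  then show ?thesis by (simp add: algebra_simps)
qed

lemma L2_conv_dominated:
  assumes F: "\<And>n. F n \<in> borel_measurable M" and f: "f \<in> borel_measurable M"
    and g: "g \<in> L2_space M" and b: "\<And>n. AE x in M. \<bar>F n x\<bar> \<le> g x"
    and lim: "AE x in M. (\<lambda>n. F n x) \<longlonglongrightarrow> f x"
  shows "L2_conv M F f"
proof -
  have fb: "AE x in M. \<bar>f x\<bar> \<le> g x"
  proof -
    have "AE x in M. \<forall>n. \<bar>F n x\<bar> \<le> g x" using b by (simp add: AE_all_countable)
    with lim show ?thesis
      by eventually_elim (auto intro: LIMSEQ_le_const2[OF tendsto_rabs])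
  qed
  have FL: "F n \<in> L2_space M" for n
    by (rule L2_bound[OF F g]) (use b[of n] in \<open>auto elim!: eventually_mono\<close>)
  have fL: "f \<in> L2_space M"
    by (rule L2_bound[OF f g]) (use fb in \<open>auto elim!: eventually_mono\<close>)
  have "(\<lambda>n. \<integral>x. (F n x - f x)\<^sup>2 \<partial>M) \<longlonglongrightarrow> (\<integral>x. 0 \<partial>M)"
  proof (rule integral_dominated_convergence[where w="\<lambda>x. 4 * (g x)\<^sup>2"])
    show "integrable M (\<lambda>x. 4 * (g x)\<^sup>2)" using g by auto
    show "AE x in M. (\<lambda>n. (F n x - f x)\<^sup>2) \<longlonglongrightarrow> 0"
      using lim
    proof eventually_elim
      case (elim x)
      have "(\<lambda>n. (F n x - f x)\<^sup>2) \<longlonglongrightarrow> (f x - f x)\<^sup>2"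
        by (intro tendsto_intros elim)
      then show ?case by simp
    qed
    show "AE x in M. norm ((F n x - f x)\<^sup>2) \<le> 4 * (g x)\<^sup>2" for n
      using b[of n] fb
    proof eventually_elim
      case (elim x)
      then have "\<bar>F n x - f x\<bar> \<le> \<bar>2 * g x\<bar>" by linarith
      then have "(F n x - f x)\<^sup>2 \<le> (2 * g x)\<^sup>2" by (simp only: abs_le_square_iff)
      then show ?case by (simp add: power_mult_distrib)
    qed
  qed (use F f in measurable)
  then have "(\<lambda>n. L2_norm M (\<lambda>x. F n x - f x)) \<longlonglongrightarrow> 0"
    unfolding L2_norm_def using tendsto_real_sqrt by fastforce
  with FL fL show ?thesis by (simp add: L2_conv_def)
qed

lemma L2_conv_integral_mult:
  assumes "L2_conv M F f" "L2_conv M G g"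
  shows "(\<lambda>n. \<integral>x. F n x * G n x \<partial>M) \<longlonglongrightarrow> (\<integral>x. f x * g x \<partial>M)"
proof -
  note F = L2_convD[OF assms(1)] and G = L2_convD[OF assms(2)]
  note dF = L2_diff[OF F(1,2)] and dG = L2_diff[OF G(1,2)]
  let ?a = "\<lambda>n. L2_norm M (\<lambda>x. F n x - f x)" and ?b = "\<lambda>n. L2_norm M (\<lambda>x. G n x - g x)"
  \<comment> \<open>The error of a product splits into one term with both differences and two terms
    with a single one; Cauchy-Schwarz makes each of them small.\<close>
  have eq: "(\<integral>x. F n x * G n x \<partial>M) - (\<integral>x. f x * g x \<partial>M) =
      (\<integral>x. (F n x - f x) * (G n x - g x) \<partial>M) + (\<integral>x. (F n x - f x) * g x \<partial>M)
      + (\<integral>x. f x * (G n x - g x) \<partial>M)" for n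
  proof -
    have "(\<integral>x. F n x * G n x \<partial>M) = (\<integral>x. (F n x - f x) * (G n x - g x) + (F n x - f x) * g x
      + f x * (G n x - g x) + f x * g x \<partial>M)"
      by (intro Bochner_Integration.integral_cong) (auto simp: algebra_simps)
    also have "\<dots> = (\<integral>x. (F n x - f x) * (G n x - g x) \<partial>M) + (\<integral>x. (F n x - f x) * g x \<partial>M)
      + (\<integral>x. f x * (G n x - g x) \<partial>M) + (\<integral>x. f x * g x \<partial>M)"
      by (subst Bochner_Integration.integral_add,
          (intro L2_integrable_mult Bochner_Integration.integrable_add dF dG F(2) G(2))+)+ simp
    finally show ?thesis by simp
  qed
  have "(\<lambda>n. (\<integral>x. F n x * G n x \<partial>M) - (\<integral>x. f x * g x \<partial>M)) \<longlonglongrightarrow> 0"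
  proof (rule Lim_null_comparison)
    show "(\<lambda>n. ?a n * ?b n + ?a n * L2_norm M g + L2_norm M f * ?b n) \<longlonglongrightarrow> 0"
      using F(3) G(3) by (auto intro!: tendsto_eq_intros)
    show "\<forall>\<^sub>F n in sequentially. norm ((\<integral>x. F n x * G n x \<partial>M) - (\<integral>x. f x * g x \<partial>M))
        \<le> ?a n * ?b n + ?a n * L2_norm M g + L2_norm M f * ?b n"
      using L2_Cauchy_Schwarz[OF dF dG] L2_Cauchy_Schwarz[OF dF G(2)] L2_Cauchy_Schwarz[OF F(2) dG]
      unfolding eq real_norm_def by (intro always_eventually allI order_trans[OF abs_triangle_ineq] add_mono) auto
  qed
  then show ?thesis by (simp add: LIM_zero_iff)
qed

lemma L2_conv_norm:
  assumes "L2_conv M F f"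
  shows "(\<lambda>n. L2_norm M (F n)) \<longlonglongrightarrow> L2_norm M f"
  unfolding L2_norm_def power2_eq_square
  by (intro tendsto_real_sqrt L2_conv_integral_mult assms)

lemma L2_conv_AE_cong:
  assumes "L2_conv M F f" "g \<in> borel_measurable M" "AE x in M. f x = g x"
  shows "L2_conv M F g"
proof -
  have g: "g \<in> L2_space M"
    by (rule L2_AE_cong[OF L2_convD(2)[OF assms(1)] assms(2,3)])
  have "L2_norm M (\<lambda>x. F n x - g x) = L2_norm M (\<lambda>x. F n x - f x)" for n
    by (rule L2_norm_AE_cong)
      (use assms(3) in \<open>auto intro!: L2_measurable L2_diff L2_convD(1,2)[OF assms(1)] g\<close>)
  with g L2_convD[OF assms(1)] show ?thesis by (simp add: L2_conv_def)
qed

lemma (in prob_space) L2_conv_AE_subseq: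
  assumes "L2_conv M F f"
  shows "\<exists>r. strict_mono r \<and> (AE x in M. (\<lambda>n. F (r n) x) \<longlonglongrightarrow> f x)"
proof -
  note d = L2_diff[OF L2_convD(1,2)[OF assms]]
  have "\<exists>r::nat\<Rightarrow>nat. strict_mono r \<and> (AE x in M. (\<lambda>n. (\<lambda>n x. F n x - f x) (r n) x) \<longlonglongrightarrow> 0)"
  proof (rule tendsto_L1_AE_subseq)
    show "integrable M (\<lambda>x. F n x - f x)" for n by (rule L2_integrable[OF d])
    show "(\<lambda>n. \<integral>x. norm (F n x - f x) \<partial>M) \<longlonglongrightarrow> 0"
      by (rule tendsto_sandwich[OF _ _ tendsto_const L2_convD(3)[OF assms]])
        (use L1_le_L2_norm[OF d] in auto)
  qed
  then show ?thesis by (auto simp: LIM_zero_iff)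
qed

text \<open>Riesz-Fischer: along a subsequence whose consecutive distances are at most
  \<open>(1/2)^j\<close> the increments are absolutely summable almost everywhere, and Fatou's lemma
  carries the Cauchy estimate over to the pointwise limit.\<close>

lemma (in prob_space) L2_complete:
  assumes F: "\<And>n. F n \<in> L2_space M"
    and cauchy: "\<And>e. 0 < e \<Longrightarrow> \<exists>N. \<forall>m\<ge>N. \<forall>n\<ge>N. L2_norm M (\<lambda>x. F m x - F n x) < e"
  shows "\<exists>f. L2_conv M F f"
proof -
  have "\<exists>N. \<forall>m\<ge>N. \<forall>n\<ge>N. L2_norm M (\<lambda>x. F m x - F n x) < (1/2)^j" for j :: nat
    by (rule cauchy) simp
  then obtain N where N: "\<And>j m n. m \<ge> N j \<Longrightarrow> n \<ge> N j \<Longrightarrow> L2_norm M (\<lambda>x. F m x - F n x) < (1/2)^j"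
    by metis
  \<comment> \<open>The maximum keeps \<open>K\<close> strictly increasing while staying above the
    thresholds \<open>N\<close>.\<close>
  define K where "K = rec_nat (N 0) (\<lambda>j k. max (Suc k) (N (Suc j)))"
  have K_Suc: "K (Suc j) = max (Suc (K j)) (N (Suc j))" for j by (simp add: K_def)
  have K: "strict_mono K" by (rule strict_monoI_Suc) (simp add: K_Suc)
  have NK: "N j \<le> K j" for j by (cases j) (simp_all add: K_def)
  define D where "D j x = F (K (Suc j)) x - F (K j) x" for j x
  have D: "D j \<in> L2_space M" for j unfolding D_def by (intro L2_diff F)
  have Dm[measurable]: "D j \<in> borel_measurable M" for j using D by auto
  have Fm[measurable]: "F j \<in> borel_measurable M" for j using F by auto
  have Dle: "(\<integral>\<^sup>+x. ennreal \<bar>D j x\<bar> \<partial>M) \<le> ennreal ((1/2)^j)" for j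
  proof -
    have "(\<integral>\<^sup>+x. ennreal \<bar>D j x\<bar> \<partial>M) = ennreal (\<integral>x. \<bar>D j x\<bar> \<partial>M)"
      by (rule nn_integral_eq_integral) (use L2_integrable[OF D] in auto)
    also have "\<dots> \<le> ennreal ((1/2)^j)"
    proof (rule ennreal_leI)
      have "N j \<le> K (Suc j)" using NK[of j] strict_monoD[OF K, of j "Suc j"] by simp
      from N[OF this NK] have "L2_norm M (D j) \<le> (1/2)^j" unfolding D_def by simp
      with L1_le_L2_norm[OF D, of j] show "(\<integral>x. \<bar>D j x\<bar> \<partial>M) \<le> (1/2)^j" by simp
    qed
    finally show ?thesis .
  qed
  have "(\<integral>\<^sup>+x. (\<Sum>j. ennreal \<bar>D j x\<bar>) \<partial>M) = (\<Sum>j. \<integral>\<^sup>+x. ennreal \<bar>D j x\<bar> \<partial>M)"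
    by (rule nn_integral_suminf) measurable
  also have "\<dots> \<le> (\<Sum>j. ennreal ((1/2)^j))" by (rule suminf_le) (auto intro: Dle)
  also have "\<dots> = ennreal 2"
    by (subst suminf_ennreal_eq[OF _ geometric_sums[of "1/2::real", simplified]]) auto
  finally have "(\<integral>\<^sup>+x. (\<Sum>j. ennreal \<bar>D j x\<bar>) \<partial>M) \<noteq> \<infinity>" by (auto simp: top_unique)
  then have "AE x in M. (\<Sum>j. ennreal \<bar>D j x\<bar>) \<noteq> \<infinity>"
    by (intro nn_integral_PInf_AE) auto
  then have conv: "AE x in M. convergent (\<lambda>j. F (K j) x)"
  proof (rule eventually_mono)
    fix x assume "(\<Sum>j. ennreal \<bar>D j x\<bar>) \<noteq> \<infinity>"
    then have "summable (\<lambda>j. \<bar>D j x\<bar>)"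
      by (intro summable_suminf_not_top) simp_all
    then have "summable (\<lambda>j. D j x)" by (rule summable_rabs_cancel)
    then have "convergent (\<lambda>n. \<Sum>j<n. D j x)" by (simp add: summable_iff_convergent)
    moreover have "(\<Sum>j<n. D j x) = F (K n) x - F (K 0) x" for n
      unfolding D_def by (rule sum_lessThan_telescope)
    ultimately have "convergent (\<lambda>n. F (K n) x - F (K 0) x)" by simp
    then have "convergent (\<lambda>n. (F (K n) x - F (K 0) x) + F (K 0) x)"
      by (intro convergent_add convergent_const)
    then show "convergent (\<lambda>j. F (K j) x)" by simp
  qed
  \<comment> \<open>Where the subsequence diverges \<open>lim\<close> is an arbitrary value; the
    function is measurable all the same and the exceptional set is null.\<close>
  define f where "f x = lim (\<lambda>j. F (K j) x)" for x
  have fm[measurable]: "f \<in> borel_measurable M" unfolding f_def by measurable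
  \<comment> \<open>Fatou in the second index of the Cauchy estimate. It yields at once the
    integrability of the squared difference and the bound on its norm.\<close>
  have fatou: "(\<lambda>x. F n x - f x) \<in> L2_space M \<and> L2_norm M (\<lambda>x. F n x - f x) \<le> e"
    if e: "0 < e" "\<And>m n. m \<ge> N0 \<Longrightarrow> n \<ge> N0 \<Longrightarrow> L2_norm M (\<lambda>x. F m x - F n x) < e" "n \<ge> N0" for e n N0
  proof -
    have "(\<integral>\<^sup>+x. ennreal ((F n x - f x)\<^sup>2) \<partial>M) \<le>
        (\<integral>\<^sup>+x. liminf (\<lambda>j. ennreal ((F n x - F (K j) x)\<^sup>2)) \<partial>M)"
    proof (rule nn_integral_mono_AE)
      show "AE x in M. ennreal ((F n x - f x)\<^sup>2) \<le> liminf (\<lambda>j. ennreal ((F n x - F (K j) x)\<^sup>2))"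
        using conv
      proof eventually_elim
        case (elim x)
        then have "(\<lambda>j. F (K j) x) \<longlonglongrightarrow> f x" by (simp add: convergent_LIMSEQ_iff f_def)
        then have "(\<lambda>j. ennreal ((F n x - F (K j) x)\<^sup>2)) \<longlonglongrightarrow> ennreal ((F n x - f x)\<^sup>2)"
          by (intro tendsto_intros)
        from lim_imp_Liminf[OF sequentially_bot this] show ?case by (rule eq_refl[OF sym])
      qed
    qed
    also have "\<dots> \<le> liminf (\<lambda>j. \<integral>\<^sup>+x. ennreal ((F n x - F (K j) x)\<^sup>2) \<partial>M)"
      by (rule nn_integral_liminf) measurable
    also have "\<dots> \<le> ennreal (e\<^sup>2)"
    proof (rule Liminf_le)
      show "\<forall>\<^sub>F j in sequentially. (\<integral>\<^sup>+x. ennreal ((F n x - F (K j) x)\<^sup>2) \<partial>M) \<le> ennreal (e\<^sup>2)"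
        using eventually_ge_at_top[of N0]
      proof eventually_elim
        case (elim j)
        then have "N0 \<le> K j" using strict_mono_imp_increasing[OF K, of j] by simp
        from e(2)[OF e(3) this] have "(L2_norm M (\<lambda>x. F n x - F (K j) x))\<^sup>2 \<le> e\<^sup>2"
          by (intro power_mono) (auto simp: L2_norm_nonneg)
        then show ?case unfolding L2_norm_square
          by (subst nn_integral_eq_integral) (auto intro!: L2_integrable_square L2_diff F ennreal_leI)
      qed
    qed simp
    finally have le: "(\<integral>\<^sup>+x. ennreal ((F n x - f x)\<^sup>2) \<partial>M) \<le> ennreal (e\<^sup>2)" .
    have int: "integrable M (\<lambda>x. (F n x - f x)\<^sup>2)"
      by (rule integrableI_bounded) (use le in \<open>auto simp: top_unique less_top[symmetric]\<close>)
    have "(\<integral>x. (F n x - f x)\<^sup>2 \<partial>M) \<le> e\<^sup>2"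
      using le by (subst (asm) nn_integral_eq_integral[OF int]) auto
    then have "L2_norm M (\<lambda>x. F n x - f x) \<le> sqrt (e\<^sup>2)"
      unfolding L2_norm_def by (rule real_sqrt_le_mono)
    with int \<open>0 < e\<close> show ?thesis by (simp add: L2_space_def)
  qed
  have "(\<lambda>n. L2_norm M (\<lambda>x. F n x - f x)) \<longlonglongrightarrow> 0"
  proof (rule LIMSEQ_I)
    fix r :: real assume "0 < r"
    then obtain N0 where N0: "\<And>m n. m \<ge> N0 \<Longrightarrow> n \<ge> N0 \<Longrightarrow> L2_norm M (\<lambda>x. F m x - F n x) < r/2"
      using cauchy[of "r/2"] by auto
    have "norm (L2_norm M (\<lambda>x. F n x - f x) - 0) < r" if "n \<ge> N0" for n
      using fatou[OF _ N0 that] \<open>0 < r\<close> L2_norm_nonneg[of M "\<lambda>x. F n x - f x"] by fastforce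
    then show "\<exists>no. \<forall>n\<ge>no. norm (L2_norm M (\<lambda>x. F n x - f x) - 0) < r" by blast
  qed
  moreover have "f \<in> L2_space M"
  proof -
    obtain N0 where N0: "\<And>m n. m \<ge> N0 \<Longrightarrow> n \<ge> N0 \<Longrightarrow> L2_norm M (\<lambda>x. F m x - F n x) < 1"
      using cauchy[of 1] by auto
    from fatou[OF _ N0 order_refl] have "(\<lambda>x. F N0 x - f x) \<in> L2_space M" by simp
    from L2_diff[OF F[of N0] this] show ?thesis by simp
  qed
  ultimately show ?thesis using F by (auto simp: L2_conv_def)
qed

section \<open>Closed subspaces and the monotone class argument\<close>

definition L2_closed_subspace :: "'a measure \<Rightarrow> ('a \<Rightarrow> real) set \<Rightarrow> bool" where
  "L2_closed_subspace M H \<longleftrightarrow> H \<subseteq> L2_space M \<and> (\<lambda>x. 0) \<in> H \<and>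
     (\<forall>f\<in>H. \<forall>g\<in>H. (\<lambda>x. f x + g x) \<in> H) \<and> (\<forall>c. \<forall>f\<in>H. (\<lambda>x. c * f x) \<in> H) \<and>
     (\<forall>F f. (\<forall>n. F n \<in> H) \<longrightarrow> L2_conv M F f \<longrightarrow> f \<in> H)"

lemma L2_closed_subspace_sum:
  assumes "L2_closed_subspace M H" "\<And>i. i \<in> I \<Longrightarrow> f i \<in> H"
  shows "(\<lambda>x. \<Sum>i\<in>I. f i x) \<in> H"
  using assms(2) by (induction I rule: infinite_finite_induct)
    (use assms(1) in \<open>auto simp: L2_closed_subspace_def\<close>)

text \<open>The sets whose indicator lies in \<open>H\<close> form a Dynkin system, so they exhaust
  the \<sigma>-algebra generated by the stable class \<open>E\<close>. Nonnegative functions follow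
  by monotone approximation, dominated by the function itself, and the others by splitting into
  positive and negative part.\<close>

lemma (in finite_measure) L2_closed_subspace_eq_UNIV:
  assumes H: "L2_closed_subspace M H"
    and E: "Int_stable E" "E \<subseteq> Pow (space M)" "sets M = sigma_sets (space M) E"
    and top: "indicator (space M) \<in> H" and ind: "\<And>A. A \<in> E \<Longrightarrow> indicator A \<in> H"
  shows "H = L2_space M"
proof
  show "H \<subseteq> L2_space M" using H by (simp add: L2_closed_subspace_def)
  have add: "\<And>f g. f \<in> H \<Longrightarrow> g \<in> H \<Longrightarrow> (\<lambda>x. f x + g x) \<in> H"
    and scale: "\<And>c f. f \<in> H \<Longrightarrow> (\<lambda>x. c * f x) \<in> H"
    and lim: "\<And>F f. (\<And>n. F n \<in> H) \<Longrightarrow> L2_conv M F f \<Longrightarrow> f \<in> H"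
    and zero: "(\<lambda>x. 0) \<in> H" and sub: "H \<subseteq> L2_space M"
    using H unfolding L2_closed_subspace_def by blast+
  have one: "(\<lambda>x. 1) \<in> L2_space M" by (simp add: L2_space_def)
  have meas: "indicator A \<in> H" if "A \<in> sets M" for A
    using E(1,2) that[unfolded E(3)]
  proof (induction rule: sigma_sets_induct_disjoint)
    case (basic A) then show ?case by (rule ind)
  next
    case empty
    have "indicator {} = (\<lambda>x. 0::real)" by auto
    then show ?case using zero by simp
  next
    case (compl A)
    then have A: "A \<in> sets M" by (simp add: E(3))
    have "(\<lambda>x. indicator (space M) x + (-1) * indicator A x :: real) \<in> H"
      by (intro add top scale compl)
    moreover have "(\<lambda>x. indicator (space M) x + (-1) * indicator A x :: real) = indicator (space M - A)"
      using sets.sets_into_space[OF A] by (auto simp: indicator_def fun_eq_iff)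
    ultimately show ?case by simp
  next
    case (union A)
    then have A[measurable]: "A i \<in> sets M" for i by (auto simp: E(3))
    have eq: "(\<Sum>i<n. indicator (A i) x) = (indicator (\<Union>i<n. A i) x :: real)" for n x
      using union(1) by (intro indicator_UN_disjoint[symmetric]) (auto simp: disjoint_family_on_def)
    show ?case
    proof (rule lim)
      show "(\<lambda>x. \<Sum>i<n. indicator (A i) x) \<in> H" for n
        by (intro L2_closed_subspace_sum[OF H] union)
      show "L2_conv M (\<lambda>n x. \<Sum>i<n. indicator (A i) x) (indicator (\<Union>i. A i))"
        unfolding eq
      proof (rule L2_conv_dominated[OF _ _ one])
        show "AE x in M. \<bar>indicator (\<Union>i<n. A i) x\<bar> \<le> (1::real)" for n
          by (simp add: indicator_def)
        show "AE x in M. (\<lambda>n. indicator (\<Union>i<n. A i) x :: real) \<longlonglongrightarrow> indicator (\<Union>i. A i) x"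
          by (intro AE_I2 LIMSEQ_indicator_UN)
      qed measurable
    qed
  qed
  have nonneg: "u \<in> H" if "u \<in> L2_space M" "\<And>x. 0 \<le> u x" for u
  proof -
    have "u \<in> borel_measurable M" using that by auto
    then show ?thesis using that(2,1)
    proof (induction u rule: borel_measurable_induct_real)
      case (set A) then show ?case by (intro meas)
    next
      case (mult u c)
      show ?case
      proof (cases "c = 0")
        case False
        from L2_cmult[OF mult(5), of "1/c"] False mult show ?thesis by (intro scale) auto
      qed (simp add: zero)
    next
      case (add u v)
      \<comment> \<open>Nonnegative summands are dominated by their sum, which is the function known
        to be in L2.\<close>
      have "u \<in> L2_space M" "v \<in> L2_space M"
        by (rule L2_bound[OF _ add(8)]; use add in \<open>simp\<close>)+
      then show ?case using add by (intro \<open>\<And>f g. f \<in> H \<Longrightarrow> g \<in> H \<Longrightarrow> (\<lambda>x. f x + g x) \<in> H\<close>) auto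
    next
      case (seq U)
      have le: "U i x \<le> u x" if "x \<in> space M" for i x
        by (rule incseq_le[OF _ seq(4)]) (use seq that in \<open>auto simp: incseq_def le_fun_def\<close>)
      have UL: "U i \<in> L2_space M" for i
        by (rule L2_bound[OF _ seq(6)]) (use seq(1,2) le in \<open>auto intro!: AE_I2 order_trans[OF le abs_ge_self]\<close>)
      show ?case
      proof (rule lim)
        show "U i \<in> H" for i using seq UL by auto
        show "L2_conv M U u"
          by (rule L2_conv_dominated[OF _ _ seq(6)]) (use seq le in auto)
      qed
    qed
  qed
  show "L2_space M \<subseteq> H"
  proof
    fix f assume f: "f \<in> L2_space M"
    then have [measurable]: "f \<in> borel_measurable M" by auto
    have "(\<lambda>x. max 0 (f x)) \<in> H"
      by (rule nonneg, rule L2_bound[OF _ f]) auto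
    moreover have "(\<lambda>x. max 0 (- f x)) \<in> H"
      by (rule nonneg, rule L2_bound[OF _ f]) auto
    ultimately have "(\<lambda>x. max 0 (f x) + (-1) * max 0 (- f x)) \<in> H" by (intro add scale)
    moreover have "(\<lambda>x. max 0 (f x) + (-1) * max 0 (- f x)) = f" by (auto simp: max_def)
    ultimately show "f \<in> H" by simp
  qed
qed

text \<open>The substantial inclusion is phrased as measurability of the identity, so that on path
  space it can be checked one coordinate at a time.\<close>

lemma sigma_sets_eq_setsI:
  assumes "E \<subseteq> sets M" "(\<lambda>x. x) \<in> measurable (sigma (space M) E) M"
  shows "sets M = sigma_sets (space M) E"
proof
  have E: "E \<subseteq> Pow (space M)" using assms(1) sets.sets_into_space by blast
  show "sigma_sets (space M) E \<subseteq> sets M" by (rule sets.sigma_sets_subset[OF assms(1)])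
  show "sets M \<subseteq> sigma_sets (space M) E"
  proof
    fix A assume A: "A \<in> sets M"
    from measurable_sets[OF assms(2) A] have "A \<inter> space M \<in> sigma_sets (space M) E"
      using E by (simp add: space_measure_of)
    then show "A \<in> sigma_sets (space M) E" using sets.sets_into_space[OF A] by (simp add: Int_absorb2)
  qed
qed

section \<open>Weighted forms of a gradient with chain rule\<close>

lemma AE_pair_fst:
  assumes "sigma_finite_measure T" "AE x in M. Q x"
  shows "AE p in M \<Otimes>\<^sub>M T. Q (fst p)"
proof -
  interpret T: sigma_finite_measure T by fact
  from assms(2) obtain A where A: "A \<in> null_sets M" "{x \<in> space M. \<not> Q x} \<subseteq> A"
    by (auto elim!: AE_E simp: null_sets_def)
  show ?thesis
  proof (rule AE_I')
    show "A \<times> space T \<in> null_sets (M \<Otimes>\<^sub>M T)"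
      using A by (auto simp: null_sets_def T.emeasure_pair_measure_Times)
    show "{p \<in> space (M \<Otimes>\<^sub>M T). \<not> Q (fst p)} \<subseteq> A \<times> space T"
      using A(2) by (auto simp: space_pair_measure)
  qed
qed

text \<open>The approximation is the average of \<open>\<phi>\<close> over [x, x + e]. Its
  derivative is a difference quotient of \<open>\<phi>\<close>, hence continuous and bounded by the
  Lipschitz constant 1.\<close>

lemma C1_mollification:
  fixes \<phi> :: "real \<Rightarrow> real" and e :: real
  assumes lip: "\<And>x y. \<bar>\<phi> x - \<phi> y\<bar> \<le> \<bar>x - y\<bar>" and e: "0 < e"
  shows "\<exists>\<psi> \<psi>'. (\<forall>x. (\<psi> has_real_derivative \<psi>' x) (at x)) \<and> continuous_on UNIV \<psi>' \<and>
    (\<forall>x. \<bar>\<psi>' x\<bar> \<le> 1) \<and> (\<forall>x. \<bar>\<psi> x - \<phi> x\<bar> \<le> e)"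
proof -
  have cont: "continuous_on UNIV \<phi>"
    by (rule lipschitz_on_continuous_on[of 1]) (auto intro!: lipschitz_onI simp: dist_real_def lip)
  then have isC: "isCont \<phi> x" for x by (simp add: continuous_on_eq_continuous_at)
  obtain A where "\<And>x. (A has_vector_derivative \<phi> x) (at x)"
    using einterval_antiderivative[of "-\<infinity>" "\<infinity>" \<phi>] isC by auto
  then have A: "(A has_real_derivative \<phi> x) (at x)" for x
    by (simp add: has_real_derivative_iff_has_vector_derivative)
  define \<psi> \<psi>' where "\<psi> x = (A (x + e) - A x) / e" and "\<psi>' x = (\<phi> (x + e) - \<phi> x) / e" for x
  have A_shift: "((\<lambda>x. A (x + e)) has_real_derivative \<phi> (x + e)) (at x)" for x
    using A[of "x + e"] by (simp add: DERIV_shift)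
  have "(\<psi> has_real_derivative \<psi>' x) (at x)" for x
    unfolding \<psi>_def \<psi>'_def by (intro DERIV_cdivide DERIV_diff A A_shift)
  moreover have "continuous_on UNIV \<psi>'"
    unfolding \<psi>'_def using e
    by (intro continuous_intros continuous_on_compose2[OF cont]) auto
  moreover have "\<bar>\<psi>' x\<bar> \<le> 1" for x
    using lip[of "x + e" x] e by (simp add: \<psi>'_def)
  moreover have "\<bar>\<psi> x - \<phi> x\<bar> \<le> e" for x
  proof -
    \<comment> \<open>By the mean value theorem for the antiderivative the average is itself a value
      of \<open>\<phi>\<close> at distance less than e from x.\<close>
    obtain z where z: "x < z" "z < x + e" "A (x + e) - A x = (x + e - x) * \<phi> z"
      using MVT2[of x "x + e" A \<phi>] A e by auto
    then have "\<psi> x = \<phi> z" using e by (simp add: \<psi>_def)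
    with lip[of z x] z show ?thesis by simp
  qed
  ultimately show ?thesis by blast
qed

text \<open>A closed linear operator into L2(M x T) given by its graph, so that no version of a
  gradient has to be chosen while computing. \<open>G_unique\<close> is closability, and
  \<open>w\<close> will be \<alpha>/k, which makes \<open>w_ge_1\<close> the condition that \<alpha>
  dominates k.\<close>

locale weighted_gradient = M: prob_space M + T: prob_space T
  for M :: "'a measure" and T :: "'b measure" +
  fixes G :: "(('a \<Rightarrow> real) \<times> ('a \<times> 'b \<Rightarrow> real)) set" and w :: "'a \<times> 'b \<Rightarrow> real"
  assumes G_L2: "(u, Z) \<in> G \<Longrightarrow> u \<in> L2_space M" "(u, Z) \<in> G \<Longrightarrow> Z \<in> L2_space (M \<Otimes>\<^sub>M T)"
    and G_zero: "(\<lambda>_. 0, \<lambda>_. 0) \<in> G"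
    and G_add: "(u, Z) \<in> G \<Longrightarrow> (v, Y) \<in> G \<Longrightarrow> (\<lambda>x. u x + v x, \<lambda>p. Z p + Y p) \<in> G"
    and G_cmult: "(u, Z) \<in> G \<Longrightarrow> (\<lambda>x. c * u x, \<lambda>p. c * Z p) \<in> G"
    and G_closed: "(\<And>n. (F n, H n) \<in> G) \<Longrightarrow> L2_conv M F u \<Longrightarrow> L2_conv (M \<Otimes>\<^sub>M T) H Z \<Longrightarrow> (u, Z) \<in> G"
    and G_unique: "(u, Z) \<in> G \<Longrightarrow> (u, Y) \<in> G \<Longrightarrow> AE p in M \<Otimes>\<^sub>M T. Z p = Y p"
    and G_chain: "(u, Z) \<in> G \<Longrightarrow> (\<And>x. (\<psi> has_real_derivative \<psi>' x) (at x)) \<Longrightarrow>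
      continuous_on UNIV \<psi>' \<Longrightarrow> (\<And>x. \<bar>\<psi>' x\<bar> \<le> L) \<Longrightarrow>
      (\<lambda>x. \<psi> (u x), \<lambda>p. \<psi>' (u (fst p)) * Z p) \<in> G"
    and w_measurable[measurable]: "w \<in> borel_measurable (M \<Otimes>\<^sub>M T)"
    and w_ge_1: "AE p in M \<Otimes>\<^sub>M T. 1 \<le> w p"
begin

sublocale N: pair_prob_space M T ..

abbreviation "N \<equiv> M \<Otimes>\<^sub>M T"

text \<open>Repeats the choice made in \<open>ou_gradient\<close>; likewise \<open>dom\<close>,
  \<open>form\<close> and \<open>gam\<close> keep the order of integration of the
  \<open>random_weight\<close> notions, so that they can be identified by mere unfolding.\<close>

definition grad :: "('a \<Rightarrow> real) \<Rightarrow> 'a \<times> 'b \<Rightarrow> real" where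
  "grad u = (SOME Z. (u, Z) \<in> G)"

definition dom :: "('a \<Rightarrow> real) set" where
  "dom = {u \<in> {u. \<exists>Z. (u, Z) \<in> G}. (\<integral>\<^sup>+t. (\<integral>\<^sup>+x. ennreal ((grad u (x, t))\<^sup>2 * w (x, t)) \<partial>M) \<partial>T) < \<infinity>}"

definition form :: "('a \<Rightarrow> real) \<Rightarrow> real" where
  "form u = 1 / 2 * (\<integral>t. (\<integral>x. (grad u (x, t))\<^sup>2 * w (x, t) \<partial>M) \<partial>T)"

definition gam :: "('a \<Rightarrow> real) \<Rightarrow> 'a \<Rightarrow> real" where
  "gam u x = (\<integral>t. (grad u (x, t))\<^sup>2 * w (x, t) \<partial>T)"

text \<open>Working with \<open>sqrt w * Z\<close> turns the weighted space into the unweighted \<open>L\<^sup>2\<close>.\<close>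

definition wgrad :: "('a \<Rightarrow> real) \<Rightarrow> ('a \<times> 'b \<Rightarrow> real) \<Rightarrow> bool" where
  "wgrad u Y \<longleftrightarrow> Y \<in> L2_space N \<and> (\<exists>Z. (u, Z) \<in> G \<and> (AE p in N. Y p = sqrt (w p) * Z p))"

lemma G_AE_cong:
  assumes "(u, Z) \<in> G" "v \<in> borel_measurable M" "AE x in M. u x = v x"
    "Y \<in> borel_measurable N" "AE p in N. Z p = Y p"
  shows "(v, Y) \<in> G"
  by (rule G_closed[of "\<lambda>n. u" "\<lambda>n. Z"])
    (use assms in \<open>auto intro!: L2_conv_AE_cong[OF L2_conv_const] G_L2\<close>)

lemma grad_AE:
  assumes "(u, Z) \<in> G"
  shows "(u, grad u) \<in> G" "AE p in N. grad u p = Z p"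
proof -
  show "(u, grad u) \<in> G" unfolding grad_def by (rule someI[of "\<lambda>Z. (u, Z) \<in> G", OF assms])
  from G_unique[OF this assms] show "AE p in N. grad u p = Z p" .
qed

lemma wgrad_add:
  assumes "wgrad u Y" "wgrad v Y'"
  shows "wgrad (\<lambda>x. u x + v x) (\<lambda>p. Y p + Y' p)"
proof -
  obtain Z Z' where "(u, Z) \<in> G" "AE p in N. Y p = sqrt (w p) * Z p"
    "(v, Z') \<in> G" "AE p in N. Y' p = sqrt (w p) * Z' p"
    using assms by (auto simp: wgrad_def)
  moreover from this have "AE p in N. Y p + Y' p = sqrt (w p) * (Z p + Z' p)"
    by (auto simp: algebra_simps)
  ultimately show ?thesis
    using assms G_add[of u Z v Z'] by (auto simp: wgrad_def intro: L2_add)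
qed

lemma wgrad_cmult:
  assumes "wgrad u Y"
  shows "wgrad (\<lambda>x. c * u x) (\<lambda>p. c * Y p)"
proof -
  obtain Z where "(u, Z) \<in> G" "AE p in N. Y p = sqrt (w p) * Z p"
    using assms by (auto simp: wgrad_def)
  moreover from this have "AE p in N. c * Y p = sqrt (w p) * (c * Z p)"
    by auto
  ultimately show ?thesis
    using assms G_cmult[of u Z c] by (auto simp: wgrad_def intro: L2_cmult)
qed

lemma wgrad_diff:
  assumes "wgrad u Y" "wgrad v Y'"
  shows "wgrad (\<lambda>x. u x - v x) (\<lambda>p. Y p - Y' p)"
  using wgrad_add[OF assms(1) wgrad_cmult[OF assms(2), of "-1"]] by simp

lemma wgrad_zero: "wgrad (\<lambda>_. 0) (\<lambda>_. 0)"
  using G_zero by (auto simp: wgrad_def L2_zero)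

lemma wgrad_AE_cong:
  assumes "wgrad u Y" "v \<in> borel_measurable M" "AE x in M. u x = v x"
  shows "wgrad v Y"
proof -
  obtain Z where Z: "(u, Z) \<in> G" "AE p in N. Y p = sqrt (w p) * Z p"
    using assms by (auto simp: wgrad_def)
  then have "(v, Z) \<in> G" using assms by (intro G_AE_cong[OF Z(1)]) (auto dest: G_L2)
  with Z assms show ?thesis by (auto simp: wgrad_def)
qed

lemma wgrad_L2: "wgrad u Y \<Longrightarrow> u \<in> L2_space M" "wgrad u Y \<Longrightarrow> Y \<in> L2_space N"
  by (auto simp: wgrad_def intro: G_L2)

lemma wgrad_grad:
  assumes "wgrad u Y"
  shows "(u, grad u) \<in> G" "AE p in N. (grad u p)\<^sup>2 * w p = (Y p)\<^sup>2"
proof -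
  obtain Z where Z: "(u, Z) \<in> G" "AE p in N. Y p = sqrt (w p) * Z p"
    using assms by (auto simp: wgrad_def)
  show "(u, grad u) \<in> G" by (rule grad_AE[OF Z(1)])
  show "AE p in N. (grad u p)\<^sup>2 * w p = (Y p)\<^sup>2"
    using grad_AE(2)[OF Z(1)] Z(2) w_ge_1
    by eventually_elim (simp add: power_mult_distrib)
qed

text \<open>Tonelli turns the iterated integral into the squared L2 norm of
  \<open>sqrt w * grad u\<close>, where \<open>w_ge_1\<close> makes the square of the root equal to
  \<open>w\<close> almost everywhere. From here on the chosen gradient is replaced by any convenient
  \<open>Y\<close>.\<close>

lemma dom_iff: "u \<in> dom \<longleftrightarrow> (\<exists>Y. wgrad u Y)"
proof
  assume "u \<in> dom"
  then obtain Z where Z: "(u, Z) \<in> G"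
    and fin: "(\<integral>\<^sup>+t. (\<integral>\<^sup>+x. ennreal ((grad u (x, t))\<^sup>2 * w (x, t)) \<partial>M) \<partial>T) < \<infinity>"
    by (auto simp: dom_def)
  note g = grad_AE[OF Z]
  have [measurable]: "grad u \<in> borel_measurable N" using G_L2(2)[OF g(1)] by auto
  have "(\<integral>\<^sup>+t. (\<integral>\<^sup>+x. ennreal ((grad u (x, t))\<^sup>2 * w (x, t)) \<partial>M) \<partial>T)
      = (\<integral>\<^sup>+p. ennreal ((grad u p)\<^sup>2 * w p) \<partial>N)"
    using N.nn_integral_snd[of "\<lambda>p. ennreal ((grad u p)\<^sup>2 * w p)"] by simp
  also have "\<dots> = (\<integral>\<^sup>+p. ennreal ((sqrt (w p) * grad u p)\<^sup>2) \<partial>N)"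
    by (rule nn_integral_cong_AE) (use w_ge_1 in \<open>auto simp: power_mult_distrib mult.commute\<close>)
  finally have "integrable N (\<lambda>p. (sqrt (w p) * grad u p)\<^sup>2)"
    using fin by (intro integrableI_bounded) auto
  then have "wgrad u (\<lambda>p. sqrt (w p) * grad u p)"
    using g(1) by (auto simp: wgrad_def L2_space_def)
  then show "\<exists>Y. wgrad u Y" by blast
next
  assume "\<exists>Y. wgrad u Y"
  then obtain Y where Y: "wgrad u Y" by blast
  note g = wgrad_grad[OF Y]
  have [measurable]: "grad u \<in> borel_measurable N" "Y \<in> borel_measurable N"
    using G_L2(2)[OF g(1)] wgrad_L2[OF Y] by auto
  have "(\<integral>\<^sup>+t. (\<integral>\<^sup>+x. ennreal ((grad u (x, t))\<^sup>2 * w (x, t)) \<partial>M) \<partial>T)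
      = (\<integral>\<^sup>+p. ennreal ((grad u p)\<^sup>2 * w p) \<partial>N)"
    using N.nn_integral_snd[of "\<lambda>p. ennreal ((grad u p)\<^sup>2 * w p)"] by simp
  also have "\<dots> = (\<integral>\<^sup>+p. ennreal ((Y p)\<^sup>2) \<partial>N)"
    by (rule nn_integral_cong_AE) (use g(2) in auto)
  also have "\<dots> < \<infinity>"
    using L2_integrable_square[OF wgrad_L2(2)[OF Y]] by (subst nn_integral_eq_integral) auto
  finally show "u \<in> dom" using g(1) by (auto simp: dom_def)
qed

lemma domE: assumes "u \<in> dom" obtains Y where "wgrad u Y"
  using assms by (auto simp: dom_iff)

lemma form_eq:
  assumes "wgrad u Y"
  shows "form u = 1 / 2 * (L2_norm N Y)\<^sup>2"
proof -
  note g = wgrad_grad[OF assms]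
  have [measurable]: "grad u \<in> borel_measurable N" "Y \<in> borel_measurable N"
    using G_L2(2)[OF g(1)] wgrad_L2[OF assms] by auto
  have int: "integrable N (\<lambda>p. (grad u p)\<^sup>2 * w p)"
    by (subst integrable_cong_AE[OF _ _ g(2)])
      (use L2_integrable_square[OF wgrad_L2(2)[OF assms]] in auto)
  then have "(\<integral>t. (\<integral>x. (grad u (x, t))\<^sup>2 * w (x, t) \<partial>M) \<partial>T) = (\<integral>p. (grad u p)\<^sup>2 * w p \<partial>N)"
    using N.integral_snd[of "\<lambda>x t. (grad u (x, t))\<^sup>2 * w (x, t)"] by (simp add: split_beta')
  also have "\<dots> = (\<integral>p. (Y p)\<^sup>2 \<partial>N)"
    by (rule integral_cong_AE) (use g(2) in auto)
  finally show ?thesis by (simp add: form_def L2_norm_square)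
qed

text \<open>Symmetry and bilinearity of the form become those of the inner product of L2(N).\<close>

lemma form_polarize:
  assumes u: "wgrad u Y" and v: "wgrad v Y'"
  shows "polarize form u v = 1 / 2 * (\<integral>p. Y p * Y' p \<partial>N)"
proof -
  note L = wgrad_L2(2)[OF u] wgrad_L2(2)[OF v]
  note int = L2_integrable_square[OF L(1)] L2_integrable_square[OF L(2)] L2_integrable_mult[OF L]
  have "(\<integral>p. (Y p + Y' p)\<^sup>2 \<partial>N) = (\<integral>p. (Y p)\<^sup>2 + (Y' p)\<^sup>2 + 2 * (Y p * Y' p) \<partial>N)"
    by (simp add: power2_sum mult.assoc)
  then have 1: "(\<integral>p. (Y p + Y' p)\<^sup>2 \<partial>N) =
      (\<integral>p. (Y p)\<^sup>2 \<partial>N) + (\<integral>p. (Y' p)\<^sup>2 \<partial>N) + 2 * (\<integral>p. Y p * Y' p \<partial>N)"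
    using int by simp
  have "(\<integral>p. (Y p - Y' p)\<^sup>2 \<partial>N) = (\<integral>p. (Y p)\<^sup>2 + (Y' p)\<^sup>2 - 2 * (Y p * Y' p) \<partial>N)"
    by (simp add: power2_diff mult.assoc)
  then have 2: "(\<integral>p. (Y p - Y' p)\<^sup>2 \<partial>N) =
      (\<integral>p. (Y p)\<^sup>2 \<partial>N) + (\<integral>p. (Y' p)\<^sup>2 \<partial>N) - 2 * (\<integral>p. Y p * Y' p \<partial>N)"
    using int by simp
  show ?thesis
    unfolding polarize_def form_eq[OF wgrad_add[OF u v]] form_eq[OF wgrad_diff[OF u v]]
      L2_norm_square 1 2
    by (simp add: field_simps)
qed

lemma AE_sections:
  fixes f :: "'a \<times> 'b \<Rightarrow> real"
  assumes "integrable N f"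
  shows "AE x in M. integrable T (\<lambda>t. f (x, t))"
  using N.AE_integrable_fst'[OF assms] .

lemma gam_eq:
  assumes "wgrad u Y"
  shows "AE x in M. gam u x = (\<integral>t. (Y (x, t))\<^sup>2 \<partial>T)"
proof -
  note g = wgrad_grad[OF assms]
  have [measurable]: "grad u \<in> borel_measurable N" "Y \<in> borel_measurable N"
    using G_L2(2)[OF g(1)] wgrad_L2[OF assms] by auto
  have "AE x in M. AE t in T. (grad u (x, t))\<^sup>2 * w (x, t) = (Y (x, t))\<^sup>2"
    using N.AE_pair[OF g(2)] by simp
  then show ?thesis
    using AE_space
  proof eventually_elim
    case (elim x)
    then show ?case unfolding gam_def
      by (intro integral_cong_AE) auto
  qed
qed

lemma gam_measurable:
  assumes "u \<in> dom" shows "gam u \<in> borel_measurable M"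
proof -
  from assms obtain Y where "wgrad u Y" by (rule domE)
  from G_L2(2)[OF wgrad_grad(1)[OF this]] have [measurable]: "grad u \<in> borel_measurable N" by auto
  show ?thesis unfolding gam_def by measurable
qed

text \<open>The fibrewise counterpart of \<open>form_polarize\<close>. It holds only almost
  everywhere, since expanding the square under the inner integral needs integrable sections.\<close>

lemma gam_polarize:
  assumes u: "wgrad u Y" and v: "wgrad v Y'"
  shows "AE x in M. polarize_ptw gam u v x = (\<integral>t. Y (x, t) * Y' (x, t) \<partial>T)"
proof -
  note L = wgrad_L2(2)[OF u] wgrad_L2(2)[OF v]
  show ?thesis
    using gam_eq[OF wgrad_add[OF u v]] gam_eq[OF wgrad_diff[OF u v]]
      AE_sections[OF L2_integrable_square[OF L(1)]] AE_sections[OF L2_integrable_square[OF L(2)]]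
      AE_sections[OF L2_integrable_mult[OF L]]
  proof eventually_elim
    case (elim x)
    have 1: "(\<integral>t. (Y (x, t) + Y' (x, t))\<^sup>2 \<partial>T) =
      (\<integral>t. (Y (x, t))\<^sup>2 + (Y' (x, t))\<^sup>2 + 2 * (Y (x, t) * Y' (x, t)) \<partial>T)"
      by (simp add: power2_sum mult.assoc)
    have 2: "(\<integral>t. (Y (x, t) - Y' (x, t))\<^sup>2 \<partial>T) =
      (\<integral>t. (Y (x, t))\<^sup>2 + (Y' (x, t))\<^sup>2 - 2 * (Y (x, t) * Y' (x, t)) \<partial>T)"
      by (simp add: power2_diff mult.assoc)
    show ?case
      unfolding polarize_ptw_def polarize_def elim(1,2) 1 2 using elim(3-5) by simp
  qed
qed

lemma dom_subspace: "L2_subspace M dom"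
  unfolding L2_subspace_def
proof (intro conjI ballI allI impI)
  show "dom \<subseteq> L2_space M" by (auto simp: dom_iff intro: wgrad_L2)
  show "(\<lambda>_. 0) \<in> dom" using wgrad_zero by (auto simp: dom_iff)
  show "(\<lambda>x. u x + v x) \<in> dom" if "u \<in> dom" "v \<in> dom" for u v
    using that unfolding dom_iff by (blast intro: wgrad_add)
  show "(\<lambda>x. c * u x) \<in> dom" if "u \<in> dom" for c u
    using that unfolding dom_iff by (blast intro: wgrad_cmult)
  show "v \<in> dom" if "u \<in> dom" "v \<in> borel_measurable M" "AE x in M. u x = v x" for u v
    using that wgrad_AE_cong[OF _ that(2,3)] unfolding dom_iff by blast
qed

lemma form_AE_cong:
  assumes "u \<in> dom" "v \<in> dom" "AE x in M. u x = v x"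
  shows "form u = form v" "AE x in M. gam u x = gam v x"
proof -
  from assms(1) obtain Y where Y: "wgrad u Y" by (rule domE)
  from assms(2) obtain V where "wgrad v V" by (rule domE)
  then have "v \<in> borel_measurable M" by (intro L2_measurable wgrad_L2)
  from wgrad_AE_cong[OF Y this assms(3)] have v: "wgrad v Y" .
  show "form u = form v" using form_eq[OF Y] form_eq[OF v] by simp
  show "AE x in M. gam u x = gam v x" using gam_eq[OF Y] gam_eq[OF v] by eventually_elim simp
qed

lemma form_nonneg_quadratic: "nonneg_quadratic_form M dom form"
  unfolding nonneg_quadratic_form_def
proof (intro conjI ballI allI impI)
  show "L2_subspace M dom" by (rule dom_subspace)
  show "form u = form v" if "u \<in> dom" "v \<in> dom" "AE x in M. u x = v x" for u v
    by (rule form_AE_cong(1)[OF that])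
  show "form u = polarize form u u" "0 \<le> form u" if "u \<in> dom" for u
  proof -
    from that obtain Y where Y: "wgrad u Y" by (rule domE)
    show "form u = polarize form u u"
      unfolding form_polarize[OF Y Y] form_eq[OF Y] L2_norm_square by (simp add: power2_eq_square)
    show "0 \<le> form u" unfolding form_eq[OF Y] by simp
  qed
  show "polarize form u v = polarize form v u" if "u \<in> dom" "v \<in> dom" for u v
  proof -
    from that obtain Y Y' where Y: "wgrad u Y" "wgrad v Y'" by (metis domE)
    show ?thesis unfolding form_polarize[OF Y] form_polarize[OF Y(2,1)] by (simp add: mult.commute)
  qed
  show "polarize form (\<lambda>x. u x + v x) z = polarize form u z + polarize form v z"
    if "u \<in> dom" "v \<in> dom" "z \<in> dom" for u v z
  proof -
    from that obtain Y Y' Y'' where Y: "wgrad u Y" "wgrad v Y'" "wgrad z Y''" by (metis domE)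
    show ?thesis
      unfolding form_polarize[OF wgrad_add[OF Y(1,2)] Y(3)] form_polarize[OF Y(1,3)]
        form_polarize[OF Y(2,3)]
      using L2_integrable_mult[OF Y(1)[THEN wgrad_L2(2)] Y(3)[THEN wgrad_L2(2)]]
        L2_integrable_mult[OF Y(2)[THEN wgrad_L2(2)] Y(3)[THEN wgrad_L2(2)]]
      by (simp add: distrib_right)
  qed
  show "polarize form (\<lambda>x. c * u x) v = c * polarize form u v" if "u \<in> dom" "v \<in> dom" for c u v
  proof -
    from that obtain Y Y' where Y: "wgrad u Y" "wgrad v Y'" by (metis domE)
    show ?thesis unfolding form_polarize[OF Y] form_polarize[OF wgrad_cmult[OF Y(1)] Y(2)]
      by (simp add: mult.assoc)
  qed
qed

text \<open>A Cauchy sequence for the form norm gives L2 limits of the functions and of their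
  weighted gradients. Dividing by \<open>sqrt w\<close> leads back to the graph \<open>G\<close>,
  which is closed.\<close>

lemma form_closed: "closed_form M dom form"
  unfolding closed_form_def
proof (intro allI impI, elim conjE)
  fix U :: "nat \<Rightarrow> 'a \<Rightarrow> real"
  assume U: "\<forall>n. U n \<in> dom"
    and cauchy: "\<forall>e>0. \<exists>N0. \<forall>m\<ge>N0. \<forall>n\<ge>N0. form_norm M form (\<lambda>x. U m x - U n x) < e"
  from U have "\<forall>n. \<exists>Y. wgrad (U n) Y" by (simp add: dom_iff)
  then obtain Y where Y: "\<And>n. wgrad (U n) (Y n)" by metis
  have fn: "form_norm M form (\<lambda>x. U m x - v x) =
      sqrt ((L2_norm M (\<lambda>x. U m x - v x))\<^sup>2 + 1/2 * (L2_norm N (\<lambda>p. Y m p - V p))\<^sup>2)"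
    if "wgrad v V" for m v V
    unfolding form_norm_def form_eq[OF wgrad_diff[OF Y that]] ..
  have le: "L2_norm M (\<lambda>x. U m x - U n x) \<le> form_norm M form (\<lambda>x. U m x - U n x)" for m n
    unfolding fn[OF Y] by (rule real_le_rsqrt) simp
  \<comment> \<open>Half of a square is at least the square of the half; the constant 2 is not sharp
    but avoids a root.\<close>
  have le': "L2_norm N (\<lambda>p. Y m p - Y n p) \<le> 2 * form_norm M form (\<lambda>x. U m x - U n x)" for m n
  proof -
    have "L2_norm N (\<lambda>p. Y m p - Y n p) / 2 \<le> form_norm M form (\<lambda>x. U m x - U n x)"
      unfolding fn[OF Y] by (rule real_le_rsqrt) (simp add: power_divide)
    then show ?thesis by simp
  qed
  have "\<exists>u. L2_conv M U u"
  proof (rule M.L2_complete)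
    fix e :: real assume "0 < e"
    with cauchy show "\<exists>N0. \<forall>m\<ge>N0. \<forall>n\<ge>N0. L2_norm M (\<lambda>x. U m x - U n x) < e"
      using le by (meson le_less_trans)
  qed (use Y wgrad_L2 in blast)
  moreover have "\<exists>V. L2_conv N Y V"
  proof (rule N.L2_complete)
    fix e :: real assume "0 < e"
    with cauchy obtain N0 where N0: "\<forall>m\<ge>N0. \<forall>n\<ge>N0. form_norm M form (\<lambda>x. U m x - U n x) < e / 2"
      by (meson half_gt_zero)
    have "L2_norm N (\<lambda>p. Y m p - Y n p) < e" if "m \<ge> N0" "n \<ge> N0" for m n
      using le'[of m n] N0 that by fastforce
    then show "\<exists>N0. \<forall>m\<ge>N0. \<forall>n\<ge>N0. L2_norm N (\<lambda>p. Y m p - Y n p) < e" by blast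
  qed (use Y wgrad_L2 in blast)
  ultimately obtain u V where u: "L2_conv M U u" and V: "L2_conv N Y V" by blast
  have "wgrad u V"
  proof -
    from Y obtain Z where Z: "\<And>n. (U n, Z n) \<in> G" "\<And>n. AE p in N. Y n p = sqrt (w p) * Z n p"
      unfolding wgrad_def by metis
    \<comment> \<open>Division by \<open>sqrt w\<close> is a bounded multiplication because the
      weight is at least 1; this is what transfers convergence to the unweighted gradients.\<close>
    have inv_bound: "AE p in N. \<bar>1 / sqrt (w p)\<bar> \<le> 1"
      using w_ge_1 by eventually_elim simp
    have "L2_conv N (\<lambda>n p. 1 / sqrt (w p) * Y n p) (\<lambda>p. 1 / sqrt (w p) * V p)"
      by (rule L2_conv_cmult_fun[OF V _ inv_bound]) measurable
    moreover have "(U n, \<lambda>p. 1 / sqrt (w p) * Y n p) \<in> G" for n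
    proof (rule G_AE_cong[OF Z(1)])
      show "(\<lambda>p. 1 / sqrt (w p) * Y n p) \<in> borel_measurable N"
        using wgrad_L2(2)[OF Y] by measurable
      show "AE p in N. Z n p = 1 / sqrt (w p) * Y n p"
        using Z(2)[of n] w_ge_1 by eventually_elim simp
      show "U n \<in> borel_measurable M" using L2_convD(1)[OF u] by (rule L2_measurable)
    qed simp
    ultimately have "(u, \<lambda>p. 1 / sqrt (w p) * V p) \<in> G" by (intro G_closed[OF _ u])
    moreover have "AE p in N. V p = sqrt (w p) * (1 / sqrt (w p) * V p)"
      using w_ge_1 by eventually_elim simp
    ultimately show ?thesis using L2_convD(2)[OF V] unfolding wgrad_def by blast
  qed
  show "\<exists>u\<in>dom. (\<lambda>n. form_norm M form (\<lambda>x. U n x - u x)) \<longlonglongrightarrow> 0"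
  proof
    show "u \<in> dom" using \<open>wgrad u V\<close> by (auto simp: dom_iff)
    have "(\<lambda>n. form_norm M form (\<lambda>x. U n x - u x)) \<longlonglongrightarrow> sqrt (0\<^sup>2 + 1/2 * 0\<^sup>2)"
      unfolding fn[OF \<open>wgrad u V\<close>] by (intro tendsto_intros L2_convD(3) u V)
    then show "(\<lambda>n. form_norm M form (\<lambda>x. U n x - u x)) \<longlonglongrightarrow> 0" by simp
  qed
qed

end

text \<open>The squared positive part is C1. It serves below to truncate the square function and to
  approximate indicators of half-lines.\<close>

lemma DERIV_pos_part_square:
  "((\<lambda>y. (max 0 y)\<^sup>2) has_real_derivative 2 * max 0 y) (at y)" for y :: real
proof (cases "y = 0")
  case True
  have "((\<lambda>h. (max 0 h)\<^sup>2 / h) \<longlongrightarrow> 0) (at (0::real))"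
  proof (rule Lim_null_comparison)
    show "\<forall>\<^sub>F h in at (0::real). norm ((max 0 h)\<^sup>2 / h) \<le> \<bar>h\<bar>"
      by (rule always_eventually) (auto simp: max_def power2_eq_square)
    show "((\<lambda>h::real. \<bar>h\<bar>) \<longlongrightarrow> 0) (at 0)" by (rule tendsto_rabs_zero) (rule tendsto_ident_at)
  qed
  then show ?thesis using True by (simp add: DERIV_def)
next
  case False
  then consider "y > 0" | "y < 0" by linarith
  then show ?thesis
  proof cases
    case 1
    have "((\<lambda>y::real. y\<^sup>2) has_real_derivative 2 * y) (at y)" by (auto intro!: derivative_eq_intros)
    then have "((\<lambda>y. (max 0 y)\<^sup>2) has_real_derivative 2 * y) (at y)"
      by (rule has_field_derivative_transform_within_open[where S="{0<..}"]) (use 1 in auto)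
    then show ?thesis using 1 by simp
  next
    case 2
    have "((\<lambda>y::real. 0) has_real_derivative 0) (at y)" by simp
    then have "((\<lambda>y::real. (max 0 y)\<^sup>2) has_real_derivative 0) (at y)"
      by (rule has_field_derivative_transform_within_open[where S="{..<0}"]) (use 2 in auto)
    then show ?thesis using 2 by simp
  qed
qed

section \<open>Contractions, products and the carre du champ\<close>

context weighted_gradient
begin

text \<open>For a merely Lipschitz \<open>\<phi>\<close> the chain rule is applied to smooth approximations; the
  admissible approximations form a convex set, so gradients of almost minimal norm are Cauchy by
  the parallelogram law and no weak compactness is needed.\<close>

lemma contraction:
  assumes uZ: "(u, Z) \<in> G" and lip: "\<And>x y. \<bar>\<phi> x - \<phi> y\<bar> \<le> \<bar>x - y\<bar>"
  shows "\<exists>Y. (\<lambda>x. \<phi> (u x), Y) \<in> G \<and> (AE p in N. \<bar>Y p\<bar> \<le> \<bar>Z p\<bar>)"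
proof -
  \<comment> \<open>Admissible approximations: C1 functions with slope at most 1, uniformly within
    1/(n+1) of \<open>\<phi>\<close>. Each \<open>S n\<close> is convex and the sets decrease in
    n.\<close>
  define S where "S n = {(\<psi>, \<psi>'). (\<forall>x. (\<psi> has_real_derivative \<psi>' x) (at x)) \<and>
    continuous_on UNIV \<psi>' \<and> (\<forall>x. \<bar>\<psi>' x\<bar> \<le> 1) \<and> (\<forall>x. \<bar>\<psi> x - \<phi> x\<bar> \<le> 1 / Suc n)}" for n
  define E where "E \<psi>' = (L2_norm N (\<lambda>p. \<psi>' (u (fst p)) * Z p))\<^sup>2" for \<psi>' :: "real \<Rightarrow> real"
  \<comment> \<open>The smallest energy available at precision n, that is, the squared distance from
    0 to a convex set of gradients.\<close>
  define d where "d n = Inf ((\<lambda>s. E (snd s)) ` S n)" for n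
  have ZL: "Z \<in> L2_space N" by (rule G_L2[OF uZ])
  have SG: "(\<lambda>x. \<psi> (u x), \<lambda>p. \<psi>' (u (fst p)) * Z p) \<in> G" if "(\<psi>, \<psi>') \<in> S n" for \<psi> \<psi>' n
    by (rule G_chain[OF uZ, where L=1]) (use that in \<open>auto simp: S_def\<close>)
  have SE: "E \<psi>' \<le> (L2_norm N Z)\<^sup>2" if "(\<psi>, \<psi>') \<in> S n" for \<psi> \<psi>' n
    unfolding E_def
  proof (rule power_mono[OF L2_norm_mono[OF _ ZL] L2_norm_nonneg])
    show "(\<lambda>p. \<psi>' (u (fst p)) * Z p) \<in> borel_measurable N"
      using G_L2(2)[OF SG[OF that]] by auto
    have "\<bar>\<psi>' x\<bar> \<le> 1" for x using that by (auto simp: S_def)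
    then show "AE p in N. \<bar>\<psi>' (u (fst p)) * Z p\<bar> \<le> \<bar>Z p\<bar>"
      by (simp add: abs_mult mult_left_le_one_le)
  qed
  have bdd: "bdd_below ((\<lambda>s. E (snd s)) ` S n)" for n
    by (rule bdd_belowI[of _ 0]) (auto simp: E_def)
  have ne: "S n \<noteq> {}" for n
    using C1_mollification[OF lip, of "1 / Suc n"] by (auto simp: S_def)
  have S_anti: "S n \<subseteq> S m" if "m \<le> n" for m n
  proof -
    have "1 / real (Suc n) \<le> 1 / real (Suc m)" using that by (simp add: frac_le)
    then show ?thesis unfolding S_def by (auto intro: order_trans)
  qed
  have d_le: "d n \<le> E \<psi>'" if "(\<psi>, \<psi>') \<in> S n" for \<psi> \<psi>' n
    unfolding d_def using that by (intro cInf_lower bdd) force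
  have "\<exists>s\<in>S n. E (snd s) < d n + 1 / Suc n" for n
    using cInf_lessD[of "(\<lambda>s. E (snd s)) ` S n" "d n + 1 / Suc n"] ne[of n] by (auto simp: d_def)
  then obtain s where s: "\<And>n. s n \<in> S n" "\<And>n. E (snd (s n)) < d n + 1 / Suc n" by metis
  define \<psi> \<psi>' where "\<psi> n = fst (s n)" and "\<psi>' n = snd (s n)" for n
  have \<psi>: "(\<psi> n, \<psi>' n) \<in> S n" "E (\<psi>' n) < d n + 1 / Suc n" for n
    using s by (auto simp: \<psi>_def \<psi>'_def)
  define Y where "Y n p = \<psi>' n (u (fst p)) * Z p" for n p
  have YG: "(\<lambda>x. \<psi> n (u x), Y n) \<in> G" for n
    using SG[OF \<psi>(1)[of n]] by (simp add: Y_def[abs_def])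
  have YL: "Y n \<in> L2_space N" for n by (rule G_L2[OF YG])
  have EY: "E (\<psi>' n) = (L2_norm N (Y n))\<^sup>2" for n by (simp add: E_def Y_def[abs_def])
  \<comment> \<open>For n \<le> m the midpoint of the two approximations still lies in
    \<open>S n\<close>, so the squared norm of \<open>Y m + Y n\<close> is at least 4
    \<open>d n\<close>. The parallelogram law and near-minimality of both energies give the
    bound.\<close>
  have par: "(L2_norm N (\<lambda>p. Y m p - Y n p))\<^sup>2 \<le> 2 * (d m - d n + 2 / Suc n)" if "n \<le> m" for m n
  proof -
    have "(\<psi> m, \<psi>' m) \<in> S n" using \<psi>(1)[of m] S_anti[OF that] by blast
    with \<psi>(1)[of n] have mid: "(\<lambda>x. (\<psi> m x + \<psi> n x) / 2, \<lambda>x. (\<psi>' m x + \<psi>' n x) / 2) \<in> S n"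
      unfolding S_def
    proof (clarsimp, intro conjI allI)
      fix x
      assume a: "\<forall>x. \<bar>\<psi>' m x\<bar> \<le> 1" "\<forall>x. \<bar>\<psi>' n x\<bar> \<le> 1"
        "\<forall>x. \<bar>\<psi> m x - \<phi> x\<bar> \<le> 1 / (1 + real n)" "\<forall>x. \<bar>\<psi> n x - \<phi> x\<bar> \<le> 1 / (1 + real n)"
        and b: "\<forall>x. (\<psi> m has_real_derivative \<psi>' m x) (at x)" "\<forall>x. (\<psi> n has_real_derivative \<psi>' n x) (at x)"
      show "((\<lambda>x. (\<psi> m x + \<psi> n x) / 2) has_real_derivative (\<psi>' m x + \<psi>' n x) / 2) (at x)"
        using b by (intro DERIV_cdivide DERIV_add) auto
      show "\<bar>\<psi>' m x + \<psi>' n x\<bar> \<le> 2" using a(1,2)[THEN spec, of x] by linarith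
      show "\<bar>(\<psi> m x + \<psi> n x) / 2 - \<phi> x\<bar> \<le> 1 / (1 + real n)"
        using a(3,4)[THEN spec, of x] by (simp add: abs_le_iff field_simps)
    qed (auto intro!: continuous_intros)
    note int = L2_integrable_square[OF YL] L2_integrable_mult[OF YL YL]
    have "d n \<le> E (\<lambda>x. (\<psi>' m x + \<psi>' n x) / 2)" by (rule d_le[OF mid])
    also have "\<dots> = (\<integral>p. 1/4 * (Y m p + Y n p)\<^sup>2 \<partial>N)"
      unfolding E_def L2_norm_square Y_def
      by (intro Bochner_Integration.integral_cong) (auto simp: power2_eq_square field_simps)
    also have "\<dots> = 1/4 * (\<integral>p. (Y m p + Y n p)\<^sup>2 \<partial>N)" by simp
    finally have "4 * d n \<le> (\<integral>p. (Y m p + Y n p)\<^sup>2 \<partial>N)" by simp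
    moreover have "(\<integral>p. (Y m p + Y n p)\<^sup>2 \<partial>N) + (\<integral>p. (Y m p - Y n p)\<^sup>2 \<partial>N)
        = 2 * (\<integral>p. (Y m p)\<^sup>2 \<partial>N) + 2 * (\<integral>p. (Y n p)\<^sup>2 \<partial>N)"
    proof -
      have "(\<integral>p. (Y m p + Y n p)\<^sup>2 \<partial>N) + (\<integral>p. (Y m p - Y n p)\<^sup>2 \<partial>N)
        = (\<integral>p. (Y m p + Y n p)\<^sup>2 + (Y m p - Y n p)\<^sup>2 \<partial>N)"
        by (rule Bochner_Integration.integral_add[symmetric])
          (intro L2_integrable_square L2_add L2_diff YL)+
      also have "\<dots> = (\<integral>p. 2 * (Y m p)\<^sup>2 + 2 * (Y n p)\<^sup>2 \<partial>N)"
        by (intro Bochner_Integration.integral_cong) (auto simp: power2_sum power2_diff)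
      finally show ?thesis using int by simp
    qed
    moreover have "(\<integral>p. (Y m p)\<^sup>2 \<partial>N) < d m + 1 / Suc n"
    proof -
      have "1 / real (Suc m) \<le> 1 / real (Suc n)" using that by (simp add: frac_le)
      then show ?thesis using \<psi>(2)[of m] unfolding EY L2_norm_square by linarith
    qed
    moreover have "(\<integral>p. (Y n p)\<^sup>2 \<partial>N) < d n + 1 / Suc n"
      using \<psi>(2)[of n] unfolding EY L2_norm_square .
    ultimately show ?thesis unfolding L2_norm_square by (simp add: algebra_simps)
  qed
  \<comment> \<open>Infima over shrinking sets increase, and the energy of \<open>Z\<close> bounds
    them; their convergence makes the right-hand side of \<open>par\<close> small.\<close>
  have "incseq d"
  proof (rule incseq_SucI)
    show "d n \<le> d (Suc n)" for n
      unfolding d_def by (intro cInf_superset_mono bdd image_mono S_anti) (use ne in auto)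
  qed
  moreover have "d n \<le> (L2_norm N Z)\<^sup>2" for n
    using d_le[OF \<psi>(1)] SE[OF \<psi>(1)] by (rule order_trans)
  ultimately have "\<exists>D. d \<longlonglongrightarrow> D \<and> (\<forall>n. d n \<le> D)"
    using incseq_convergent[of d "(L2_norm N Z)\<^sup>2"] by blast
  then obtain D where D: "d \<longlonglongrightarrow> D" "\<And>n. d n \<le> D" by blast
  have "(\<lambda>n. 2 * (D - d n + 2 / Suc n)) \<longlonglongrightarrow> 2 * (D - D + 0)"
    by (intro tendsto_intros D(1) LIMSEQ_Suc[OF lim_const_over_n])
  then have b0: "(\<lambda>n. 2 * (D - d n + 2 / Suc n)) \<longlonglongrightarrow> 0" by simp
  have "\<exists>V. L2_conv N Y V"
  proof (rule N.L2_complete[OF YL])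
    fix e :: real assume "0 < e"
    then have "eventually (\<lambda>n. 2 * (D - d n + 2 / Suc n) < e\<^sup>2) sequentially"
      by (intro order_tendstoD(2)[OF b0]) simp
    then obtain N0 where N0: "\<And>n. n \<ge> N0 \<Longrightarrow> 2 * (D - d n + 2 / Suc n) < e\<^sup>2"
      by (auto simp: eventually_sequentially)
    have le: "L2_norm N (\<lambda>p. Y m p - Y n p) < e" if "N0 \<le> n" "n \<le> m" for m n
    proof (rule power_less_imp_less_base)
      have "2 * (d m - d n + 2 / Suc n) \<le> 2 * (D - d n + 2 / Suc n)"
        using D(2)[of m] by simp
      from order_trans[OF par[OF that(2)] this] N0[OF that(1)]
      show "(L2_norm N (\<lambda>p. Y m p - Y n p))\<^sup>2 < e\<^sup>2"
        by (rule le_less_trans)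
    qed (use \<open>0 < e\<close> in simp)
    have "L2_norm N (\<lambda>p. Y m p - Y n p) < e" if "N0 \<le> n" "N0 \<le> m" for m n
      using le[of n m] le[of m n] that L2_norm_minus_commute[of N "Y m" "Y n"] by (cases "n \<le> m") auto
    then show "\<exists>N0. \<forall>m\<ge>N0. \<forall>n\<ge>N0. L2_norm N (\<lambda>p. Y m p - Y n p) < e" by blast
  qed
  then obtain V where V: "L2_conv N Y V" by blast
  have u: "u \<in> L2_space M" by (rule G_L2[OF uZ])
  \<comment> \<open>The dominating function combines the uniform error, at most 1, with the linear
    growth of \<open>\<phi>\<close>.\<close>
  have "L2_conv M (\<lambda>n x. \<psi> n (u x)) (\<lambda>x. \<phi> (u x))"
  proof (rule L2_conv_dominated[where g="\<lambda>x. \<bar>\<phi> 0\<bar> + 1 + \<bar>u x\<bar>"])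
    have le: "\<bar>\<psi> n x - \<phi> x\<bar> \<le> 1 / Suc n" for n x using \<psi>(1)[of n] by (auto simp: S_def)
    have "continuous_on UNIV \<phi>"
      by (rule lipschitz_on_continuous_on[of 1]) (auto intro!: lipschitz_onI simp: dist_real_def lip)
    then show "(\<lambda>x. \<phi> (u x)) \<in> borel_measurable M"
      using u by (intro borel_measurable_continuous_on[of \<phi>]) auto
    show "(\<lambda>x. \<psi> n (u x)) \<in> borel_measurable M" for n using G_L2(1)[OF YG] by auto
    have "(\<lambda>x. \<bar>\<phi> 0\<bar> + 1) \<in> L2_space M" by (simp add: L2_space_def)
    moreover have "(\<lambda>x. \<bar>u x\<bar>) \<in> L2_space M" by (rule L2_bound[OF _ u]) (use u in auto)
    ultimately show "(\<lambda>x. \<bar>\<phi> 0\<bar> + 1 + \<bar>u x\<bar>) \<in> L2_space M" by (rule L2_add)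
    show "AE x in M. \<bar>\<psi> n (u x)\<bar> \<le> \<bar>\<phi> 0\<bar> + 1 + \<bar>u x\<bar>" for n
    proof (rule AE_I2)
      fix x
      have "1 / real (Suc n) \<le> 1" by simp
      then show "\<bar>\<psi> n (u x)\<bar> \<le> \<bar>\<phi> 0\<bar> + 1 + \<bar>u x\<bar>"
        using le[of n "u x"] lip[of "u x" 0] by linarith
    qed
    show "AE x in M. (\<lambda>n. \<psi> n (u x)) \<longlonglongrightarrow> \<phi> (u x)"
    proof (rule AE_I2)
      fix x
      have "(\<lambda>n. \<psi> n (u x) - \<phi> (u x)) \<longlonglongrightarrow> 0"
        by (rule Lim_null_comparison[OF _ LIMSEQ_Suc[OF lim_const_over_n[of 1]]]) (simp add: le del: of_nat_Suc)
      then show "(\<lambda>n. \<psi> n (u x)) \<longlonglongrightarrow> \<phi> (u x)" by (simp add: LIM_zero_iff)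
    qed
  qed
  from G_closed[OF YG this V] have "(\<lambda>x. \<phi> (u x), V) \<in> G" .
  \<comment> \<open>The bound holds for every approximant pointwise, and passes to the limit along
    an almost everywhere convergent subsequence.\<close>
  moreover have "AE p in N. \<bar>V p\<bar> \<le> \<bar>Z p\<bar>"
  proof -
    obtain r where r: "AE p in N. (\<lambda>n. Y (r n) p) \<longlonglongrightarrow> V p"
      using N.L2_conv_AE_subseq[OF V] by blast
    have "\<bar>Y n p\<bar> \<le> \<bar>Z p\<bar>" for n p
      using \<psi>(1)[of n] by (auto simp: Y_def S_def abs_mult mult_left_le_one_le)
    with r show ?thesis
      by (auto elim!: eventually_mono intro!: LIMSEQ_le_const2[OF tendsto_rabs])
  qed
  ultimately show ?thesis by blast
qed

text \<open>The bound in \<open>contraction\<close> is pointwise and not merely in norm; this is why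
  it survives multiplication by \<open>sqrt w\<close>.\<close>

lemma form_contraction:
  assumes "u \<in> dom" and lip: "\<And>x y. \<bar>\<phi> x - \<phi> y\<bar> \<le> \<bar>x - y\<bar>"
  shows "(\<lambda>x. \<phi> (u x)) \<in> dom \<and> form (\<lambda>x. \<phi> (u x)) \<le> form u"
proof -
  from assms(1) obtain Y where Y: "wgrad u Y" by (rule domE)
  then obtain Z where Z: "(u, Z) \<in> G" "AE p in N. Y p = sqrt (w p) * Z p"
    by (auto simp: wgrad_def)
  from contraction[OF Z(1) lip] obtain Z' where
    Z': "(\<lambda>x. \<phi> (u x), Z') \<in> G" "AE p in N. \<bar>Z' p\<bar> \<le> \<bar>Z p\<bar>" by auto
  note YL = wgrad_L2(2)[OF Y]
  have m: "(\<lambda>p. sqrt (w p) * Z' p) \<in> borel_measurable N"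
    using G_L2(2)[OF Z'(1)] by measurable
  have le: "AE p in N. \<bar>sqrt (w p) * Z' p\<bar> \<le> \<bar>Y p\<bar>"
    using Z(2) Z'(2) w_ge_1 by eventually_elim (simp add: abs_mult mult_left_mono)
  have W: "wgrad (\<lambda>x. \<phi> (u x)) (\<lambda>p. sqrt (w p) * Z' p)"
    using L2_bound[OF m YL le] Z'(1) unfolding wgrad_def by auto
  have "(L2_norm N (\<lambda>p. sqrt (w p) * Z' p))\<^sup>2 \<le> (L2_norm N Y)\<^sup>2"
    by (rule power_mono[OF L2_norm_mono[OF m YL le] L2_norm_nonneg])
  then show ?thesis using W unfolding form_eq[OF W] form_eq[OF Y] dom_iff by auto
qed

text \<open>The square has unbounded derivative, but \<open>f\<close> takes its values almost surely
  in an interval [-K, K]. Outside it the square is continued linearly, which gives a C1 function to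
  which the chain rule applies.\<close>

lemma wgrad_square:
  assumes f: "wgrad f Y" and b: "AE x in M. \<bar>f x\<bar> \<le> C"
  shows "wgrad (\<lambda>x. (f x)\<^sup>2) (\<lambda>p. 2 * f (fst p) * Y p)"
proof -
  define K where "K = \<bar>C\<bar>"
  have K: "0 \<le> K" "AE x in M. \<bar>f x\<bar> \<le> K" using b by (auto simp: K_def elim!: eventually_mono)
  \<comment> \<open>For y > K the value is y^2 - (y - K)^2 = 2Ky - K^2, the tangent at K, and
    symmetrically for y < -K.\<close>
  define \<psi> \<psi>' :: "real \<Rightarrow> real"
    where "\<psi> y = y\<^sup>2 - (max 0 (y - K))\<^sup>2 - (max 0 (- y - K))\<^sup>2"
      and "\<psi>' y = 2 * y - 2 * max 0 (y - K) + 2 * max 0 (- y - K)" for y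
  obtain Z where Z: "(f, Z) \<in> G" "AE p in N. Y p = sqrt (w p) * Z p"
    using f by (auto simp: wgrad_def)
  have fm[measurable]: "f \<in> borel_measurable M" and Ym[measurable]: "Y \<in> borel_measurable N"
    and Zm[measurable]: "Z \<in> borel_measurable N"
    using G_L2[OF Z(1)] wgrad_L2(2)[OF f] by auto
  have d: "(\<psi> has_real_derivative \<psi>' y) (at y)" for y
    unfolding \<psi>_def \<psi>'_def
    by (rule derivative_eq_intros refl DERIV_chain2[OF DERIV_pos_part_square] | simp)+
  have c: "continuous_on UNIV \<psi>'" unfolding \<psi>'_def by (intro continuous_intros)
  have bd: "\<bar>\<psi>' y\<bar> \<le> 2 * K" for y using K(1) by (auto simp: \<psi>'_def max_def)
  have eq: "\<psi> y = y\<^sup>2" "\<psi>' y = 2 * y" if "\<bar>y\<bar> \<le> K" for y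
  proof -
    have "max 0 (y - K) = 0" "max 0 (- y - K) = 0" using that by auto
    then show "\<psi> y = y\<^sup>2" "\<psi>' y = 2 * y" by (simp_all add: \<psi>_def \<psi>'_def)
  qed
  have KN: "AE p in N. \<bar>f (fst p)\<bar> \<le> K" by (rule AE_pair_fst[OF _ K(2)]) unfold_locales
  have "(\<lambda>x. (f x)\<^sup>2, \<lambda>p. 2 * f (fst p) * Z p) \<in> G"
  proof (rule G_AE_cong[OF G_chain[OF Z(1) d c bd]])
    show "AE x in M. \<psi> (f x) = (f x)\<^sup>2" using K(2) by eventually_elim (simp add: eq)
    show "AE p in N. \<psi>' (f (fst p)) * Z p = 2 * f (fst p) * Z p"
      using KN by eventually_elim (simp add: eq)
  qed measurable
  moreover have "AE p in N. 2 * f (fst p) * Y p = sqrt (w p) * (2 * f (fst p) * Z p)"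
    using Z(2) by eventually_elim simp
  moreover have "(\<lambda>p. 2 * f (fst p) * Y p) \<in> L2_space N"
  proof (rule L2_bounded_mult[OF wgrad_L2(2)[OF f]])
    show "AE p in N. \<bar>2 * f (fst p)\<bar> \<le> 2 * K" using KN by eventually_elim simp
  qed measurable
  ultimately show ?thesis unfolding wgrad_def by blast
qed

text \<open>The product rule is the polarization fh = ((f+h)^2 - (f-h)^2)/4 of the rule for
  squares.\<close>

lemma wgrad_mult:
  assumes f: "wgrad f Y" and h: "wgrad h Y'"
    and "essentially_bounded M f" "essentially_bounded M h"
  shows "wgrad (\<lambda>x. f x * h x) (\<lambda>p. f (fst p) * Y' p + h (fst p) * Y p)"
proof -
  obtain C C' where b: "AE x in M. \<bar>f x\<bar> \<le> C" "AE x in M. \<bar>h x\<bar> \<le> C'"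
    using assms by (auto simp: essentially_bounded_def)
  have "AE x in M. \<bar>f x + h x\<bar> \<le> C + C'" "AE x in M. \<bar>f x - h x\<bar> \<le> C + C'"
    using b by (eventually_elim, linarith)+
  note * = wgrad_square[OF wgrad_add[OF f h] this(1)] wgrad_square[OF wgrad_diff[OF f h] this(2)]
  have 1: "(\<lambda>x. 1/4 * ((f x + h x)\<^sup>2 - (f x - h x)\<^sup>2)) = (\<lambda>x. f x * h x)"
    by (auto simp: power2_eq_square field_simps)
  have 2: "(\<lambda>p. 1/4 * (2 * (f (fst p) + h (fst p)) * (Y p + Y' p) - 2 * (f (fst p) - h (fst p)) * (Y p - Y' p)))
    = (\<lambda>p. f (fst p) * Y' p + h (fst p) * Y p)"
    by (auto simp: field_simps)
  from wgrad_cmult[OF wgrad_diff[OF *], of "1/4"] show ?thesis unfolding 1 2 .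
qed

text \<open>With gradients \<open>F\<close> and \<open>H\<close> of f and h, the product rule turns
  2 E[fh, f] into the integral of (fH + hF)F, and E[h, f^2] into that of fHF. What remains is hF^2,
  which Fubini turns into h times the carre du champ. The factor 1/2 in the form is what makes the
  constants fit.\<close>

lemma gam_carre_du_champ: "carre_du_champ M dom form gam"
  unfolding carre_du_champ_def
proof (intro conjI ballI allI impI, unfold dom_iff)
  \<comment> \<open>Measurability has to come from the definition: agreeing almost everywhere with a
    measurable function does not give it, as \<open>M\<close> need not be complete.\<close>
  have ptw_meas: "polarize_ptw gam u v \<in> borel_measurable M" if "wgrad u Y" "wgrad v Y'" for u v Y Y'
  proof -
    have [measurable]: "gam (\<lambda>x. u x + v x) \<in> borel_measurable M" "gam (\<lambda>x. u x - v x) \<in> borel_measurable M"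
      using wgrad_add[OF that] wgrad_diff[OF that] by (intro gam_measurable; auto simp: dom_iff)+
    have "polarize_ptw gam u v = (\<lambda>x. (gam (\<lambda>x. u x + v x) x - gam (\<lambda>x. u x - v x) x) / 4)"
      by (auto simp: polarize_ptw_def polarize_def)
    then show ?thesis by simp
  qed
  show "integrable M (polarize_ptw gam u v)" if "\<exists>Y. wgrad u Y" "\<exists>Y. wgrad v Y" for u v
  proof -
    from that obtain Y Y' where Y: "wgrad u Y" "wgrad v Y'" by blast
    note int = L2_integrable_mult[OF Y[THEN wgrad_L2(2)]]
    have "integrable M (\<lambda>x. \<integral>t. Y (x, t) * Y' (x, t) \<partial>T)"
      using N.integrable_fst'[OF int] .
    then show ?thesis
      using gam_polarize[OF Y] ptw_meas[OF Y] by (subst integrable_cong_AE) auto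
  qed
  show "AE x in M. gam u x = gam v x" if "\<exists>Y. wgrad u Y" "\<exists>Y. wgrad v Y" "AE x in M. u x = v x" for u v
    using form_AE_cong(2)[OF _ _ that(3)] that by (simp add: dom_iff)
  show "AE x in M. gam u x = polarize_ptw gam u u x \<and> 0 \<le> gam u x" if "\<exists>Y. wgrad u Y" for u
  proof -
    from that obtain Y where Y: "wgrad u Y" by blast
    show ?thesis using gam_eq[OF Y] gam_polarize[OF Y Y]
      by eventually_elim (simp add: power2_eq_square)
  qed
  show "AE x in M. polarize_ptw gam u v x = polarize_ptw gam v u x"
    if "\<exists>Y. wgrad u Y" "\<exists>Y. wgrad v Y" for u v
  proof -
    from that obtain Y Y' where Y: "wgrad u Y" "wgrad v Y'" by blast
    show ?thesis using gam_polarize[OF Y] gam_polarize[OF Y(2,1)]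
      by eventually_elim (simp add: mult.commute)
  qed
  show "AE x in M. polarize_ptw gam (\<lambda>y. u y + v y) z x = polarize_ptw gam u z x + polarize_ptw gam v z x"
    if "\<exists>Y. wgrad u Y" "\<exists>Y. wgrad v Y" "\<exists>Y. wgrad z Y" for u v z
  proof -
    from that obtain Y Y' Y'' where Y: "wgrad u Y" "wgrad v Y'" "wgrad z Y''" by blast
    show ?thesis
      using gam_polarize[OF wgrad_add[OF Y(1,2)] Y(3)] gam_polarize[OF Y(1,3)] gam_polarize[OF Y(2,3)]
        AE_sections[OF L2_integrable_mult[OF Y(1)[THEN wgrad_L2(2)] Y(3)[THEN wgrad_L2(2)]]]
        AE_sections[OF L2_integrable_mult[OF Y(2)[THEN wgrad_L2(2)] Y(3)[THEN wgrad_L2(2)]]]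
      by eventually_elim (simp add: distrib_right)
  qed
  show "AE x in M. polarize_ptw gam (\<lambda>y. c * u y) v x = c * polarize_ptw gam u v x"
    if "\<exists>Y. wgrad u Y" "\<exists>Y. wgrad v Y" for c u v
  proof -
    from that obtain Y Y' where Y: "wgrad u Y" "wgrad v Y'" by blast
    show ?thesis using gam_polarize[OF wgrad_cmult[OF Y(1)] Y(2)] gam_polarize[OF Y]
      by eventually_elim (simp add: mult.assoc)
  qed
  fix f h
  assume "\<exists>Y. wgrad f Y" "\<exists>Y. wgrad h Y" and b: "essentially_bounded M f \<and> essentially_bounded M h"
  then obtain F H where F: "wgrad f F" and H: "wgrad h H" by blast
  obtain C C' where bf: "AE x in M. \<bar>f x\<bar> \<le> C" and bh: "AE x in M. \<bar>h x\<bar> \<le> C'"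
    using b by (auto simp: essentially_bounded_def)
  note fh = wgrad_mult[OF F H conjunct1[OF b] conjunct2[OF b]] and ff = wgrad_square[OF F bf]
  show "\<exists>Y. wgrad (\<lambda>x. f x * h x) Y" "\<exists>Y. wgrad (\<lambda>x. (f x)\<^sup>2) Y" using fh ff by blast+
  have [measurable]: "f \<in> borel_measurable M" "h \<in> borel_measurable M"
    "F \<in> borel_measurable N" "H \<in> borel_measurable N"
    using wgrad_L2[OF F] wgrad_L2[OF H] by auto
  have L: "(\<lambda>p. f (fst p) * H p) \<in> L2_space N" "(\<lambda>p. h (fst p) * F p) \<in> L2_space N"
    using L2_bounded_mult[OF wgrad_L2(2)[OF H] _ AE_pair_fst[OF T.sigma_finite_measure_axioms bf]]
      L2_bounded_mult[OF wgrad_L2(2)[OF F] _ AE_pair_fst[OF T.sigma_finite_measure_axioms bh]]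
    by simp_all
  note int = L2_integrable_mult[OF L(1) wgrad_L2(2)[OF F]] L2_integrable_mult[OF L(2) wgrad_L2(2)[OF F]]
  have "(\<integral>p. H p * (2 * f (fst p) * F p) \<partial>N) = (\<integral>p. 2 * (f (fst p) * H p * F p) \<partial>N)"
    by (simp add: ac_simps)
  also have "\<dots> = 2 * (\<integral>p. f (fst p) * H p * F p \<partial>N)" by simp
  finally have eq: "(\<integral>p. H p * (2 * f (fst p) * F p) \<partial>N) = 2 * (\<integral>p. f (fst p) * H p * F p \<partial>N)" .
  have "2 * polarize form (\<lambda>x. f x * h x) f - polarize form h (\<lambda>x. (f x)\<^sup>2)
      = (\<integral>p. f (fst p) * H p * F p + h (fst p) * F p * F p \<partial>N) - (\<integral>p. f (fst p) * H p * F p \<partial>N)"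
    unfolding form_polarize[OF fh F] form_polarize[OF H ff] eq
    by (simp add: algebra_simps)
  also have "\<dots> = (\<integral>p. h (fst p) * F p * F p \<partial>N)" using int by simp
  also have "\<dots> = (\<integral>x. (\<integral>t. h x * F (x, t) * F (x, t) \<partial>T) \<partial>M)"
    using N.integral_fst'[OF int(2)] by simp
  also have "\<dots> = (\<integral>x. h x * gam f x \<partial>M)"
  proof (rule integral_cong_AE)
    have "f \<in> dom" using F by (auto simp: dom_iff)
    from gam_measurable[OF this] show "(\<lambda>x. h x * gam f x) \<in> borel_measurable M" by measurable
    show "AE x in M. (\<integral>t. h x * F (x, t) * F (x, t) \<partial>T) = h x * gam f x"
      using gam_eq[OF F] by eventually_elim (simp add: power2_eq_square mult.assoc)
  qed measurable
  finally show "2 * polarize form (\<lambda>x. f x * h x) f - polarize form h (\<lambda>x. (f x)\<^sup>2) = (\<integral>x. h x * gam f x \<partial>M)" .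
qed

text \<open>Density stays a hypothesis because it cannot follow from the locale: almost surely
  constant functions with zero gradient satisfy all its axioms.\<close>

theorem dirichlet_form_dom:
  assumes "L2_dense M dom"
  shows "dirichlet_form M dom form"
  unfolding dirichlet_form_def
proof (intro conjI ballI allI impI)
  fix u \<phi> assume u: "u \<in> dom" and "\<phi> 0 = (0::real) \<and> (\<forall>x y. \<bar>\<phi> x - \<phi> y\<bar> \<le> \<bar>x - y\<bar>)"
  then have "\<And>x y. \<bar>\<phi> x - \<phi> y\<bar> \<le> \<bar>x - y\<bar>" by blast
  from form_contraction[OF u this] show "(\<lambda>x. \<phi> (u x)) \<in> dom" "form (\<lambda>x. \<phi> (u x)) \<le> form u"
    by auto
qed (rule form_nonneg_quadratic assms form_closed)+

end

section \<open>Continuously differentiable Lipschitz functions of finitely many coordinates\<close>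

lemma tendsto_fun_iff:
  fixes f :: "'a \<Rightarrow> 'i \<Rightarrow> 'b::topological_space"
  shows "(f \<longlongrightarrow> l) F \<longleftrightarrow> (\<forall>i. ((\<lambda>x. f x i) \<longlongrightarrow> l i) F)"
  using limitin_componentwise[of "\<lambda>_. euclidean" UNIV f l F]
  by (simp add: euclidean_product_topology limitin_canonical_iff)

text \<open>Trades the Euclidean norm for the sum norm, which is handled coordinate by coordinate.
  The same constant bounds the partial derivatives, as limits of difference quotients.\<close>

lemma C1_lipschitz_bound:
  assumes "C1_lipschitz m \<Phi> d"
  obtains L where "0 \<le> L" "\<And>x y. \<bar>\<Phi> x - \<Phi> y\<bar> \<le> L * (\<Sum>i<m. \<bar>x i - y i\<bar>)"
    "\<And>i x. i < m \<Longrightarrow> \<bar>d i x\<bar> \<le> L"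
proof -
  obtain L0 where L0: "\<And>x y. \<bar>\<Phi> x - \<Phi> y\<bar> \<le> L0 * L2_set (\<lambda>i. x i - y i) {..<m}"
    using assms by (auto simp: C1_lipschitz_def)
  \<comment> \<open>For m = 0 the given constant may be negative.\<close>
  define L where "L = max 0 L0"
  have L: "\<bar>\<Phi> x - \<Phi> y\<bar> \<le> L * (\<Sum>i<m. \<bar>x i - y i\<bar>)" for x y
  proof -
    have "\<bar>\<Phi> x - \<Phi> y\<bar> \<le> L0 * L2_set (\<lambda>i. x i - y i) {..<m}" by (rule L0)
    also have "\<dots> \<le> L * L2_set (\<lambda>i. x i - y i) {..<m}"
      by (rule mult_right_mono) (auto simp: L_def)
    also have "\<dots> \<le> L * (\<Sum>i<m. \<bar>x i - y i\<bar>)"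
      by (rule mult_left_mono[OF L2_set_le_sum_abs]) (auto simp: L_def)
    finally show ?thesis .
  qed
  have "\<bar>d i x\<bar> \<le> L" if "i < m" for i x
  proof -
    have "((\<lambda>s. \<Phi> (x(i := s))) has_real_derivative d i x) (at (x i))"
      using assms that by (auto simp: C1_lipschitz_def)
    then have "((\<lambda>h. (\<Phi> (x(i := x i + h)) - \<Phi> x) / h) \<longlongrightarrow> d i x) (at 0)"
      by (simp add: DERIV_def)
    then have "((\<lambda>h. \<bar>(\<Phi> (x(i := x i + h)) - \<Phi> x) / h\<bar>) \<longlongrightarrow> \<bar>d i x\<bar>) (at 0)"
      by (rule tendsto_rabs)
    moreover have "\<forall>\<^sub>F h in at 0. \<bar>(\<Phi> (x(i := x i + h)) - \<Phi> x) / h\<bar> \<le> L"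
      unfolding eventually_at_filter
    proof (rule always_eventually, intro allI impI)
      fix h :: real assume "h \<noteq> 0"
      have "(\<Sum>j<m. \<bar>(x(i := x i + h)) j - x j\<bar>) = (\<Sum>j<m. if j = i then \<bar>h\<bar> else 0)"
        by (intro sum.cong) auto
      also have "\<dots> = \<bar>h\<bar>" using that by simp
      finally have "\<bar>\<Phi> (x(i := x i + h)) - \<Phi> x\<bar> \<le> L * \<bar>h\<bar>"
        using L[of "x(i := x i + h)" x] by simp
      then show "\<bar>(\<Phi> (x(i := x i + h)) - \<Phi> x) / h\<bar> \<le> L"
        using \<open>h \<noteq> 0\<close> by (simp add: abs_divide divide_le_eq)
    qed
    ultimately show ?thesis by (rule tendsto_upperbound) simp
  qed
  with L show ?thesis by (intro that[of L]) (auto simp: L_def)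
qed

text \<open>A vanishing right-hand side in the Lipschitz bound identifies the values of
  \<open>\<Phi>\<close>; the partial derivatives then agree by uniqueness of derivatives.\<close>

lemma C1_lipschitz_cong:
  assumes "C1_lipschitz m \<Phi> d" "\<And>i. i < m \<Longrightarrow> x i = y i"
  shows "\<Phi> x = \<Phi> y" "i < m \<Longrightarrow> d i x = d i y"
proof -
  obtain L where "0 \<le> L" and L: "\<And>x y. \<bar>\<Phi> x - \<Phi> y\<bar> \<le> L * (\<Sum>i<m. \<bar>x i - y i\<bar>)"
    using C1_lipschitz_bound[OF assms(1)] by metis
  have eq: "\<Phi> x = \<Phi> y" if "\<And>i. i < m \<Longrightarrow> x i = y i" for x y
  proof -
    have "(\<Sum>i<m. \<bar>x i - y i\<bar>) = 0" using that by simp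
    with L[of x y] show ?thesis by simp
  qed
  then show "\<Phi> x = \<Phi> y" using assms(2) by blast
  assume "i < m"
  have "((\<lambda>s. \<Phi> (x(i := s))) has_real_derivative d i x) (at (x i))"
    "((\<lambda>s. \<Phi> (y(i := s))) has_real_derivative d i y) (at (y i))"
    using assms(1) \<open>i < m\<close> by (auto simp: C1_lipschitz_def)
  moreover have "(\<lambda>s. \<Phi> (x(i := s))) = (\<lambda>s. \<Phi> (y(i := s)))"
    using assms(2) by (intro ext eq) auto
  ultimately show "d i x = d i y"
    using assms(2)[OF \<open>i < m\<close>] by (metis DERIV_unique)
qed

text \<open>Setting all further coordinates to 0 reconciles continuity in the infinite product with
  arguments of which only the first m coordinates are known to converge or to be measurable.\<close>

lemma C1_lipschitz_cong_restrict:
  assumes "C1_lipschitz m \<Phi> d"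
  shows "\<Phi> (\<lambda>i. if i < m then x i else 0) = \<Phi> x"
    "i < m \<Longrightarrow> d i (\<lambda>i. if i < m then x i else 0) = d i x"
  using C1_lipschitz_cong[OF assms, of "\<lambda>i. if i < m then x i else 0" x] by auto

lemma C1_lipschitz_tendsto:
  assumes "C1_lipschitz m \<Phi> d" "\<And>i. i < m \<Longrightarrow> ((\<lambda>n. X n i) \<longlongrightarrow> x i) F"
  shows "((\<lambda>n. \<Phi> (X n)) \<longlongrightarrow> \<Phi> x) F" "i < m \<Longrightarrow> ((\<lambda>n. d i (X n)) \<longlongrightarrow> d i x) F"
proof -
  obtain L where L: "\<And>x y. \<bar>\<Phi> x - \<Phi> y\<bar> \<le> L * (\<Sum>i<m. \<bar>x i - y i\<bar>)"
    using C1_lipschitz_bound[OF assms(1)] by metis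
  have "((\<lambda>n. L * (\<Sum>i<m. \<bar>X n i - x i\<bar>)) \<longlongrightarrow> L * (\<Sum>i<m. \<bar>x i - x i\<bar>)) F"
    by (intro tendsto_intros assms(2)) auto
  then have "((\<lambda>n. L * (\<Sum>i<m. \<bar>X n i - x i\<bar>)) \<longlongrightarrow> 0) F" by simp
  then have "((\<lambda>n. \<Phi> (X n) - \<Phi> x) \<longlongrightarrow> 0) F"
    by (rule Lim_null_comparison[rotated]) (simp add: L)
  then show "((\<lambda>n. \<Phi> (X n)) \<longlongrightarrow> \<Phi> x) F" by (simp add: LIM_zero_iff)
  assume i: "i < m"
  then have "continuous_on UNIV (d i)" using assms(1) by (simp add: C1_lipschitz_def)
  moreover have "((\<lambda>n i. if i < m then X n i else 0) \<longlongrightarrow> (\<lambda>i. if i < m then x i else 0)) F"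
    unfolding tendsto_fun_iff using assms(2) by auto
  ultimately have "((\<lambda>n. d i (\<lambda>i. if i < m then X n i else 0)) \<longlongrightarrow> d i (\<lambda>i. if i < m then x i else 0)) F"
    using continuous_on_tendsto_compose[of UNIV "d i"] by auto
  then show "((\<lambda>n. d i (X n)) \<longlongrightarrow> d i x) F"
    by (simp add: C1_lipschitz_cong_restrict(2)[OF assms(1) i])
qed

lemma C1_lipschitz_continuous:
  assumes "C1_lipschitz m \<Phi> d"
  shows "continuous_on UNIV \<Phi>"
  unfolding continuous_on_def
proof
  fix x :: "nat \<Rightarrow> real"
  have "((\<lambda>y. y) \<longlongrightarrow> x) (at x)" by (rule tendsto_ident_at)
  then show "(\<Phi> \<longlongrightarrow> \<Phi> x) (at x)"
    unfolding tendsto_fun_iff by (intro C1_lipschitz_tendsto(1)[OF assms]) auto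
qed

lemma C1_lipschitz_measurable:
  assumes C1: "C1_lipschitz m \<Phi> d" and X: "\<And>i. i < m \<Longrightarrow> X i \<in> borel_measurable M"
  shows "(\<lambda>\<omega>. \<Phi> (\<lambda>i. X i \<omega>)) \<in> borel_measurable M"
    "i < m \<Longrightarrow> (\<lambda>\<omega>. d i (\<lambda>i. X i \<omega>)) \<in> borel_measurable M"
proof -
  have m: "(\<lambda>\<omega> i. if i < m then X i \<omega> else 0) \<in> borel_measurable M"
  proof (rule measurable_coordinatewise_then_product)
    show "(\<lambda>\<omega>. if i < m then X i \<omega> else 0) \<in> borel_measurable M" for i
      using X by (cases "i < m") auto
  qed
  from borel_measurable_continuous_on[OF C1_lipschitz_continuous[OF C1] m]
  show "(\<lambda>\<omega>. \<Phi> (\<lambda>i. X i \<omega>)) \<in> borel_measurable M"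
    by (simp add: C1_lipschitz_cong_restrict(1)[OF C1])
  assume i: "i < m"
  then have "continuous_on UNIV (d i)" using C1 by (simp add: C1_lipschitz_def)
  from borel_measurable_continuous_on[OF this m]
  show "(\<lambda>\<omega>. d i (\<lambda>i. X i \<omega>)) \<in> borel_measurable M"
    by (simp add: C1_lipschitz_cong_restrict(2)[OF C1 i])
qed

text \<open>Only partial derivatives are given; moving one coordinate at a time, the mean value theorem
  and continuity of the partial derivatives give the derivative along a line.\<close>

lemma C1_lipschitz_DERIV_line:
  assumes C1: "C1_lipschitz m \<Phi> d"
  shows "((\<lambda>s. \<Phi> (\<lambda>i. a i + s * c i)) has_real_derivative
    (\<Sum>i<m. d i (\<lambda>i. a i + s0 * c i) * c i)) (at s0)"
proof -
  define x0 where "x0 i = a i + s0 * c i" for i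
  \<comment> \<open>The first j coordinates move along the line, the others stay at their values for
    \<open>s0\<close>; induction on j releases them one after the other.\<close>
  define p where "p j s i = (if i < j then a i + s * c i else x0 i)" for j s i
  have "((\<lambda>s. \<Phi> (p j s)) has_real_derivative (\<Sum>i<j. d i x0 * c i)) (at s0)" if "j \<le> m" for j
    using that
  proof (induction j)
    case 0
    have "p 0 s = x0" for s by (simp add: p_def fun_eq_iff)
    then show ?case by simp
  next
    case (Suc j)
    then have j: "j < m" by simp
    have dP: "((\<lambda>t. \<Phi> (x(j := t))) has_real_derivative d j (x(j := t))) (at t)" for x t
    proof -
      have "((\<lambda>s. \<Phi> ((x(j := t))(j := s))) has_real_derivative d j (x(j := t))) (at ((x(j := t)) j))"
        using C1 j unfolding C1_lipschitz_def by blast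
      then show ?thesis by simp
    qed
    have pS: "p (Suc j) s = (p j s)(j := x0 j + (s - s0) * c j)" for s
      by (auto simp: p_def x0_def fun_eq_iff algebra_simps less_Suc_eq)
    \<comment> \<open>Mean value theorem in coordinate j. The sign of the displacement decides the
      orientation of the interval, and for a zero displacement any point close enough would
      do.\<close>
    have "\<exists>z. \<bar>z - x0 j\<bar> \<le> \<bar>(s - s0) * c j\<bar> \<and>
        \<Phi> (p (Suc j) s) - \<Phi> (p j s) = d j ((p j s)(j := z)) * ((s - s0) * c j)" for s
    proof -
      have pj: "p j s = (p j s)(j := x0 j)" by (auto simp: p_def)
      let ?h = "(s - s0) * c j" and ?g = "\<lambda>t. \<Phi> ((p j s)(j := t))"
      consider "?h = 0" | "?h > 0" | "?h < 0" by linarith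
      then show ?thesis
      proof cases
        case 1 then show ?thesis unfolding pS using pj by (intro exI[of _ "x0 j"]) auto
      next
        case 2
        then obtain z where "x0 j < z" "z < x0 j + ?h"
          "?g (x0 j + ?h) - ?g (x0 j) = (x0 j + ?h - x0 j) * d j ((p j s)(j := z))"
          using MVT2[of "x0 j" "x0 j + ?h" ?g "\<lambda>z. d j ((p j s)(j := z))"] dP by auto
        then show ?thesis unfolding pS using pj by (intro exI[of _ z]) auto
      next
        case 3
        then obtain z where "x0 j + ?h < z" "z < x0 j"
          "?g (x0 j) - ?g (x0 j + ?h) = (x0 j - (x0 j + ?h)) * d j ((p j s)(j := z))"
          using MVT2[of "x0 j + ?h" "x0 j" ?g "\<lambda>z. d j ((p j s)(j := z))"] dP by auto
        then show ?thesis unfolding pS using pj by (intro exI[of _ z]) (auto simp: algebra_simps)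
      qed
    qed
    then obtain z where z: "\<And>s. \<bar>z s - x0 j\<bar> \<le> \<bar>(s - s0) * c j\<bar>"
      "\<And>s. \<Phi> (p (Suc j) s) - \<Phi> (p j s) = d j ((p j s)(j := z s)) * ((s - s0) * c j)"
      by metis
    have zlim: "(z \<longlongrightarrow> x0 j) (at s0)"
    proof -
      have "((\<lambda>s. \<bar>(s - s0) * c j\<bar>) \<longlongrightarrow> \<bar>(s0 - s0) * c j\<bar>) (at s0)" by (intro tendsto_intros)
      then have "((\<lambda>s. \<bar>(s - s0) * c j\<bar>) \<longlongrightarrow> 0) (at s0)" by simp
      then have "((\<lambda>s. z s - x0 j) \<longlongrightarrow> 0) (at s0)"
        by (rule Lim_null_comparison[rotated]) (use z(1) in auto)
      then show ?thesis by (simp add: LIM_zero_iff)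
    qed
    have plim: "((\<lambda>s. p j s i) \<longlongrightarrow> x0 i) (at s0)" for i
      unfolding p_def x0_def by (cases "i < j") (auto intro!: tendsto_intros)
    have g0: "(p j s0)(j := z s0) = x0"
      using z(1)[of s0] by (auto simp: p_def x0_def fun_eq_iff)
    have "((\<lambda>s. d j ((p j s)(j := z s)) * c j) \<longlongrightarrow> d j x0 * c j) (at s0)"
    proof (intro tendsto_mult tendsto_const C1_lipschitz_tendsto(2)[OF C1 _ j])
      show "((\<lambda>s. ((p j s)(j := z s)) i) \<longlongrightarrow> x0 i) (at s0)" for i
        by (cases "i = j") (simp_all add: plim zlim)
    qed
    then have isC: "isCont (\<lambda>s. d j ((p j s)(j := z s)) * c j) s0"
      by (simp add: isCont_def g0)
    have z0: "\<Phi> (p (Suc j) s0) - \<Phi> (p j s0) = 0" unfolding z(2) by simp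
    \<comment> \<open>Caratheodory's form of the derivative: the increment is (s - s0) times a
      factor continuous at \<open>s0\<close>. Joint continuity of \<open>d j\<close> is used here,
      as the earlier coordinates move as well.\<close>
    have "((\<lambda>s. \<Phi> (p (Suc j) s) - \<Phi> (p j s)) has_real_derivative d j x0 * c j) (at s0)"
      unfolding CARAT_DERIV
      by (intro exI[of _ "\<lambda>s. d j ((p j s)(j := z s)) * c j"] conjI allI isC)
        (unfold z0, simp_all add: z(2) g0)
    from DERIV_add[OF this Suc.IH] j show ?case by (simp add: add.commute)
  qed
  from this[of m] have "((\<lambda>s. \<Phi> (p m s)) has_real_derivative (\<Sum>i<m. d i x0 * c i)) (at s0)" by simp
  moreover have "(\<lambda>s. \<Phi> (p m s)) = (\<lambda>s. \<Phi> (\<lambda>i. a i + s * c i))"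
    by (intro ext C1_lipschitz_cong(1)[OF C1]) (simp add: p_def)
  ultimately show ?thesis by (simp add: x0_def[abs_def])
qed

section \<open>Gaussian integration by parts\<close>

lemma DERIV_normal_density:
  assumes "0 < \<sigma>"
  shows "(normal_density 0 \<sigma> has_real_derivative - (x / \<sigma>\<^sup>2) * normal_density 0 \<sigma> x) (at x)"
  unfolding normal_density_def[abs_def]
  by (rule derivative_eq_intros refl | use assms in \<open>simp add: field_simps\<close>)+

text \<open>From x \<le> exp x the density is at most K/y^2, which already beats linear growth.
  These are the boundary terms of the integration by parts.\<close>

lemma normal_density_tendsto:
  assumes \<sigma>: "0 < \<sigma>" and f: "\<And>y. \<bar>f y\<bar> \<le> a + L * \<bar>y\<bar>"
  shows "((\<lambda>y. normal_density 0 \<sigma> y * f y) \<longlongrightarrow> 0) at_top"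
    "((\<lambda>y. normal_density 0 \<sigma> y * f y) \<longlongrightarrow> 0) at_bot"
proof -
  define K where "K = 1 / sqrt (2 * pi * \<sigma>\<^sup>2) * (2 * \<sigma>\<^sup>2)"
  have K: "0 \<le> K" by (simp add: K_def)
  have le: "normal_density 0 \<sigma> y \<le> K / y\<^sup>2" if "y \<noteq> 0" for y
  proof -
    have pos: "0 < y\<^sup>2 / (2 * \<sigma>\<^sup>2)" using that \<sigma> by simp
    moreover have "y\<^sup>2 / (2 * \<sigma>\<^sup>2) \<le> exp (y\<^sup>2 / (2 * \<sigma>\<^sup>2))"
      using exp_ge_add_one_self[of "y\<^sup>2 / (2 * \<sigma>\<^sup>2)"] by linarith
    ultimately have "exp (- (y\<^sup>2 / (2 * \<sigma>\<^sup>2))) \<le> 1 / (y\<^sup>2 / (2 * \<sigma>\<^sup>2))"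
      unfolding exp_minus inverse_eq_divide by (intro frac_le) auto
    also have "\<dots> = 2 * \<sigma>\<^sup>2 / y\<^sup>2" by simp
    finally have "exp (- (y\<^sup>2 / (2 * \<sigma>\<^sup>2))) \<le> 2 * \<sigma>\<^sup>2 / y\<^sup>2" .
    then have "1 / sqrt (2 * pi * \<sigma>\<^sup>2) * exp (- (y\<^sup>2 / (2 * \<sigma>\<^sup>2))) \<le> 1 / sqrt (2 * pi * \<sigma>\<^sup>2) * (2 * \<sigma>\<^sup>2 / y\<^sup>2)"
      by (rule mult_left_mono) simp
    then show ?thesis by (simp add: normal_density_def K_def)
  qed
  have bound: "norm (normal_density 0 \<sigma> y * f y) \<le> K * a * (1 / y\<^sup>2) + K * L * (1 / \<bar>y\<bar>)" if "y \<noteq> 0" for y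
  proof -
    have "norm (normal_density 0 \<sigma> y * f y) \<le> K / y\<^sup>2 * (a + L * \<bar>y\<bar>)"
      unfolding real_norm_def abs_mult
      using le[OF that] f[of y] by (intro mult_mono) (auto simp: K)
    also have "\<dots> = K * a * (1 / y\<^sup>2) + K * L * (\<bar>y\<bar> / y\<^sup>2)"
      by (simp add: distrib_left add_divide_distrib)
    also have "\<bar>y\<bar> / y\<^sup>2 = 1 / \<bar>y\<bar>"
      by (cases "y > 0") (use that in \<open>auto simp: power2_eq_square\<close>)
    finally show ?thesis .
  qed
  have *: "((\<lambda>y. normal_density 0 \<sigma> y * f y) \<longlongrightarrow> 0) F"
    if "((\<lambda>y::real. 1 / y\<^sup>2) \<longlongrightarrow> 0) F" "((\<lambda>y::real. 1 / \<bar>y\<bar>) \<longlongrightarrow> 0) F"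
      "eventually (\<lambda>y. y \<noteq> 0) F" for F
  proof (rule Lim_null_comparison)
    show "\<forall>\<^sub>F y in F. norm (normal_density 0 \<sigma> y * f y) \<le> K * a * (1 / y\<^sup>2) + K * L * (1 / \<bar>y\<bar>)"
      using that(3) by eventually_elim (rule bound)
    have "((\<lambda>y. K * a * (1 / y\<^sup>2) + K * L * (1 / \<bar>y\<bar>)) \<longlongrightarrow> K * a * 0 + K * L * 0) F"
      by (intro tendsto_add tendsto_mult tendsto_const that)
    then show "((\<lambda>y. K * a * (1 / y\<^sup>2) + K * L * (1 / \<bar>y\<bar>)) \<longlongrightarrow> 0) F" by simp
  qed
  show "((\<lambda>y. normal_density 0 \<sigma> y * f y) \<longlongrightarrow> 0) at_top"
  proof (rule *)
    show "((\<lambda>y::real. 1 / y\<^sup>2) \<longlongrightarrow> 0) at_top" "((\<lambda>y::real. 1 / \<bar>y\<bar>) \<longlongrightarrow> 0) at_top"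
      by real_asymp+
    show "eventually (\<lambda>y::real. y \<noteq> 0) at_top"
      using eventually_gt_at_top[of "0::real"] by eventually_elim simp
  qed
  show "((\<lambda>y. normal_density 0 \<sigma> y * f y) \<longlongrightarrow> 0) at_bot"
  proof (rule *)
    show "((\<lambda>y::real. 1 / y\<^sup>2) \<longlongrightarrow> 0) at_bot" "((\<lambda>y::real. 1 / \<bar>y\<bar>) \<longlongrightarrow> 0) at_bot"
      by real_asymp+
    show "eventually (\<lambda>y::real. y \<noteq> 0) at_bot"
      using eventually_gt_at_bot[of "0::real"] by eventually_elim simp
  qed
qed

text \<open>Stein's identity: the derivative of density times f is the density times f' -
  yf/\<sigma>^2, and it integrates to 0 over the line because the boundary terms vanish.\<close>

lemma normal_density_stein:
  assumes \<sigma>: "0 < \<sigma>" and d: "\<And>x. (f has_real_derivative f' x) (at x)"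
    and c: "continuous_on UNIV f'" and L: "\<And>x. \<bar>f' x\<bar> \<le> L"
  shows "(\<integral>y. normal_density 0 \<sigma> y * (f y * y) \<partial>lborel) = \<sigma>\<^sup>2 * (\<integral>y. normal_density 0 \<sigma> y * f' y \<partial>lborel)"
proof -
  let ?n = "normal_density 0 \<sigma>"
  have contf: "continuous_on UNIV f"
    by (rule DERIV_continuous_on[where D=f']) (use d in auto)
  have [measurable]: "f \<in> borel_measurable borel" "f' \<in> borel_measurable borel"
    using contf c by (auto intro: borel_measurable_continuous_onI)
  have fb: "\<bar>f y\<bar> \<le> \<bar>f 0\<bar> + L * \<bar>y\<bar>" for y
  proof -
    have "norm (f y - f 0) \<le> L * norm (y - 0)"
      by (rule field_differentiable_bound[of UNIV f f']) (use d L in auto)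
    then show ?thesis by simp
  qed
  have i1: "integrable lborel (\<lambda>y. ?n y * (f y * y))"
  proof (rule Bochner_Integration.integrable_bound)
    show "integrable lborel (\<lambda>y. \<bar>f 0\<bar> * (?n y * \<bar>y - 0\<bar> ^ 1) + L * (?n y * (y - 0) ^ 2))"
      using integrable_normal_moment_abs[OF \<sigma>, of 0 1] integrable_normal_moment[OF \<sigma>, of 0 2]
      by (intro Bochner_Integration.integrable_add integrable_mult_right)
    show "AE y in lborel. norm (?n y * (f y * y)) \<le> norm (\<bar>f 0\<bar> * (?n y * \<bar>y - 0\<bar> ^ 1) + L * (?n y * (y - 0) ^ 2))"
    proof (rule AE_I2)
      fix y
      have "?n y * (\<bar>f y\<bar> * \<bar>y\<bar>) \<le> ?n y * ((\<bar>f 0\<bar> + L * \<bar>y\<bar>) * \<bar>y\<bar>)"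
        by (intro mult_left_mono mult_right_mono fb) auto
      then show "norm (?n y * (f y * y)) \<le> norm (\<bar>f 0\<bar> * (?n y * \<bar>y - 0\<bar> ^ 1) + L * (?n y * (y - 0) ^ 2))"
        by (simp add: abs_mult algebra_simps power2_eq_square)
    qed
  qed measurable
  have i2: "integrable lborel (\<lambda>y. ?n y * f' y)"
  proof (rule Bochner_Integration.integrable_bound)
    show "integrable lborel (\<lambda>y. L * ?n y)" using integrable_normal_density[OF \<sigma>] by simp
    show "AE y in lborel. norm (?n y * f' y) \<le> norm (L * ?n y)"
    proof (rule AE_I2)
      fix y show "norm (?n y * f' y) \<le> norm (L * ?n y)"
        using mult_left_mono[OF L[of y], of "?n y"] L[of y]
        by (simp add: abs_mult mult.commute)
    qed
  qed measurable
  let ?g = "\<lambda>y. ?n y * f' y - 1 / \<sigma>\<^sup>2 * (?n y * (f y * y))"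
  have "(LBINT y=-\<infinity>..\<infinity>. ?g y) = 0 - 0"
  proof (rule interval_integral_FTC_integrable)
    show "((\<lambda>y. ?n y * f y) has_vector_derivative ?g x) (at x)" for x
      unfolding has_real_derivative_iff_has_vector_derivative[symmetric]
      using DERIV_mult[OF DERIV_normal_density[OF \<sigma>, of x] d[of x]]
      by (rule DERIV_cong) (simp add: field_simps)
    show "isCont ?g x" for x
    proof -
      have "continuous_on UNIV ?g"
        unfolding normal_density_def by (intro continuous_intros c contf) (use \<sigma> in auto)
      then show ?thesis by (simp add: continuous_on_eq_continuous_at)
    qed
    show "set_integrable lborel (einterval (- \<infinity>) \<infinity>) ?g"
      unfolding set_integrable_def by (simp add: i1 i2)
    show "(((\<lambda>y. ?n y * f y) \<circ> real_of_ereal) \<longlongrightarrow> 0) (at_right (- \<infinity>))"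
      "(((\<lambda>y. ?n y * f y) \<circ> real_of_ereal) \<longlongrightarrow> 0) (at_left \<infinity>)"
      unfolding ereal_tendsto_simps by (rule normal_density_tendsto[OF \<sigma> fb])+
  qed simp
  then have "(\<integral>y. ?g y \<partial>lborel) = 0"
    by (simp add: interval_lebesgue_integral_def set_lebesgue_integral_def)
  then have "(\<integral>y. ?n y * f' y \<partial>lborel) - 1 / \<sigma>\<^sup>2 * (\<integral>y. ?n y * (f y * y) \<partial>lborel) = 0"
    by (subst (asm) Bochner_Integration.integral_diff) (use i1 i2 in auto)
  then show ?thesis using \<sigma> by (simp add: field_simps)
qed

lemma (in prob_space) C1_lipschitz_L2:
  assumes C1: "C1_lipschitz m \<Phi> d" and X: "\<And>i. i < m \<Longrightarrow> X i \<in> L2_space M"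
  shows "(\<lambda>\<omega>. \<Phi> (\<lambda>i. X i \<omega>)) \<in> L2_space M"
proof -
  obtain L where "0 \<le> L" and L: "\<And>x y. \<bar>\<Phi> x - \<Phi> y\<bar> \<le> L * (\<Sum>i<m. \<bar>x i - y i\<bar>)"
    using C1_lipschitz_bound[OF C1] by metis
  have abs: "(\<lambda>\<omega>. \<bar>X i \<omega>\<bar>) \<in> L2_space M" if "i < m" for i
    by (rule L2_bound[OF _ X[OF that]]) (use L2_measurable[OF X[OF that]] in auto)
  show ?thesis
  proof (rule L2_bound)
    show "(\<lambda>\<omega>. \<Phi> (\<lambda>i. X i \<omega>)) \<in> borel_measurable M"
      by (rule C1_lipschitz_measurable(1)[OF C1]) (use X in auto)
    show "(\<lambda>\<omega>. \<bar>\<Phi> (\<lambda>_. 0)\<bar> + L * (\<Sum>i<m. \<bar>X i \<omega>\<bar>)) \<in> L2_space M"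
    proof (intro L2_add L2_cmult L2_sum)
      show "(\<lambda>\<omega>. \<bar>\<Phi> (\<lambda>_. 0)\<bar>) \<in> L2_space M" by (simp add: L2_space_def)
    qed (use abs in auto)
    show "AE \<omega> in M. \<bar>\<Phi> (\<lambda>i. X i \<omega>)\<bar> \<le> \<bar>\<bar>\<Phi> (\<lambda>_. 0)\<bar> + L * (\<Sum>i<m. \<bar>X i \<omega>\<bar>)\<bar>"
    proof (rule AE_I2)
      fix \<omega>
      have "\<bar>\<Phi> (\<lambda>i. X i \<omega>) - \<Phi> (\<lambda>_. 0)\<bar> \<le> L * (\<Sum>i<m. \<bar>X i \<omega>\<bar>)"
        using L[of "\<lambda>i. X i \<omega>" "\<lambda>_. 0"] by simp
      then show "\<bar>\<Phi> (\<lambda>i. X i \<omega>)\<bar> \<le> \<bar>\<bar>\<Phi> (\<lambda>_. 0)\<bar> + L * (\<Sum>i<m. \<bar>X i \<omega>\<bar>)\<bar>"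
        by linarith
    qed
  qed
qed

section \<open>Integration by parts for Brownian increments on a grid\<close>

lemma grid_in_unit_interval:
  fixes \<tau> :: "nat \<Rightarrow> real"
  assumes "0 \<le> \<tau> 0" "\<tau> n \<le> 1" "\<And>l. l < n \<Longrightarrow> \<tau> l \<le> \<tau> (Suc l)" "i \<le> n"
  shows "0 \<le> \<tau> i" "\<tau> i \<le> 1"
proof -
  show "0 \<le> \<tau> i" using assms(4)
  proof (induction i)
    case (Suc i)
    then show ?case using assms(3)[of i] by simp
  qed (rule assms(1))
  show "\<tau> i \<le> 1" using assms(4)
  proof (induction rule: inc_induct)
    case (step l)
    then show ?case using assms(3)[of l] by simp
  qed (rule assms(2))
qed

locale wiener_space = prob_space P for P :: "path measure" +
  assumes wiener: "wiener_measure P"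
begin

lemma space_P: "space P = C01"
proof -
  have "space P = space (restrict_space (\<Pi>\<^sub>M t\<in>{0..1::real}. (borel :: real measure)) C01)"
    by (rule sets_eq_imp_space_eq) (use wiener in \<open>simp add: wiener_measure_def\<close>)
  then show ?thesis by (auto simp: space_restrict_space space_PiM C01_def PiE_def)
qed

lemma coordinate_measurable:
  assumes "t \<in> {0..1}" shows "(\<lambda>\<omega>. \<omega> t) \<in> borel_measurable P"
proof -
  have sets: "sets P = sets (restrict_space (\<Pi>\<^sub>M t\<in>{0..1::real}. (borel :: real measure)) C01)"
    using wiener by (simp add: wiener_measure_def)
  show ?thesis unfolding measurable_cong_sets[OF sets refl]
    by (rule measurable_restrict_space1) (rule measurable_component_singleton[OF assms])
qed

lemma increment_L2:
  assumes "0 \<le> s" "s \<le> t" "t \<le> 1"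
  shows "(\<lambda>\<omega>. \<omega> t - \<omega> s) \<in> L2_space P"
proof (cases "s = t")
  case True then show ?thesis by (simp add: L2_zero)
next
  case False
  then have "distributed P lborel (\<lambda>\<omega>. \<omega> t - \<omega> s) (normal_density 0 (sqrt (t - s)))"
    using wiener assms by (auto simp: wiener_measure_def)
  from distributed_integrable[OF this, of "\<lambda>x. x\<^sup>2"]
  have "integrable P (\<lambda>\<omega>. (\<omega> t - \<omega> s)\<^sup>2) \<longleftrightarrow>
      integrable lborel (\<lambda>x. normal_density 0 (sqrt (t - s)) x * x\<^sup>2)" by simp
  also have "\<dots>" using integrable_normal_moment[of "sqrt (t - s)" 0 2] False assms by simp
  finally show ?thesis
    using coordinate_measurable[of s] coordinate_measurable[of t] assms by (auto intro!: L2_spaceI)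
qed

text \<open>The increments are independent centred Gaussians whose variances are the cell lengths.
  Fubini isolates the j-th one, Stein's identity is applied to it with the others frozen, and its
  variance appears as the factor in front.\<close>

lemma grid_integration_by_parts:
  assumes C1: "C1_lipschitz m \<Phi> d" and \<tau>: "0 \<le> \<tau> 0" "\<tau> n \<le> 1" "\<And>i. i < n \<Longrightarrow> \<tau> i < \<tau> (Suc i)"
    and j: "j < n"
  shows "(\<integral>\<omega>. \<Phi> (\<lambda>i. \<Sum>l<n. c i l * (\<omega> (\<tau> (Suc l)) - \<omega> (\<tau> l))) * (\<omega> (\<tau> (Suc j)) - \<omega> (\<tau> j)) \<partial>P) =
    (\<tau> (Suc j) - \<tau> j) *
      (\<integral>\<omega>. (\<Sum>i<m. d i (\<lambda>i. \<Sum>l<n. c i l * (\<omega> (\<tau> (Suc l)) - \<omega> (\<tau> l))) * c i j) \<partial>P)"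
proof -
  define Y where "Y l \<omega> = \<omega> (\<tau> (Suc l)) - \<omega> (\<tau> l)" for l and \<omega> :: path
  \<comment> \<open>The value 1 beyond the grid makes every \<open>N l\<close> a probability
    measure, as the product construction is indexed by all naturals.\<close>
  define \<sigma> where "\<sigma> l = (if l < n then sqrt (\<tau> (Suc l) - \<tau> l) else 1)" for l
  define N where "N l = density lborel (normal_density 0 (\<sigma> l))" for l
  define X where "X i y = (\<Sum>l<n. c i l * y l)" for i and y :: "nat \<Rightarrow> real"
  define g where "g y = \<Phi> (\<lambda>i. X i y)" for y
  define g' where "g' y = (\<Sum>i<m. d i (\<lambda>i. X i y) * c i j)" for y
  obtain L where "0 \<le> L" and L: "\<And>i x. i < m \<Longrightarrow> \<bar>d i x\<bar> \<le> L"
    using C1_lipschitz_bound[OF C1] by metis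
  have \<sigma>: "0 < \<sigma> l" for l using \<tau>(3) by (simp add: \<sigma>_def)
  note \<tau>_lo = grid_in_unit_interval(1)[OF \<tau>(1,2) less_imp_le[OF \<tau>(3)]]
    and \<tau>_hi = grid_in_unit_interval(2)[OF \<tau>(1,2) less_imp_le[OF \<tau>(3)]]
  have YL: "Y l \<in> L2_space P" if "l < n" for l
    unfolding Y_def using \<tau>(3)[OF that] \<tau>_lo[of l] \<tau>_hi[of "Suc l"] that by (intro increment_L2) auto
  then have Ym: "Y l \<in> borel_measurable P" if "l < n" for l using that by auto
  interpret product_sigma_finite N
    unfolding N_def product_sigma_finite_def
    using prob_space_normal_density[OF \<sigma>] by (auto intro: prob_space_imp_sigma_finite)
  have distrY: "distr P borel (Y l) = N l" if "l < n" for l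
  proof -
    have "distributed P lborel (Y l) (normal_density 0 (sqrt (\<tau> (Suc l) - \<tau> l)))"
      using wiener \<tau>(3)[OF that] \<tau>_lo[of l] \<tau>_hi[of "Suc l"] that
      by (auto simp: wiener_measure_def Y_def[abs_def])
    then have "distr P lborel (Y l) = N l"
      using that by (simp add: distributed_distr_eq_density N_def \<sigma>_def)
    moreover have "distr P borel (Y l) = distr P lborel (Y l)" by (rule distr_cong) auto
    ultimately show ?thesis by simp
  qed
  have ind: "indep_vars (\<lambda>_. borel) Y {..<n}"
    using wiener \<tau> by (auto simp: wiener_measure_def Y_def[abs_def] less_imp_le)
  \<comment> \<open>Independence in the form that the joint law is the product of the
    marginals.\<close>
  have D: "distr P (Pi\<^sub>M {..<n} (\<lambda>_. borel)) (\<lambda>\<omega>. \<lambda>l\<in>{..<n}. Y l \<omega>) = Pi\<^sub>M {..<n} N"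
  proof -
    have "distr P (Pi\<^sub>M {..<n} (\<lambda>_. borel)) (\<lambda>\<omega>. \<lambda>l\<in>{..<n}. Y l \<omega>) = Pi\<^sub>M {..<n} (\<lambda>l. distr P borel (Y l))"
      using ind j Ym by (subst (asm) indep_vars_iff_distr_eq_PiM') auto
    also have "\<dots> = Pi\<^sub>M {..<n} N" by (rule PiM_cong) (auto simp: distrY)
    finally show ?thesis .
  qed
  have Xm: "X i \<in> borel_measurable (Pi\<^sub>M {..<n} (\<lambda>_. borel))" for i
    unfolding X_def by measurable
  have Rm: "(\<lambda>\<omega>. \<lambda>l\<in>{..<n}. Y l \<omega>) \<in> measurable P (Pi\<^sub>M {..<n} (\<lambda>_. borel))"
    by (rule measurable_restrict) (use Ym in auto)
  have gm: "g \<in> borel_measurable (Pi\<^sub>M {..<n} (\<lambda>_. borel))"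
    unfolding g_def[abs_def] by (rule C1_lipschitz_measurable(1)[OF C1 Xm])
  have g'm: "g' \<in> borel_measurable (Pi\<^sub>M {..<n} (\<lambda>_. borel))"
    unfolding g'_def[abs_def]
    by (intro borel_measurable_sum borel_measurable_times borel_measurable_const
        C1_lipschitz_measurable(2)[OF C1 Xm]) auto
  have XR: "X i (\<lambda>l\<in>{..<n}. Y l \<omega>) = X i (\<lambda>l. Y l \<omega>)" for i \<omega> by (simp add: X_def)
  have XL: "(\<lambda>\<omega>. X i (\<lambda>l. Y l \<omega>)) \<in> L2_space P" for i
    unfolding X_def by (intro L2_sum L2_cmult YL) auto
  have gL: "(\<lambda>\<omega>. g (\<lambda>l. Y l \<omega>)) \<in> L2_space P"
    unfolding g_def by (rule C1_lipschitz_L2[OF C1 XL])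
  have g'_bound: "\<bar>g' y\<bar> \<le> (\<Sum>i<m. L * \<bar>c i j\<bar>)" for y
    unfolding g'_def using L by (auto intro!: order_trans[OF sum_abs] sum_mono mult_right_mono simp: abs_mult)
  have hm: "(\<lambda>y. g y * y j) \<in> borel_measurable (Pi\<^sub>M {..<n} (\<lambda>_. borel))"
    by (intro borel_measurable_times gm measurable_component_singleton) (use j in simp)
  have int1: "integrable (Pi\<^sub>M {..<n} N) (\<lambda>y. g y * y j)"
  proof -
    have "integrable P (\<lambda>\<omega>. g (\<lambda>l\<in>{..<n}. Y l \<omega>) * (\<lambda>l\<in>{..<n}. Y l \<omega>) j)"
      using L2_integrable_mult[OF gL YL[OF j]] j by (simp add: g_def XR)
    then show ?thesis unfolding D[symmetric] by (subst integrable_distr_eq[OF Rm hm])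
  qed
  have int2: "integrable (Pi\<^sub>M {..<n} N) g'"
  proof -
    have "integrable P (\<lambda>\<omega>. g' (\<lambda>l\<in>{..<n}. Y l \<omega>))"
      by (rule integrable_const_bound[where B="\<Sum>i<m. L * \<bar>c i j\<bar>"])
        (use g'_bound measurable_compose[OF Rm g'm] in auto)
    then show ?thesis unfolding D[symmetric] by (subst integrable_distr_eq[OF Rm g'm])
  qed
  define I where "I = {..<n} - {j}"
  have I: "finite I" "j \<notin> I" "insert j I = {..<n}" using j by (auto simp: I_def)
  \<comment> \<open>With the other increments fixed, all m arguments of \<open>\<Phi>\<close> are
    affine in s with slopes \<open>c i j\<close>, so the derivative along a line applies.\<close>
  have inner: "(\<integral>s. g (x(j := s)) * s \<partial>N j) = (\<sigma> j)\<^sup>2 * (\<integral>s. g' (x(j := s)) \<partial>N j)" for x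
  proof -
    define a where "a i = (\<Sum>l\<in>I. c i l * x l)" for i
    have Xs: "X i (x(j := s)) = a i + s * c i j" for i s
    proof -
      have "X i (x(j := s)) = (\<Sum>l\<in>insert j I. c i l * (x(j := s)) l)" by (simp add: X_def I(3))
      also have "\<dots> = c i j * s + (\<Sum>l\<in>I. c i l * (x(j := s)) l)" using I(1,2) by simp
      also have "(\<Sum>l\<in>I. c i l * (x(j := s)) l) = a i"
        unfolding a_def using I(2) by (intro sum.cong) auto
      also have "c i j * s + a i = a i + s * c i j" by simp
      finally show ?thesis .
    qed
    have der: "((\<lambda>s. g (x(j := s))) has_real_derivative g' (x(j := s))) (at s)" for s
      unfolding g_def g'_def Xs by (rule C1_lipschitz_DERIV_line[OF C1])
    have cont: "continuous_on UNIV (\<lambda>s. g' (x(j := s)))"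
      unfolding g'_def Xs continuous_on_def
      by (intro ballI tendsto_sum tendsto_mult tendsto_const C1_lipschitz_tendsto(2)[OF C1] tendsto_add
          tendsto_ident_at) auto
    have m: "(\<lambda>s. g (x(j := s)) * s) \<in> borel_measurable borel" "(\<lambda>s. g' (x(j := s))) \<in> borel_measurable borel"
      by (intro borel_measurable_continuous_onI continuous_on_mult continuous_on_id cont
          DERIV_continuous_on[OF der])+
    have "(\<integral>s. g (x(j := s)) * s \<partial>N j) = (\<integral>s. normal_density 0 (\<sigma> j) s * (g (x(j := s)) * s) \<partial>lborel)"
      unfolding N_def by (subst integral_real_density) (use m in auto)
    also have "\<dots> = (\<sigma> j)\<^sup>2 * (\<integral>s. normal_density 0 (\<sigma> j) s * g' (x(j := s)) \<partial>lborel)"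
      by (rule normal_density_stein[OF \<sigma> der cont g'_bound])
    also have "(\<integral>s. normal_density 0 (\<sigma> j) s * g' (x(j := s)) \<partial>lborel) = (\<integral>s. g' (x(j := s)) \<partial>N j)"
      unfolding N_def by (subst integral_real_density) (use m in auto)
    finally show ?thesis .
  qed
  have "(\<integral>\<omega>. g (\<lambda>l. Y l \<omega>) * Y j \<omega> \<partial>P) = (\<integral>\<omega>. g (\<lambda>l\<in>{..<n}. Y l \<omega>) * (\<lambda>l\<in>{..<n}. Y l \<omega>) j \<partial>P)"
    using j by (simp add: g_def XR)
  also have "\<dots> = (\<integral>y. g y * y j \<partial>Pi\<^sub>M (insert j I) N)"
    unfolding I(3) D[symmetric] by (rule integral_distr[OF Rm hm, symmetric])
  also have "\<dots> = (\<integral>x. (\<integral>s. g (x(j := s)) * (x(j := s)) j \<partial>N j) \<partial>Pi\<^sub>M I N)"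
    by (rule product_integral_insert[OF I(1,2)]) (use int1 I(3) in simp)
  also have "\<dots> = (\<integral>x. (\<sigma> j)\<^sup>2 * (\<integral>s. g' (x(j := s)) \<partial>N j) \<partial>Pi\<^sub>M I N)"
    by (simp add: inner)
  also have "\<dots> = (\<sigma> j)\<^sup>2 * (\<integral>x. (\<integral>s. g' (x(j := s)) \<partial>N j) \<partial>Pi\<^sub>M I N)"
    by simp
  also have "(\<integral>x. (\<integral>s. g' (x(j := s)) \<partial>N j) \<partial>Pi\<^sub>M I N) = (\<integral>y. g' y \<partial>Pi\<^sub>M (insert j I) N)"
    by (rule product_integral_insert[OF I(1,2), symmetric]) (use int2 I(3) in simp)
  also have "\<dots> = (\<integral>\<omega>. g' (\<lambda>l\<in>{..<n}. Y l \<omega>) \<partial>P)"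
    unfolding I(3) D[symmetric] by (rule integral_distr[OF Rm g'm])
  also have "\<dots> = (\<integral>\<omega>. g' (\<lambda>l. Y l \<omega>) \<partial>P)" by (simp add: g'_def XR)
  finally show ?thesis
    using j \<tau>(3)[OF j] by (simp add: g_def g'_def X_def Y_def \<sigma>_def)
qed

end

section \<open>Common refinement of step functions\<close>

lemma grid_telescope:
  fixes F :: "'a \<Rightarrow> real" and \<tau> :: "nat \<Rightarrow> 'a"
  assumes "a \<le> b" "b \<le> n"
  shows "F (\<tau> b) - F (\<tau> a) = (\<Sum>l<n. of_bool (a \<le> l \<and> l < b) * (F (\<tau> (Suc l)) - F (\<tau> l)))"
proof -
  have "(\<Sum>l<n. of_bool (a \<le> l \<and> l < b) * (F (\<tau> (Suc l)) - F (\<tau> l))) =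
      (\<Sum>l\<in>{a..<b}. F (\<tau> (Suc l)) - F (\<tau> l))"
    using assms by (intro sum.mono_neutral_cong_right) auto
  also have "\<dots> = F (\<tau> b) - F (\<tau> a)" using assms(1) by (rule sum_Suc_diff')
  finally show ?thesis by simp
qed

text \<open>All grid points are merged into one sorted list without repetition. Strictness of the
  new grid provides the positive variances needed for Stein's identity.\<close>

lemma step_integrals_common_grid:
  fixes m :: nat
  assumes S: "\<And>i. i < m \<Longrightarrow> (h i, X i) \<in> step_integrals"
  shows "\<exists>n \<tau> c. 0 \<le> \<tau> 0 \<and> \<tau> n \<le> 1 \<and> (\<forall>l<n. \<tau> l < \<tau> (Suc l)) \<and>
    (\<forall>i<m. h i = (\<lambda>s. \<Sum>l<n. c i l * indicator {\<tau> l<..\<tau> (Suc l)} s) \<and>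
           X i = (\<lambda>\<omega>. \<Sum>l<n. c i l * (\<omega> (\<tau> (Suc l)) - \<omega> (\<tau> l))))"
proof -
  have "\<forall>i. \<exists>n c \<tau>. i < m \<longrightarrow> 0 \<le> \<tau> 0 \<and> \<tau> n \<le> 1 \<and> (\<forall>l<n. \<tau> l \<le> \<tau> (Suc l)) \<and>
      h i = (\<lambda>s. \<Sum>l<n. c l * indicator {\<tau> l<..\<tau> (Suc l)} s) \<and>
      X i = (\<lambda>\<omega>. \<Sum>l<n. c l * (\<omega> (\<tau> (Suc l)) - \<omega> (\<tau> l)))"
    using S unfolding step_integrals_def by blast
  then obtain N C \<theta> where st: "\<And>i. i < m \<Longrightarrow> 0 \<le> \<theta> i 0 \<and> \<theta> i (N i) \<le> 1 \<and> (\<forall>l<N i. \<theta> i l \<le> \<theta> i (Suc l)) \<and>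
      h i = (\<lambda>s. \<Sum>l<N i. C i l * indicator {\<theta> i l<..\<theta> i (Suc l)} s) \<and>
      X i = (\<lambda>\<omega>. \<Sum>l<N i. C i l * (\<omega> (\<theta> i (Suc l)) - \<omega> (\<theta> i l)))"
    unfolding choice_iff by blast
  have lo: "0 \<le> \<theta> i l" and hi: "\<theta> i l \<le> 1" if "i < m" "l \<le> N i" for i l
    using grid_in_unit_interval[of "\<theta> i" "N i" l] st[OF that(1)] that(2) by auto
  \<comment> \<open>The point 0 keeps the set nonempty when m = 0.\<close>
  define T where "T = insert 0 (\<Union>i<m. \<theta> i ` {..N i})"
  have "finite T" unfolding T_def by simp
  moreover have "T \<subseteq> {0..1}" using lo hi by (auto simp: T_def)
  ultimately have T: "finite T" "T \<subseteq> {0..1}" by simp_all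
  define xs where "xs = sorted_list_of_set T"
  have xs: "set xs = T" "sorted_wrt (<) xs" using T(1) by (auto simp: xs_def)
  have "xs \<noteq> []" using xs(1) by (auto simp: T_def)
  define n \<tau> where "n = length xs - 1" and "\<tau> l = xs ! l" for l
  have len: "length xs = Suc n" using \<open>xs \<noteq> []\<close> by (simp add: n_def)
  have \<tau>T: "\<tau> l \<in> T" if "l \<le> n" for l
    unfolding xs(1)[symmetric] \<tau>_def by (rule nth_mem) (use that len in simp)
  have \<tau>_less: "\<tau> a < \<tau> b" if "a < b" "b \<le> n" for a b
    unfolding \<tau>_def by (rule sorted_wrt_nth_less[OF xs(2)]) (use that len in simp_all)
  have "\<exists>a\<le>n. \<tau> a = t" if "t \<in> T" for t
    using that[folded xs(1)] unfolding in_set_conv_nth \<tau>_def len less_Suc_eq_le by blast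
  then obtain idx where idx: "\<And>t. t \<in> T \<Longrightarrow> idx t \<le> n \<and> \<tau> (idx t) = t" by metis
  \<comment> \<open>Cell l collects the coefficients of all original steps covering it; a degenerate
    step covers no cell.\<close>
  define c where "c i l = (\<Sum>k<N i. C i k * of_bool (idx (\<theta> i k) \<le> l \<and> l < idx (\<theta> i (Suc k))))" for i l
  \<comment> \<open>A general \<open>F\<close> treats integrand and integral at once:
    \<open>F\<close> is the path in the one case and t \<mapsto> \<open>of_bool (s \<le> t)\<close>
    in the other, since the indicator of a half-open interval is an increment of the latter.\<close>
  have tele: "(\<Sum>k<N i. C i k * (F (\<theta> i (Suc k)) - F (\<theta> i k))) = (\<Sum>l<n. c i l * (F (\<tau> (Suc l)) - F (\<tau> l)))"
    if i: "i < m" for i and F :: "real \<Rightarrow> real"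
  proof -
    have "F (\<theta> i (Suc k)) - F (\<theta> i k) =
        (\<Sum>l<n. of_bool (idx (\<theta> i k) \<le> l \<and> l < idx (\<theta> i (Suc k))) * (F (\<tau> (Suc l)) - F (\<tau> l)))"
      if k: "k < N i" for k
    proof -
      have "\<theta> i l \<in> T" if "l \<le> N i" for l unfolding T_def using i that by blast
      then have in_T: "\<theta> i k \<in> T" "\<theta> i (Suc k) \<in> T" using k by simp_all
      note a = idx[OF in_T(1)] and b = idx[OF in_T(2)]
      have "idx (\<theta> i k) \<le> idx (\<theta> i (Suc k))"
      proof (rule ccontr)
        assume "\<not> ?thesis"
        then have "\<theta> i (Suc k) < \<theta> i k" using \<tau>_less[of "idx (\<theta> i (Suc k))" "idx (\<theta> i k)"] a b by simp
        with st[OF i] k show False by (auto simp: not_le[symmetric])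
      qed
      from grid_telescope[OF this, of n F \<tau>] a b show ?thesis by simp
    qed
    then have "(\<Sum>k<N i. C i k * (F (\<theta> i (Suc k)) - F (\<theta> i k))) =
      (\<Sum>k<N i. \<Sum>l<n. C i k * of_bool (idx (\<theta> i k) \<le> l \<and> l < idx (\<theta> i (Suc k))) * (F (\<tau> (Suc l)) - F (\<tau> l)))"
      by (intro sum.cong refl) (simp only: sum_distrib_left mult.assoc lessThan_iff)
    also have "\<dots> = (\<Sum>l<n. c i l * (F (\<tau> (Suc l)) - F (\<tau> l)))"
      unfolding c_def sum_distrib_right by (rule sum.swap)
    finally show ?thesis .
  qed
  have ind: "indicator {u<..v} s = (of_bool (s \<le> v) - of_bool (s \<le> u) :: real)" if "u \<le> v" for u v s :: real
    using that by (auto simp: indicator_def)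
  show ?thesis
  proof (intro exI conjI allI impI)
    show "0 \<le> \<tau> 0" "\<tau> n \<le> 1" using \<tau>T[of 0] \<tau>T[of n] T(2) by auto
    show "\<tau> l < \<tau> (Suc l)" if "l < n" for l using that by (intro \<tau>_less) auto
    fix i assume i: "i < m"
    show "X i = (\<lambda>\<omega>. \<Sum>l<n. c i l * (\<omega> (\<tau> (Suc l)) - \<omega> (\<tau> l)))"
    proof
      fix \<omega> show "X i \<omega> = (\<Sum>l<n. c i l * (\<omega> (\<tau> (Suc l)) - \<omega> (\<tau> l)))"
        using st[OF i] tele[OF i, of \<omega>] by simp
    qed
    show "h i = (\<lambda>s. \<Sum>l<n. c i l * indicator {\<tau> l<..\<tau> (Suc l)} s)"
    proof
      fix s
      have "h i s = (\<Sum>k<N i. C i k * indicator {\<theta> i k<..\<theta> i (Suc k)} s)" using st[OF i] by simp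
      also have "\<dots> = (\<Sum>k<N i. C i k * (of_bool (s \<le> \<theta> i (Suc k)) - of_bool (s \<le> \<theta> i k)))"
        using st[OF i] by (intro sum.cong refl) (subst ind, auto)
      also have "\<dots> = (\<Sum>l<n. c i l * (of_bool (s \<le> \<tau> (Suc l)) - of_bool (s \<le> \<tau> l)))"
        by (rule tele[OF i])
      also have "\<dots> = (\<Sum>l<n. c i l * indicator {\<tau> l<..\<tau> (Suc l)} s)"
        using \<tau>_less by (intro sum.cong refl) (subst ind, auto intro: less_imp_le)
      finally show "h i s = (\<Sum>l<n. c i l * indicator {\<tau> l<..\<tau> (Suc l)} s)" .
    qed
  qed
qed

section \<open>Wiener integrals\<close>

lemma prob_space_time01: "prob_space time01"
  by (rule prob_spaceI) (simp add: time01_def emeasure_restrict_space space_restrict_space)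

interpretation time01: prob_space time01
  by (rule prob_space_time01)

lemma measurable_time01: "f \<in> borel_measurable borel \<Longrightarrow> f \<in> borel_measurable time01"
  unfolding time01_def by (rule measurable_restrict_space1) simp

lemma integral_time01_Ioc:
  assumes "0 \<le> u" "u \<le> v" "v \<le> 1"
  shows "(\<integral>s. indicator {u<..v} s \<partial>time01) = v - u"
proof -
  have "(\<integral>s. indicator {u<..v} s \<partial>time01) = measure time01 ({u<..v} \<inter> space time01)" by simp
  also have "{u<..v} \<inter> space time01 = {u<..v}" using assms by (auto simp: time01_def space_restrict_space)
  also have "measure time01 {u<..v} = measure lborel {u<..v}"
    unfolding time01_def by (rule measure_restrict_space) (use assms in auto)
  finally show ?thesis using assms by simp
qed

text \<open>The closure speaks of norms only, and \<open>L2_norm\<close> is 0 whenever the square is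
  not integrable. Membership of the approximants in L2 must therefore come from \<open>G\<close>;
  \<open>L2_conv\<close> records it.\<close>

lemma L2_graph_closureE:
  assumes "(f, g) \<in> L2_graph_closure M N G" "\<And>u v. (u, v) \<in> G \<Longrightarrow> u \<in> L2_space M \<and> v \<in> L2_space N"
  obtains F H where "\<And>n. (F n, H n) \<in> G" "L2_conv M F f" "L2_conv N H g"
  using assms unfolding L2_graph_closure_def L2_conv_def by blast

lemma L2_graph_closureI:
  assumes "\<And>n. (F n, H n) \<in> G" "L2_conv M F f" "L2_conv N H g"
  shows "(f, g) \<in> L2_graph_closure M N G"
  using assms unfolding L2_graph_closure_def L2_conv_def by blast

text \<open>A diagonal argument: an element of \<open>G\<close> within e/2 of the n-th term, itself
  within e/2 of the limit, simultaneously for both components.\<close>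

lemma L2_graph_closure_closed:
  assumes G: "\<And>u v. (u, v) \<in> G \<Longrightarrow> u \<in> L2_space M \<and> v \<in> L2_space N"
    and FH: "\<And>n. (F n, H n) \<in> L2_graph_closure M N G" and F: "L2_conv M F f" and H: "L2_conv N H g"
  shows "(f, g) \<in> L2_graph_closure M N G"
proof -
  have "\<exists>K J. (\<forall>i. (K i, J i) \<in> G) \<and> L2_conv M K (F n) \<and> L2_conv N J (H n)" for n
    using L2_graph_closureE[OF FH[of n] G] by metis
  then obtain K J where KJ: "\<And>n i. (K n i, J n i) \<in> G" "\<And>n. L2_conv M (K n) (F n)" "\<And>n. L2_conv N (J n) (H n)"
    by metis
  have ex: "\<exists>p\<in>G. L2_norm M (\<lambda>x. fst p x - f x) < e \<and> L2_norm N (\<lambda>x. snd p x - g x) < e" if "0 < e" for e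
  proof -
    have "eventually (\<lambda>n. L2_norm M (\<lambda>x. F n x - f x) < e / 2) sequentially"
      "eventually (\<lambda>n. L2_norm N (\<lambda>x. H n x - g x) < e / 2) sequentially"
      using order_tendstoD(2)[OF L2_convD(3)[OF F], of "e / 2"]
        order_tendstoD(2)[OF L2_convD(3)[OF H], of "e / 2"] that by auto
    then have "eventually (\<lambda>n. L2_norm M (\<lambda>x. F n x - f x) < e / 2 \<and> L2_norm N (\<lambda>x. H n x - g x) < e / 2) sequentially"
      by (rule eventually_conj)
    then obtain n where n: "L2_norm M (\<lambda>x. F n x - f x) < e / 2" "L2_norm N (\<lambda>x. H n x - g x) < e / 2"
      by (auto simp: eventually_sequentially)
    have "eventually (\<lambda>i. L2_norm M (\<lambda>x. K n i x - F n x) < e / 2) sequentially"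
      "eventually (\<lambda>i. L2_norm N (\<lambda>x. J n i x - H n x) < e / 2) sequentially"
      using order_tendstoD(2)[OF L2_convD(3)[OF KJ(2)], of "e / 2"]
        order_tendstoD(2)[OF L2_convD(3)[OF KJ(3)], of "e / 2"] that by auto
    then have "eventually (\<lambda>i. L2_norm M (\<lambda>x. K n i x - F n x) < e / 2 \<and> L2_norm N (\<lambda>x. J n i x - H n x) < e / 2) sequentially"
      by (rule eventually_conj)
    then obtain i where i: "L2_norm M (\<lambda>x. K n i x - F n x) < e / 2" "L2_norm N (\<lambda>x. J n i x - H n x) < e / 2"
      by (auto simp: eventually_sequentially)
    have "L2_norm M (\<lambda>x. K n i x - f x) \<le> L2_norm M (\<lambda>x. K n i x - F n x) + L2_norm M (\<lambda>x. F n x - f x)"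
      "L2_norm N (\<lambda>x. J n i x - g x) \<le> L2_norm N (\<lambda>x. J n i x - H n x) + L2_norm N (\<lambda>x. H n x - g x)"
      using L2_norm_triangle_diff[OF L2_convD(1,2)[OF KJ(2)] L2_convD(2)[OF F]]
        L2_norm_triangle_diff[OF L2_convD(1,2)[OF KJ(3)] L2_convD(2)[OF H]] by blast+
    with n i show ?thesis using KJ(1)[of n i] by (intro bexI[of _ "(K n i, J n i)"]) auto
  qed
  have "\<exists>p\<in>G. L2_norm M (\<lambda>x. fst p x - f x) < 1 / Suc n \<and> L2_norm N (\<lambda>x. snd p x - g x) < 1 / Suc n" for n
    by (rule ex) simp
  then obtain p where p: "\<And>n. p n \<in> G" "\<And>n. L2_norm M (\<lambda>x. fst (p n) x - f x) < 1 / Suc n"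
    "\<And>n. L2_norm N (\<lambda>x. snd (p n) x - g x) < 1 / Suc n" by metis
  have pG: "(fst (p n), snd (p n)) \<in> G" for n using p(1) by simp
  show ?thesis
  proof (rule L2_graph_closureI[OF pG])
    show "L2_conv M (\<lambda>n. fst (p n)) f"
      by (rule L2_conv_bound[OF _ L2_convD(2)[OF F] LIMSEQ_Suc[OF lim_const_over_n[of 1]]])
        (use G[OF pG] p(2) in \<open>auto intro: less_imp_le simp del: of_nat_Suc\<close>)
    show "L2_conv N (\<lambda>n. snd (p n)) g"
      by (rule L2_conv_bound[OF _ L2_convD(2)[OF H] LIMSEQ_Suc[OF lim_const_over_n[of 1]]])
        (use G[OF pG] p(3) in \<open>auto intro: less_imp_le simp del: of_nat_Suc\<close>)
  qed
qed

lemma L2_conv_sum: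
  assumes "\<And>i. i \<in> I \<Longrightarrow> L2_conv M (F i) (f i)"
  shows "L2_conv M (\<lambda>n x. \<Sum>i\<in>I. F i n x) (\<lambda>x. \<Sum>i\<in>I. f i x)"
  using assms by (induction I rule: infinite_finite_induct)
    (auto intro: L2_conv_add L2_conv_const L2_zero)

lemma L2_conv_abs_diff:
  assumes "L2_conv M F f"
  shows "L2_conv M (\<lambda>n x. \<bar>F n x - f x\<bar>) (\<lambda>x. 0)"
proof (rule L2_conv_bound[OF _ L2_zero L2_convD(3)[OF assms]])
  note d = L2_diff[OF L2_convD(1,2)[OF assms]]
  show "(\<lambda>x. \<bar>F n x - f x\<bar>) \<in> L2_space M" for n
    by (rule L2_bound[OF _ d]) (use L2_measurable[OF d] in auto)
  show "L2_norm M (\<lambda>x. \<bar>F n x - f x\<bar> - 0) \<le> L2_norm M (\<lambda>x. F n x - f x)" for n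
    by (simp add: L2_norm_def)
qed

lemma (in prob_space) C1_lipschitz_L2_conv:
  assumes C1: "C1_lipschitz m \<Phi> d" and X: "\<And>i. i < m \<Longrightarrow> L2_conv M (\<lambda>n. X n i) (Y i)"
  shows "L2_conv M (\<lambda>n \<omega>. \<Phi> (\<lambda>i. X n i \<omega>)) (\<lambda>\<omega>. \<Phi> (\<lambda>i. Y i \<omega>))"
proof -
  obtain L where L: "0 \<le> L" "\<And>x y. \<bar>\<Phi> x - \<Phi> y\<bar> \<le> L * (\<Sum>i<m. \<bar>x i - y i\<bar>)"
    using C1_lipschitz_bound[OF C1] by metis
  have "L2_conv M (\<lambda>n \<omega>. L * (\<Sum>i<m. \<bar>X n i \<omega> - Y i \<omega>\<bar>)) (\<lambda>\<omega>. L * (\<Sum>i<m. 0))"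
    by (intro L2_conv_cmult L2_conv_sum L2_conv_abs_diff X) auto
  then have S: "L2_conv M (\<lambda>n \<omega>. L * (\<Sum>i<m. \<bar>X n i \<omega> - Y i \<omega>\<bar>)) (\<lambda>\<omega>. 0)" by simp
  have a: "(\<lambda>\<omega>. \<Phi> (\<lambda>i. X n i \<omega>)) \<in> L2_space M" for n
    by (rule C1_lipschitz_L2[OF C1]) (use L2_convD(1)[OF X] in blast)
  have b: "(\<lambda>\<omega>. \<Phi> (\<lambda>i. Y i \<omega>)) \<in> L2_space M"
    by (rule C1_lipschitz_L2[OF C1]) (use L2_convD(2)[OF X] in blast)
  show ?thesis
  proof (rule L2_conv_bound[OF a b L2_convD(3)[OF S]])
    fix n
    have "L2_norm M (\<lambda>\<omega>. \<Phi> (\<lambda>i. X n i \<omega>) - \<Phi> (\<lambda>i. Y i \<omega>)) \<le> L2_norm M (\<lambda>\<omega>. L * (\<Sum>i<m. \<bar>X n i \<omega> - Y i \<omega>\<bar>))"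
    proof (rule L2_norm_mono)
      show "(\<lambda>\<omega>. \<Phi> (\<lambda>i. X n i \<omega>) - \<Phi> (\<lambda>i. Y i \<omega>)) \<in> borel_measurable M"
        using L2_diff[OF a b] by (rule L2_measurable)
      show "(\<lambda>\<omega>. L * (\<Sum>i<m. \<bar>X n i \<omega> - Y i \<omega>\<bar>)) \<in> L2_space M" by (rule L2_convD(1)[OF S])
      show "AE \<omega> in M. \<bar>\<Phi> (\<lambda>i. X n i \<omega>) - \<Phi> (\<lambda>i. Y i \<omega>)\<bar> \<le> \<bar>L * (\<Sum>i<m. \<bar>X n i \<omega> - Y i \<omega>\<bar>)\<bar>"
        using L(2) by (intro AE_I2 order_trans[OF _ abs_ge_self]) auto
    qed
    then show "L2_norm M (\<lambda>\<omega>. \<Phi> (\<lambda>i. X n i \<omega>) - \<Phi> (\<lambda>i. Y i \<omega>))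
      \<le> L2_norm M (\<lambda>\<omega>. L * (\<Sum>i<m. \<bar>X n i \<omega> - Y i \<omega>\<bar>) - 0)" by simp
  qed
qed

context wiener_space
begin

lemma step_integrals_L2:
  assumes "(h, X) \<in> step_integrals"
  shows "h \<in> L2_space time01" "X \<in> L2_space P"
proof -
  obtain n \<tau> c where \<tau>: "0 \<le> \<tau> 0" "\<tau> n \<le> 1" "\<forall>l<n. \<tau> l < \<tau> (Suc l)"
    and hX: "h = (\<lambda>s. \<Sum>l<n. c l * indicator {\<tau> l<..\<tau> (Suc l)} s)"
      "X = (\<lambda>\<omega>. \<Sum>l<n. c l * (\<omega> (\<tau> (Suc l)) - \<omega> (\<tau> l)))"
    using step_integrals_common_grid[of 1 "\<lambda>_. h" "\<lambda>_. X"] assms by auto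
  note lo = grid_in_unit_interval(1)[OF \<tau>(1,2) less_imp_le[OF \<tau>(3)[rule_format]]]
    and hi = grid_in_unit_interval(2)[OF \<tau>(1,2) less_imp_le[OF \<tau>(3)[rule_format]]]
  have "indicator {\<tau> l<..\<tau> (Suc l)} \<in> L2_space time01" for l
    by (rule time01.L2_bounded[where C=1]) (auto intro!: measurable_time01 simp: indicator_def)
  then show "h \<in> L2_space time01" unfolding hX(1) by (intro L2_sum L2_cmult)
  show "X \<in> L2_space P" unfolding hX(2)
  proof (intro L2_sum L2_cmult increment_L2)
    fix l assume "l \<in> {..<n}"
    then show "0 \<le> \<tau> l" "\<tau> l \<le> \<tau> (Suc l)" "\<tau> (Suc l) \<le> 1"
      using lo[of l] hi[of "Suc l"] \<tau>(3) by (auto intro: less_imp_le)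
  qed
qed

text \<open>On a common grid \<open>V\<close> is a combination of increments and the grid formula
  applies to each. Since the cells are disjoint, the resulting sums of coefficients times cell
  lengths are the inner products of \<open>h i\<close> and \<open>v\<close>.\<close>

lemma step_integration_by_parts:
  assumes C1: "C1_lipschitz m \<Phi> d" and S: "\<And>i. i < m \<Longrightarrow> (h i, X i) \<in> step_integrals"
    and V: "(v, V) \<in> step_integrals"
  shows "(\<integral>\<omega>. \<Phi> (\<lambda>i. X i \<omega>) * V \<omega> \<partial>P) =
    (\<Sum>i<m. (\<integral>\<omega>. d i (\<lambda>i. X i \<omega>) \<partial>P) * (\<integral>s. h i s * v s \<partial>time01))"
proof -
  \<comment> \<open>Index m carries the direction \<open>v\<close>, so that it shares the grid of
    the integrands.\<close>
  define h' where "h' i = (if i < m then h i else v)" for i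
  define X' where "X' i = (if i < m then X i else V)" for i
  have "(h' i, X' i) \<in> step_integrals" if "i < Suc m" for i using S V by (simp add: h'_def X'_def)
  then have "\<exists>n \<tau> c. 0 \<le> \<tau> 0 \<and> \<tau> n \<le> 1 \<and> (\<forall>l<n. \<tau> l < \<tau> (Suc l)) \<and>
      (\<forall>i<Suc m. h' i = (\<lambda>s. \<Sum>l<n. c i l * indicator {\<tau> l<..\<tau> (Suc l)} s) \<and>
           X' i = (\<lambda>\<omega>. \<Sum>l<n. c i l * (\<omega> (\<tau> (Suc l)) - \<omega> (\<tau> l))))"
    by (rule step_integrals_common_grid)
  then obtain n \<tau> c
    where grid: "0 \<le> \<tau> 0 \<and> \<tau> n \<le> 1 \<and> (\<forall>l<n. \<tau> l < \<tau> (Suc l)) \<and>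
      (\<forall>i<Suc m. h' i = (\<lambda>s. \<Sum>l<n. c i l * indicator {\<tau> l<..\<tau> (Suc l)} s) \<and>
           X' i = (\<lambda>\<omega>. \<Sum>l<n. c i l * (\<omega> (\<tau> (Suc l)) - \<omega> (\<tau> l))))"
    by (elim exE)
  then have \<tau>: "0 \<le> \<tau> 0" "\<tau> n \<le> 1" "\<And>l. l < n \<Longrightarrow> \<tau> l < \<tau> (Suc l)"
    and rep: "\<And>i. i < Suc m \<Longrightarrow> h' i = (\<lambda>s. \<Sum>l<n. c i l * indicator {\<tau> l<..\<tau> (Suc l)} s)"
      "\<And>i. i < Suc m \<Longrightarrow> X' i = (\<lambda>\<omega>. \<Sum>l<n. c i l * (\<omega> (\<tau> (Suc l)) - \<omega> (\<tau> l)))"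
    by simp_all
  note lo = grid_in_unit_interval(1)[OF \<tau>(1,2) less_imp_le[OF \<tau>(3)]]
    and hi = grid_in_unit_interval(2)[OF \<tau>(1,2) less_imp_le[OF \<tau>(3)]]
  have less: "\<tau> a < \<tau> b" if "a < b" "b \<le> n" for a b
    using that by (induction b) (auto simp: less_Suc_eq Suc_le_eq intro: \<tau>(3) less_trans)
  define Y where "Y l \<omega> = \<omega> (\<tau> (Suc l)) - \<omega> (\<tau> l)" for l and \<omega> :: path
  define Z where "Z i \<omega> = (\<Sum>l<n. c i l * Y l \<omega>)" for i \<omega>
  have YL: "Y l \<in> L2_space P" if "l < n" for l
    unfolding Y_def using \<tau>(3)[OF that] lo[of l] hi[of "Suc l"] that by (intro increment_L2) auto
  have ZL: "Z i \<in> L2_space P" for i unfolding Z_def by (intro L2_sum L2_cmult YL) auto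
  have X: "X i = Z i" if "i < m" for i using rep(2)[of i] that by (simp add: X'_def Z_def[abs_def] Y_def)
  have Vr: "V = (\<lambda>\<omega>. \<Sum>l<n. c m l * Y l \<omega>)" using rep(2)[of m] by (simp add: X'_def Y_def)
  have cong: "\<Phi> (\<lambda>i. X i \<omega>) = \<Phi> (\<lambda>i. Z i \<omega>)" "i < m \<Longrightarrow> d i (\<lambda>i. X i \<omega>) = d i (\<lambda>i. Z i \<omega>)" for i \<omega>
    using C1_lipschitz_cong[OF C1, of "\<lambda>i. X i \<omega>" "\<lambda>i. Z i \<omega>"] X by auto
  obtain L where L: "\<And>i x. i < m \<Longrightarrow> \<bar>d i x\<bar> \<le> L" using C1_lipschitz_bound[OF C1] by metis
  have dint: "integrable P (\<lambda>\<omega>. d i (\<lambda>i. Z i \<omega>))" if "i < m" for i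
    by (rule integrable_const_bound[where B=L])
      (use L[OF that] C1_lipschitz_measurable(2)[OF C1 L2_measurable[OF ZL] that] in auto)
  have inner: "(\<integral>s. h i s * v s \<partial>time01) = (\<Sum>l<n. c i l * c m l * (\<tau> (Suc l) - \<tau> l))" if "i < m" for i
  proof -
    have "h i s * v s = (\<Sum>l<n. c i l * c m l * indicator {\<tau> l<..\<tau> (Suc l)} s)" for s
    proof -
      have "h i s * v s = (\<Sum>l<n. \<Sum>k<n. c i l * indicator {\<tau> l<..\<tau> (Suc l)} s * (c m k * indicator {\<tau> k<..\<tau> (Suc k)} s))"
      proof -
        have "h i = (\<lambda>s. \<Sum>l<n. c i l * indicator {\<tau> l<..\<tau> (Suc l)} s)"
          "v = (\<lambda>s. \<Sum>l<n. c m l * indicator {\<tau> l<..\<tau> (Suc l)} s)"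
          using rep(1)[of i] rep(1)[of m] that by (simp_all add: h'_def)
        then show ?thesis by (simp only: sum_product)
      qed
      \<comment> \<open>Distinct cells are disjoint, so only the diagonal survives.\<close>
      also have "\<dots> = (\<Sum>l<n. \<Sum>k<n. if k = l then c i l * c m l * indicator {\<tau> l<..\<tau> (Suc l)} s else 0)"
      proof (intro sum.cong refl)
        fix l k assume lk: "l \<in> {..<n}" "k \<in> {..<n}"
        have "\<tau> (Suc l) \<le> \<tau> k" if "l < k" using less[of "Suc l" k] that lk by (cases "Suc l = k") auto
        moreover have "\<tau> (Suc k) \<le> \<tau> l" if "k < l" using less[of "Suc k" l] that lk by (cases "Suc k = l") auto
        ultimately show "c i l * indicator {\<tau> l<..\<tau> (Suc l)} s * (c m k * indicator {\<tau> k<..\<tau> (Suc k)} s) =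
          (if k = l then c i l * c m l * indicator {\<tau> l<..\<tau> (Suc l)} s else 0)"
          by (cases k l rule: linorder_cases) (auto simp: indicator_def)
      qed
      finally show ?thesis by simp
    qed
    note prod = this
    have ind: "integrable time01 (\<lambda>s. c i l * c m l * indicator {\<tau> l<..\<tau> (Suc l)} s)" for l
      by (intro integrable_mult_right time01.integrable_const_bound[where B=1])
        (auto intro!: measurable_time01 simp: indicator_def)
    have "(\<integral>s. h i s * v s \<partial>time01) = (\<Sum>l<n. \<integral>s. c i l * c m l * indicator {\<tau> l<..\<tau> (Suc l)} s \<partial>time01)"
      unfolding prod by (rule Bochner_Integration.integral_sum[OF ind])
    also have "\<dots> = (\<Sum>l<n. c i l * c m l * (\<integral>s. indicator {\<tau> l<..\<tau> (Suc l)} s \<partial>time01))"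
      by (intro sum.cong refl) (rule integral_mult_right_zero)
    also have "\<dots> = (\<Sum>l<n. c i l * c m l * (\<tau> (Suc l) - \<tau> l))"
      using lo hi \<tau>(3) by (intro sum.cong refl) (subst integral_time01_Ioc, auto intro: less_imp_le)
    finally show ?thesis .
  qed
  have "(\<integral>\<omega>. \<Phi> (\<lambda>i. X i \<omega>) * V \<omega> \<partial>P) = (\<integral>\<omega>. (\<Sum>l<n. c m l * (\<Phi> (\<lambda>i. Z i \<omega>) * Y l \<omega>)) \<partial>P)"
    unfolding cong Vr by (simp add: sum_distrib_left ac_simps)
  also have "\<dots> = (\<Sum>l<n. c m l * (\<integral>\<omega>. \<Phi> (\<lambda>i. Z i \<omega>) * Y l \<omega> \<partial>P))"
    using L2_integrable_mult[OF C1_lipschitz_L2[OF C1 ZL] YL] by (subst Bochner_Integration.integral_sum) auto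
  also have "\<dots> = (\<Sum>l<n. c m l * ((\<tau> (Suc l) - \<tau> l) * (\<integral>\<omega>. (\<Sum>i<m. d i (\<lambda>i. Z i \<omega>) * c i l) \<partial>P)))"
    unfolding Z_def Y_def by (intro sum.cong refl arg_cong2[where f="(*)"] grid_integration_by_parts[OF C1 \<tau>]) auto
  also have "\<dots> = (\<Sum>l<n. c m l * ((\<tau> (Suc l) - \<tau> l) * (\<Sum>i<m. (\<integral>\<omega>. d i (\<lambda>i. Z i \<omega>) \<partial>P) * c i l)))"
    using dint by (subst Bochner_Integration.integral_sum) auto
  also have "\<dots> = (\<Sum>l<n. \<Sum>i<m. (\<integral>\<omega>. d i (\<lambda>i. Z i \<omega>) \<partial>P) * (c i l * c m l * (\<tau> (Suc l) - \<tau> l)))"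
    by (simp add: sum_distrib_left ac_simps)
  also have "\<dots> = (\<Sum>i<m. \<Sum>l<n. (\<integral>\<omega>. d i (\<lambda>i. Z i \<omega>) \<partial>P) * (c i l * c m l * (\<tau> (Suc l) - \<tau> l)))"
    by (rule sum.swap)
  also have "\<dots> = (\<Sum>i<m. (\<integral>\<omega>. d i (\<lambda>i. X i \<omega>) \<partial>P) * (\<integral>s. h i s * v s \<partial>time01))"
    by (simp add: inner cong(2) sum_distrib_left)
  finally show ?thesis .
qed

lemma has_wiener_integralE:
  assumes "has_wiener_integral P h X"
  obtains F H where "\<And>n. (F n, H n) \<in> step_integrals" "L2_conv time01 F h" "L2_conv P H X"
  using assms unfolding has_wiener_integral_def
  by (rule L2_graph_closureE) (use step_integrals_L2 in blast)+

lemma has_wiener_integral_L2: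
  assumes "has_wiener_integral P h X"
  shows "h \<in> L2_space time01" "X \<in> L2_space P"
  using assms by (auto simp: has_wiener_integral_def L2_graph_closure_def)

text \<open>Approximation by step integrands. The factors \<open>\<Phi>\<close> and \<open>V\<close>
  converge in L2, but the partial derivatives are only continuous and bounded, so their expectations
  are handled by dominated convergence along an almost surely convergent subsequence.\<close>

lemma wiener_integration_by_parts:
  assumes C1: "C1_lipschitz m \<Phi> d" and S: "\<And>i. i < m \<Longrightarrow> has_wiener_integral P (h i) (X i)"
    and V: "has_wiener_integral P v V"
  shows "(\<integral>\<omega>. \<Phi> (\<lambda>i. X i \<omega>) * V \<omega> \<partial>P) =
    (\<Sum>i<m. (\<integral>\<omega>. d i (\<lambda>i. X i \<omega>) \<partial>P) * (\<integral>s. h i s * v s \<partial>time01))"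
proof -
  have "\<forall>i. \<exists>F H. i < m \<longrightarrow> (\<forall>n. (F n, H n) \<in> step_integrals) \<and> L2_conv time01 F (h i) \<and> L2_conv P H (X i)"
    using S by (metis has_wiener_integralE)
  then obtain F H where FH: "\<And>i n. i < m \<Longrightarrow> (F i n, H i n) \<in> step_integrals"
    "\<And>i. i < m \<Longrightarrow> L2_conv time01 (F i) (h i)" "\<And>i. i < m \<Longrightarrow> L2_conv P (H i) (X i)"
    by metis
  obtain w W where wW: "\<And>n. (w n, W n) \<in> step_integrals" "L2_conv time01 w v" "L2_conv P W V"
    using has_wiener_integralE[OF V] by metis
  \<comment> \<open>Applying the subsequence principle to the sum of the errors yields one
    subsequence for all i.\<close>
  have "L2_conv P (\<lambda>n \<omega>. \<Sum>i<m. \<bar>H i n \<omega> - X i \<omega>\<bar>) (\<lambda>\<omega>. \<Sum>i<m. 0)"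
    by (intro L2_conv_sum L2_conv_abs_diff FH) auto
  from L2_conv_AE_subseq[OF this] obtain r where r: "strict_mono r"
    "AE \<omega> in P. (\<lambda>n. \<Sum>i<m. \<bar>H i (r n) \<omega> - X i \<omega>\<bar>) \<longlonglongrightarrow> 0" by auto
  have AE: "AE \<omega> in P. \<forall>i<m. (\<lambda>n. H i (r n) \<omega>) \<longlonglongrightarrow> X i \<omega>"
    using r(2)
  proof eventually_elim
    case (elim \<omega>)
    show ?case
    proof (intro allI impI)
      fix i assume i: "i < m"
      have "(\<lambda>n. H i (r n) \<omega> - X i \<omega>) \<longlonglongrightarrow> 0"
      proof (rule Lim_null_comparison[OF always_eventually elim], rule allI)
        fix n show "norm (H i (r n) \<omega> - X i \<omega>) \<le> (\<Sum>i<m. \<bar>H i (r n) \<omega> - X i \<omega>\<bar>)"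
          using member_le_sum[of i "{..<m}" "\<lambda>i. \<bar>H i (r n) \<omega> - X i \<omega>\<bar>"] i by simp
      qed
      then show "(\<lambda>n. H i (r n) \<omega>) \<longlonglongrightarrow> X i \<omega>" by (simp add: LIM_zero_iff)
    qed
  qed
  obtain L where L: "\<And>i x. i < m \<Longrightarrow> \<bar>d i x\<bar> \<le> L" using C1_lipschitz_bound[OF C1] by metis
  have Hm: "H i n \<in> borel_measurable P" if "i < m" for i n
    using L2_convD(1)[OF FH(3)[OF that]] by (rule L2_measurable)
  have Xm: "X i \<in> borel_measurable P" if "i < m" for i
    using L2_convD(2)[OF FH(3)[OF that]] by (rule L2_measurable)
  have dlim: "(\<lambda>n. \<integral>\<omega>. d i (\<lambda>i. H i (r n) \<omega>) \<partial>P) \<longlonglongrightarrow> (\<integral>\<omega>. d i (\<lambda>i. X i \<omega>) \<partial>P)" if "i < m" for i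
  proof (rule integral_dominated_convergence[where w="\<lambda>_. L"])
    show "(\<lambda>\<omega>. d i (\<lambda>i. X i \<omega>)) \<in> borel_measurable P"
      by (rule C1_lipschitz_measurable(2)[OF C1 Xm that])
    show "(\<lambda>\<omega>. d i (\<lambda>i. H i (r n) \<omega>)) \<in> borel_measurable P" for n
      by (rule C1_lipschitz_measurable(2)[OF C1 Hm that])
    show "AE \<omega> in P. (\<lambda>n. d i (\<lambda>i. H i (r n) \<omega>)) \<longlonglongrightarrow> d i (\<lambda>i. X i \<omega>)"
      using AE by eventually_elim (rule C1_lipschitz_tendsto(2)[OF C1 _ that], blast)
    show "AE \<omega> in P. norm (d i (\<lambda>i. H i (r n) \<omega>)) \<le> L" for n using L[OF that] by simp
  qed simp
  have "(\<lambda>n. \<integral>\<omega>. \<Phi> (\<lambda>i. H i (r n) \<omega>) * W (r n) \<omega> \<partial>P) \<longlonglongrightarrow> (\<integral>\<omega>. \<Phi> (\<lambda>i. X i \<omega>) * V \<omega> \<partial>P)"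
    by (intro L2_conv_integral_mult C1_lipschitz_L2_conv[OF C1] L2_conv_subseq[OF _ r(1)] FH(3) wW(3))
  moreover have "(\<lambda>n. \<Sum>i<m. (\<integral>\<omega>. d i (\<lambda>i. H i (r n) \<omega>) \<partial>P) * (\<integral>s. F i (r n) s * w (r n) s \<partial>time01))
      \<longlonglongrightarrow> (\<Sum>i<m. (\<integral>\<omega>. d i (\<lambda>i. X i \<omega>) \<partial>P) * (\<integral>s. h i s * v s \<partial>time01))"
    by (intro tendsto_sum tendsto_mult dlim L2_conv_integral_mult L2_conv_subseq[OF _ r(1)] FH(2) wW(2)) auto
  moreover have "(\<integral>\<omega>. \<Phi> (\<lambda>i. H i (r n) \<omega>) * W (r n) \<omega> \<partial>P) =
      (\<Sum>i<m. (\<integral>\<omega>. d i (\<lambda>i. H i (r n) \<omega>) \<partial>P) * (\<integral>s. F i (r n) s * w (r n) s \<partial>time01))" for n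
    by (rule step_integration_by_parts[OF C1 FH(1) wW(1)])
  ultimately show ?thesis by (simp add: LIMSEQ_unique)
qed

end

section \<open>Operations on cylinder functions\<close>

text \<open>Converse to \<open>C1_lipschitz_bound\<close>: each coordinate difference is at most the
  Euclidean norm, which costs a factor m.\<close>

lemma C1_lipschitzI:
  assumes "0 \<le> L" "\<And>x y. \<bar>\<Phi> x - \<Phi> y\<bar> \<le> L * (\<Sum>i<m. \<bar>x i - y i\<bar>)"
    "\<And>i. i < m \<Longrightarrow> continuous_on UNIV (d i)"
    "\<And>i x. i < m \<Longrightarrow> ((\<lambda>s. \<Phi> (x(i := s))) has_real_derivative d i x) (at (x i))"
  shows "C1_lipschitz m \<Phi> d"
proof -
  have "\<bar>\<Phi> x - \<Phi> y\<bar> \<le> (L * m) * L2_set (\<lambda>i. x i - y i) {..<m}" for x y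
  proof -
    have "\<bar>x i - y i\<bar> \<le> L2_set (\<lambda>i. x i - y i) {..<m}" if "i < m" for i
      using member_le_L2_set[of "{..<m}" i "\<lambda>i. \<bar>x i - y i\<bar>"] that by (simp add: L2_set_def)
    then have "(\<Sum>i<m. \<bar>x i - y i\<bar>) \<le> (\<Sum>i<m. L2_set (\<lambda>i. x i - y i) {..<m})"
      by (intro sum_mono) auto
    then have "L * (\<Sum>i<m. \<bar>x i - y i\<bar>) \<le> L * (m * L2_set (\<lambda>i. x i - y i) {..<m})"
      using assms(1) by (intro mult_left_mono) auto
    with assms(2)[of x y] show ?thesis by (simp add: mult.assoc)
  qed
  then have "\<exists>L. \<forall>x y. \<bar>\<Phi> x - \<Phi> y\<bar> \<le> L * L2_set (\<lambda>i. x i - y i) {..<m}" by blast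
  with assms(3,4) show ?thesis by (simp add: C1_lipschitz_def)
qed

lemma C1_lipschitzD:
  assumes "C1_lipschitz m \<Phi> d" "i < m"
  shows "continuous_on UNIV (d i)" "((\<lambda>s. \<Phi> (x(i := s))) has_real_derivative d i x) (at (x i))"
  using assms by (auto simp: C1_lipschitz_def)

lemma C1_lipschitz_compose:
  assumes C1: "C1_lipschitz m \<Phi> d" and \<psi>: "\<And>x. (\<psi> has_real_derivative \<psi>' x) (at x)"
    and c: "continuous_on UNIV \<psi>'" and L: "\<And>x. \<bar>\<psi>' x\<bar> \<le> L"
  shows "C1_lipschitz m (\<lambda>x. \<psi> (\<Phi> x)) (\<lambda>i x. \<psi>' (\<Phi> x) * d i x)"
proof -
  obtain K where K: "0 \<le> K" "\<And>x y. \<bar>\<Phi> x - \<Phi> y\<bar> \<le> K * (\<Sum>i<m. \<bar>x i - y i\<bar>)"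
    using C1_lipschitz_bound[OF C1] by metis
  have L0: "0 \<le> L" using L[of 0] by linarith
  have lip: "\<bar>\<psi> x - \<psi> y\<bar> \<le> L * \<bar>x - y\<bar>" for x y
    using field_differentiable_bound[of UNIV \<psi> \<psi>' L x y] \<psi> L by auto
  note cont = C1_lipschitz_continuous[OF C1]
  show ?thesis
  proof (rule C1_lipschitzI)
    show "0 \<le> L * K" using L0 K(1) by simp
    show "\<bar>\<psi> (\<Phi> x) - \<psi> (\<Phi> y)\<bar> \<le> L * K * (\<Sum>i<m. \<bar>x i - y i\<bar>)" for x y
      using order_trans[OF lip mult_left_mono[OF K(2) L0]] by (simp add: mult.assoc)
    fix i assume i: "i < m"
    show "continuous_on UNIV (\<lambda>x. \<psi>' (\<Phi> x) * d i x)"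
      by (intro continuous_on_mult C1_lipschitzD(1)[OF C1 i] continuous_on_compose2[OF c cont]) auto
    show "((\<lambda>s. \<psi> (\<Phi> (x(i := s)))) has_real_derivative \<psi>' (\<Phi> x) * d i x) (at (x i))" for x
      using DERIV_chain2[of \<psi> _ "\<lambda>s. \<Phi> (x(i := s))" "x i", OF _ C1_lipschitzD(2)[OF C1 i]] \<psi>[of "\<Phi> x"]
      by simp
  qed
qed

lemma C1_lipschitz_coordinate: "C1_lipschitz 1 (\<lambda>x. x 0) (\<lambda>_ _. 1)"
  by (rule C1_lipschitzI[of 1]) auto

lemma C1_lipschitz_add:
  assumes C1: "C1_lipschitz m \<Phi> d" and C2: "C1_lipschitz m \<Psi> e"
  shows "C1_lipschitz m (\<lambda>x. \<Phi> x + \<Psi> x) (\<lambda>i x. d i x + e i x)"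
proof -
  obtain K where K: "0 \<le> K" "\<And>x y. \<bar>\<Phi> x - \<Phi> y\<bar> \<le> K * (\<Sum>i<m. \<bar>x i - y i\<bar>)"
    using C1_lipschitz_bound[OF C1] by metis
  obtain J where J: "0 \<le> J" "\<And>x y. \<bar>\<Psi> x - \<Psi> y\<bar> \<le> J * (\<Sum>i<m. \<bar>x i - y i\<bar>)"
    using C1_lipschitz_bound[OF C2] by metis
  show ?thesis
  proof (rule C1_lipschitzI)
    show "0 \<le> K + J" using K(1) J(1) by simp
    show "\<bar>\<Phi> x + \<Psi> x - (\<Phi> y + \<Psi> y)\<bar> \<le> (K + J) * (\<Sum>i<m. \<bar>x i - y i\<bar>)" for x y
      using K(2)[of x y] J(2)[of x y] unfolding distrib_right by linarith
  qed (auto intro!: continuous_on_add DERIV_add C1_lipschitzD[OF C1] C1_lipschitzD[OF C2])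
qed

text \<open>The bounds enter because the increment of a product is \<open>\<Phi>\<close> times the
  increment of \<open>\<Psi>\<close> plus \<open>\<Psi>\<close> times that of
  \<open>\<Phi>\<close>.\<close>

lemma C1_lipschitz_mult:
  assumes C1: "C1_lipschitz m \<Phi> d" and C2: "C1_lipschitz m \<Psi> e"
    and A: "\<And>x. \<bar>\<Phi> x\<bar> \<le> A" and B: "\<And>x. \<bar>\<Psi> x\<bar> \<le> B"
  shows "C1_lipschitz m (\<lambda>x. \<Phi> x * \<Psi> x) (\<lambda>i x. d i x * \<Psi> x + e i x * \<Phi> x)"
proof -
  obtain K where K: "0 \<le> K" "\<And>x y. \<bar>\<Phi> x - \<Phi> y\<bar> \<le> K * (\<Sum>i<m. \<bar>x i - y i\<bar>)"
    using C1_lipschitz_bound[OF C1] by metis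
  obtain J where J: "0 \<le> J" "\<And>x y. \<bar>\<Psi> x - \<Psi> y\<bar> \<le> J * (\<Sum>i<m. \<bar>x i - y i\<bar>)"
    using C1_lipschitz_bound[OF C2] by metis
  have A0: "0 \<le> A" and B0: "0 \<le> B"
    using A[of undefined] B[of undefined] by linarith+
  show ?thesis
  proof (rule C1_lipschitzI)
    show "0 \<le> A * J + B * K" using A0 B0 K(1) J(1) by simp
    show "\<bar>\<Phi> x * \<Psi> x - \<Phi> y * \<Psi> y\<bar> \<le> (A * J + B * K) * (\<Sum>i<m. \<bar>x i - y i\<bar>)" for x y
    proof -
      have "\<Phi> x * \<Psi> x - \<Phi> y * \<Psi> y = \<Phi> x * (\<Psi> x - \<Psi> y) + \<Psi> y * (\<Phi> x - \<Phi> y)"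
        by (simp add: algebra_simps)
      then have "\<bar>\<Phi> x * \<Psi> x - \<Phi> y * \<Psi> y\<bar> \<le> \<bar>\<Phi> x\<bar> * \<bar>\<Psi> x - \<Psi> y\<bar> + \<bar>\<Psi> y\<bar> * \<bar>\<Phi> x - \<Phi> y\<bar>"
        by (metis abs_mult abs_triangle_ineq)
      also have "\<dots> \<le> A * (J * (\<Sum>i<m. \<bar>x i - y i\<bar>)) + B * (K * (\<Sum>i<m. \<bar>x i - y i\<bar>))"
        by (intro add_mono mult_mono A B J(2) K(2)) (use A0 B0 in auto)
      finally show ?thesis by (simp add: algebra_simps)
    qed
    fix i assume i: "i < m"
    show "continuous_on UNIV (\<lambda>x. d i x * \<Psi> x + e i x * \<Phi> x)"
      by (intro continuous_on_add continuous_on_mult C1_lipschitzD(1)[OF C1 i] C1_lipschitzD(1)[OF C2 i]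
          C1_lipschitz_continuous[OF C1] C1_lipschitz_continuous[OF C2])
    show "((\<lambda>s. \<Phi> (x(i := s)) * \<Psi> (x(i := s))) has_real_derivative d i x * \<Psi> x + e i x * \<Phi> x) (at (x i))" for x
      using DERIV_mult[OF C1_lipschitzD(2)[OF C1 i, of x] C1_lipschitzD(2)[OF C2 i, of x]] by simp
  qed
qed

text \<open>With \<open>C1_lipschitz_shift_right\<close> this places functions of m and of n
  variables in disjoint slots of one list of length m + n, so that sums and products of cylinder
  functions are cylinder functions.\<close>

lemma C1_lipschitz_shift_left:
  assumes C1: "C1_lipschitz m \<Phi> d"
  shows "C1_lipschitz (m + n) \<Phi> (\<lambda>i x. if i < m then d i x else 0)"
proof -
  obtain K where K: "0 \<le> K" "\<And>x y. \<bar>\<Phi> x - \<Phi> y\<bar> \<le> K * (\<Sum>i<m. \<bar>x i - y i\<bar>)"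
    using C1_lipschitz_bound[OF C1] by metis
  show ?thesis
  proof (rule C1_lipschitzI[OF K(1)])
    show "\<bar>\<Phi> x - \<Phi> y\<bar> \<le> K * (\<Sum>i<m + n. \<bar>x i - y i\<bar>)" for x y
      by (rule order_trans[OF K(2) mult_left_mono[OF sum_mono2 K(1)]]) auto
    show "continuous_on UNIV (\<lambda>x. if i < m then d i x else 0)" for i
      using C1_lipschitzD(1)[OF C1] by (cases "i < m") auto
    show "((\<lambda>s. \<Phi> (x(i := s))) has_real_derivative (if i < m then d i x else 0)) (at (x i))" for i x
    proof (cases "i < m")
      case False
      then have "(\<lambda>s. \<Phi> (x(i := s))) = (\<lambda>s. \<Phi> x)"
        by (intro ext C1_lipschitz_cong(1)[OF C1]) auto
      then show ?thesis using False by simp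
    qed (use C1_lipschitzD(2)[OF C1] in auto)
  qed
qed

lemma C1_lipschitz_shift_right:
  assumes C1: "C1_lipschitz n \<Phi> d"
  shows "C1_lipschitz (m + n) (\<lambda>x. \<Phi> (\<lambda>i. x (i + m)))
    (\<lambda>i x. if i < m then 0 else d (i - m) (\<lambda>i. x (i + m)))"
proof -
  obtain K where K: "0 \<le> K" "\<And>x y. \<bar>\<Phi> x - \<Phi> y\<bar> \<le> K * (\<Sum>i<n. \<bar>x i - y i\<bar>)"
    using C1_lipschitz_bound[OF C1] by metis
  show ?thesis
  proof (rule C1_lipschitzI[OF K(1)])
    show "\<bar>\<Phi> (\<lambda>i. x (i + m)) - \<Phi> (\<lambda>i. y (i + m))\<bar> \<le> K * (\<Sum>i<m + n. \<bar>x i - y i\<bar>)" for x y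
    proof (rule order_trans[OF K(2) mult_left_mono[OF _ K(1)]])
      have "(\<Sum>i<n. \<bar>x (i + m) - y (i + m)\<bar>) = (\<Sum>i\<in>(\<lambda>i. i + m) ` {..<n}. \<bar>x i - y i\<bar>)"
        by (subst sum.reindex) (auto simp: inj_on_def)
      also have "\<dots> \<le> (\<Sum>i<m + n. \<bar>x i - y i\<bar>)" by (rule sum_mono2) auto
      finally show "(\<Sum>i<n. \<bar>x (i + m) - y (i + m)\<bar>) \<le> (\<Sum>i<m + n. \<bar>x i - y i\<bar>)" .
    qed
    fix i assume i: "i < m + n"
    show "continuous_on UNIV (\<lambda>x. if i < m then 0 else d (i - m) (\<lambda>i. x (i + m)))"
    proof (cases "i < m")
      case False
      with i have "continuous_on UNIV (d (i - m))" by (intro C1_lipschitzD(1)[OF C1]) auto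
      then have "continuous_on UNIV (\<lambda>x. d (i - m) (\<lambda>i. x (i + m)))"
        by (rule continuous_on_compose2) (auto intro!: continuous_on_coordinatewise_then_product)
      with False show ?thesis by simp
    qed auto
    show "((\<lambda>s. \<Phi> (\<lambda>j. (x(i := s)) (j + m))) has_real_derivative
        (if i < m then 0 else d (i - m) (\<lambda>i. x (i + m)))) (at (x i))" for x
    proof (cases "i < m")
      case True
      then have "(\<lambda>s. \<Phi> (\<lambda>j. (x(i := s)) (j + m))) = (\<lambda>s. \<Phi> (\<lambda>j. x (j + m)))" by simp
      with True show ?thesis by simp
    next
      case False
      then have "(\<lambda>j. (x(i := s)) (j + m)) = (\<lambda>j. x (j + m))(i - m := s)" for s by (auto simp: fun_eq_iff)
      with False i C1_lipschitzD(2)[OF C1, of "i - m" "\<lambda>j. x (j + m)"] show ?thesis by auto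
    qed
  qed
qed

lemma sum_lessThan_add:
  fixes f :: "nat \<Rightarrow> 'a::comm_monoid_add"
  shows "sum f {..<m + n} = sum f {..<m} + (\<Sum>i<n. f (i + m))"
  by (induction n) (auto simp: ac_simps)

text \<open>Products of one-variable functions approximate indicators of boxes. As all factors are
  at most 1 in modulus, the increments of the product are bounded by the sum of the increments of
  the factors.\<close>

lemma C1_lipschitz_prod:
  assumes f: "\<And>i x. i < m \<Longrightarrow> (f i has_real_derivative f' i x) (at x)"
    and c: "\<And>i. i < m \<Longrightarrow> continuous_on UNIV (f' i)" and L: "\<And>i x. i < m \<Longrightarrow> \<bar>f' i x\<bar> \<le> L"
    and b: "\<And>i x. i < m \<Longrightarrow> \<bar>f i x\<bar> \<le> 1"
  shows "C1_lipschitz m (\<lambda>x. \<Prod>i<m. f i (x i)) (\<lambda>j x. f' j (x j) * (\<Prod>i\<in>{..<m} - {j}. f i (x i)))"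
proof (rule C1_lipschitzI)
  \<comment> \<open>For m = 0 nothing forces \<open>L\<close> itself to be nonnegative.\<close>
  show "0 \<le> \<bar>L\<bar>" by simp
  have cont: "continuous_on UNIV (f i)" if "i < m" for i
    by (rule DERIV_continuous_on[OF f[OF that]])
  have lip: "\<bar>f i x - f i y\<bar> \<le> \<bar>L\<bar> * \<bar>x - y\<bar>" if "i < m" for i x y
    using field_differentiable_bound[of UNIV "f i" "f' i" "\<bar>L\<bar>" x y] f[OF that] order_trans[OF L[OF that] abs_ge_self] by auto
  show "\<bar>(\<Prod>i<m. f i (x i)) - (\<Prod>i<m. f i (y i))\<bar> \<le> \<bar>L\<bar> * (\<Sum>i<m. \<bar>x i - y i\<bar>)" for x y
  proof -
    have "norm ((\<Prod>i<m. f i (x i)) - (\<Prod>i<m. f i (y i))) \<le> (\<Sum>i<m. norm (f i (x i) - f i (y i)))"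
      by (rule norm_prod_diff) (use b in auto)
    also have "\<dots> \<le> (\<Sum>i<m. \<bar>L\<bar> * \<bar>x i - y i\<bar>)" by (rule sum_mono) (use lip in auto)
    finally show ?thesis by (simp add: sum_distrib_left)
  qed
  fix j assume j: "j < m"
  show "continuous_on UNIV (\<lambda>x. f' j (x j) * (\<Prod>i\<in>{..<m} - {j}. f i (x i)))"
    by (intro continuous_on_mult continuous_on_prod continuous_on_compose2[OF c[OF j]]
        continuous_on_compose2[OF cont]) auto
  show "((\<lambda>s. \<Prod>i<m. f i ((x(j := s)) i)) has_real_derivative
      f' j (x j) * (\<Prod>i\<in>{..<m} - {j}. f i (x i))) (at (x j))" for x
  proof -
    have "(\<Prod>i<m. f i ((x(j := s)) i)) = f j s * (\<Prod>i\<in>{..<m} - {j}. f i (x i))" for s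
      using j by (subst prod.remove[of _ j]) auto
    then show ?thesis using DERIV_cmult_right[OF f[OF j]] by simp
  qed
qed

lemma L2_closed_subspaceD:
  assumes "L2_closed_subspace M H"
  shows "f \<in> H \<Longrightarrow> f \<in> L2_space M" "(\<lambda>x. 0) \<in> H"
    "f \<in> H \<Longrightarrow> g \<in> H \<Longrightarrow> (\<lambda>x. f x + g x) \<in> H" "f \<in> H \<Longrightarrow> (\<lambda>x. c * f x) \<in> H"
    "(\<And>n. F n \<in> H) \<Longrightarrow> L2_conv M F f \<Longrightarrow> f \<in> H"
  using assms unfolding L2_closed_subspace_def by blast+

text \<open>A constant sequence converges in L2 to every version of its value, so closedness
  includes invariance under change on null sets.\<close>

lemma L2_closed_subspace_AE_cong:
  assumes H: "L2_closed_subspace M H" and f: "f \<in> H" "g \<in> borel_measurable M" "AE x in M. f x = g x"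
  shows "g \<in> H"
  by (rule L2_closed_subspaceD(5)[OF H, of "\<lambda>n. f", OF f(1)],
      rule L2_conv_AE_cong[OF L2_conv_const[OF L2_closed_subspaceD(1)[OF H f(1)]] f(2,3)])

lemma AE_time01_pos: "AE t in time01. 0 < t"
proof -
  have "AE t in lborel. t \<in> {0..1} \<longrightarrow> 0 < (t::real)"
    using AE_lborel_singleton[of "0::real"] by eventually_elim auto
  then show ?thesis unfolding time01_def by (subst AE_restrict_space_iff) auto
qed

lemma space_time01: "space time01 = {0..1}"
  by (simp add: time01_def space_restrict_space)

lemma step_integralsI:
  assumes "0 \<le> \<tau> 0" "\<tau> n \<le> 1" "\<forall>l<n. \<tau> l \<le> \<tau> (Suc l)"
  shows "(\<lambda>s. \<Sum>l<n. c l * indicator {\<tau> l<..\<tau> (Suc l)} s,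
    \<lambda>\<omega>. \<Sum>l<n. c l * (\<omega> (\<tau> (Suc l)) - \<omega> (\<tau> l))) \<in> step_integrals"
  unfolding step_integrals_def using assms by blast

lemma step_integrals_add:
  assumes "(h, X) \<in> step_integrals" "(g, Y) \<in> step_integrals"
  shows "(\<lambda>s. h s + g s, \<lambda>\<omega>. X \<omega> + Y \<omega>) \<in> step_integrals"
proof -
  define h' X' where "h' i = (if i = 0 then h else g)" and "X' i = (if i = 0 then X else Y)" for i :: nat
  have "(h' i, X' i) \<in> step_integrals" if "i < 2" for i using assms by (simp add: h'_def X'_def)
  then have "\<exists>n \<tau> c. 0 \<le> \<tau> 0 \<and> \<tau> n \<le> 1 \<and> (\<forall>l<n. \<tau> l < \<tau> (Suc l)) \<and>
      (\<forall>i<2. h' i = (\<lambda>s. \<Sum>l<n. c i l * indicator {\<tau> l<..\<tau> (Suc l)} s) \<and>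
           X' i = (\<lambda>\<omega>. \<Sum>l<n. c i l * (\<omega> (\<tau> (Suc l)) - \<omega> (\<tau> l))))"
    by (rule step_integrals_common_grid)
  then obtain n \<tau> c where \<tau>: "0 \<le> \<tau> 0" "\<tau> n \<le> 1" "\<forall>l<n. \<tau> l < \<tau> (Suc l)"
    and rep: "\<forall>i<2. h' i = (\<lambda>s. \<Sum>l<n. c i l * indicator {\<tau> l<..\<tau> (Suc l)} s) \<and>
           X' i = (\<lambda>\<omega>. \<Sum>l<n. c i l * (\<omega> (\<tau> (Suc l)) - \<omega> (\<tau> l)))" by auto
  have 1: "h = (\<lambda>s. \<Sum>l<n. c 0 l * indicator {\<tau> l<..\<tau> (Suc l)} s)"
    "X = (\<lambda>\<omega>. \<Sum>l<n. c 0 l * (\<omega> (\<tau> (Suc l)) - \<omega> (\<tau> l)))"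
    using rep[THEN spec, of 0] by (simp_all add: h'_def X'_def)
  have 2: "g = (\<lambda>s. \<Sum>l<n. c 1 l * indicator {\<tau> l<..\<tau> (Suc l)} s)"
    "Y = (\<lambda>\<omega>. \<Sum>l<n. c 1 l * (\<omega> (\<tau> (Suc l)) - \<omega> (\<tau> l)))"
    using rep[THEN spec, of 1] by (simp_all add: h'_def X'_def)
  have "(\<lambda>s. h s + g s) = (\<lambda>s. \<Sum>l<n. (c 0 l + c 1 l) * indicator {\<tau> l<..\<tau> (Suc l)} s)"
    "(\<lambda>\<omega>. X \<omega> + Y \<omega>) = (\<lambda>\<omega>. \<Sum>l<n. (c 0 l + c 1 l) * (\<omega> (\<tau> (Suc l)) - \<omega> (\<tau> l)))"
    unfolding 1 2 by (simp_all only: sum.distrib distrib_right)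
  then show ?thesis using step_integralsI[of \<tau> n "\<lambda>l. c 0 l + c 1 l"] \<tau> by (simp add: less_imp_le)
qed

lemma step_integrals_cmult:
  assumes "(h, X) \<in> step_integrals"
  shows "(\<lambda>s. a * h s, \<lambda>\<omega>. a * X \<omega>) \<in> step_integrals"
proof -
  obtain n c \<tau> where *: "0 \<le> \<tau> 0" "\<tau> n \<le> 1" "\<forall>l<n. \<tau> l \<le> \<tau> (Suc l)"
    "h = (\<lambda>s. \<Sum>l<n. c l * indicator {\<tau> l<..\<tau> (Suc l)} s)"
    "X = (\<lambda>\<omega>. \<Sum>l<n. c l * (\<omega> (\<tau> (Suc l)) - \<omega> (\<tau> l)))"
    using assms unfolding step_integrals_def by blast
  have "(\<lambda>s. a * h s) = (\<lambda>s. \<Sum>l<n. (a * c l) * indicator {\<tau> l<..\<tau> (Suc l)} s)"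
    "(\<lambda>\<omega>. a * X \<omega>) = (\<lambda>\<omega>. \<Sum>l<n. (a * c l) * (\<omega> (\<tau> (Suc l)) - \<omega> (\<tau> l)))"
    unfolding *(4,5) by (simp_all only: sum_distrib_left mult.assoc)
  then show ?thesis using step_integralsI[OF *(1-3), of "\<lambda>l. a * c l"] by simp
qed

text \<open>The increment from time 0 takes the place of the coordinate, because paths start at 0
  only almost surely.\<close>

lemma step_integrals_coordinate:
  assumes "t \<in> {0..1}"
  shows "(indicator {0<..t}, \<lambda>\<omega>. \<omega> t - \<omega> 0) \<in> step_integrals"
  using step_integralsI[of "\<lambda>l. if l = 0 then 0 else t" 1 "\<lambda>_. 1"] assms by simp

text \<open>Bounds the slope of the smoothed indicator of a half-line used in
  \<open>cylinder_total\<close>: with z the positive part, z \<le> 1 + z^2 \<le> exp(n z^2).\<close>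

lemma exp_pos_part_deriv_bound:
  fixes y :: real assumes "0 < n"
  shows "\<bar>- (real n * (2 * max 0 y)) * exp (- (real n * (max 0 y)\<^sup>2))\<bar> \<le> 2 * real n"
proof -
  define z where "z = max 0 y"
  have z: "0 \<le> z" by (simp add: z_def)
  have "0 \<le> (z - 1)\<^sup>2 + z" using z by simp
  then have "z \<le> 1 + z\<^sup>2" by (simp add: power2_eq_square algebra_simps)
  also have "\<dots> \<le> 1 + real n * z\<^sup>2" using assms mult_right_mono[of 1 "real n" "z\<^sup>2"] by simp
  also have "\<dots> \<le> exp (real n * z\<^sup>2)" by (rule exp_ge_add_one_self)
  finally have "z * exp (- (real n * z\<^sup>2)) \<le> 1" by (simp add: exp_minus field_simps)
  then have "2 * real n * (z * exp (- (real n * z\<^sup>2))) \<le> 2 * real n * 1"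
    by (intro mult_left_mono) auto
  then show ?thesis using z unfolding z_def[symmetric] by (simp add: abs_mult algebra_simps)
qed

section \<open>Existence of the Wiener integral and totality of cylinder functions\<close>

context wiener_space
begin

lemma has_wiener_integral_step:
  assumes "(h, X) \<in> step_integrals" shows "has_wiener_integral P h X"
  unfolding has_wiener_integral_def
  by (rule L2_graph_closureI[of "\<lambda>_. h" "\<lambda>_. X"])
    (use assms step_integrals_L2[OF assms] in \<open>auto intro: L2_conv_const\<close>)

lemma has_wiener_integral_add:
  assumes "has_wiener_integral P h X" "has_wiener_integral P g Y"
  shows "has_wiener_integral P (\<lambda>s. h s + g s) (\<lambda>\<omega>. X \<omega> + Y \<omega>)"
proof -
  obtain F H where 1: "\<And>n. (F n, H n) \<in> step_integrals" "L2_conv time01 F h" "L2_conv P H X"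
    using has_wiener_integralE[OF assms(1)] by metis
  obtain F' H' where 2: "\<And>n. (F' n, H' n) \<in> step_integrals" "L2_conv time01 F' g" "L2_conv P H' Y"
    using has_wiener_integralE[OF assms(2)] by metis
  show ?thesis unfolding has_wiener_integral_def
    by (rule L2_graph_closureI[OF step_integrals_add[OF 1(1) 2(1)] L2_conv_add[OF 1(2) 2(2)] L2_conv_add[OF 1(3) 2(3)]])
qed

lemma has_wiener_integral_cmult:
  assumes "has_wiener_integral P h X"
  shows "has_wiener_integral P (\<lambda>s. a * h s) (\<lambda>\<omega>. a * X \<omega>)"
proof -
  obtain F H where 1: "\<And>n. (F n, H n) \<in> step_integrals" "L2_conv time01 F h" "L2_conv P H X"
    using has_wiener_integralE[OF assms(1)] by metis
  show ?thesis unfolding has_wiener_integral_def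
    by (rule L2_graph_closureI[OF step_integrals_cmult[OF 1(1)] L2_conv_cmult[OF 1(2)] L2_conv_cmult[OF 1(3)]])
qed

text \<open>Integration by parts for the coordinate function, with \<open>X\<close> in both roles;
  the derivative is 1, which leaves the inner product of h with itself.\<close>

lemma wiener_isometry:
  assumes "has_wiener_integral P h X"
  shows "L2_norm P X = L2_norm time01 h"
  using wiener_integration_by_parts[OF C1_lipschitz_coordinate, of "\<lambda>_. h" "\<lambda>_. X" h X] assms
  by (simp add: L2_norm_def power2_eq_square prob_space)

text \<open>The integrands possessing an integral form a closed subspace of L2[0,1] that contains
  the indicators of initial intervals, a generating stable class.\<close>

lemma has_wiener_integral_exists:
  assumes "v \<in> L2_space time01"
  shows "\<exists>V. has_wiener_integral P v V"
proof -
  define H where "H = {v. \<exists>V. has_wiener_integral P v V}"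
  \<comment> \<open>By the isometry the integrals of a convergent sequence are Cauchy; their limit
    belongs to the closure of the step graph.\<close>
  have closed: "f \<in> H" if F: "\<And>n. F n \<in> H" and conv: "L2_conv time01 F f" for F f
  proof -
    have "\<exists>V. has_wiener_integral P (F n) V" for n using F[of n] by (simp add: H_def)
    then obtain V where V: "\<And>n. has_wiener_integral P (F n) (V n)" by metis
    have iso: "L2_norm P (\<lambda>\<omega>. V m \<omega> - V n \<omega>) = L2_norm time01 (\<lambda>s. F m s - F n s)" for m n
      using wiener_isometry[OF has_wiener_integral_add[OF V has_wiener_integral_cmult[OF V, of "-1"]], of m n]
      by simp
    have "\<exists>W. L2_conv P V W"
    proof (rule L2_complete)
      show "V n \<in> L2_space P" for n by (rule has_wiener_integral_L2[OF V])
      fix e :: real assume "0 < e"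
      then have "eventually (\<lambda>n. L2_norm time01 (\<lambda>s. F n s - f s) < e / 2) sequentially"
        using order_tendstoD(2)[OF L2_convD(3)[OF conv], of "e / 2"] by simp
      then obtain N where N: "\<And>n. n \<ge> N \<Longrightarrow> L2_norm time01 (\<lambda>s. F n s - f s) < e / 2"
        by (auto simp: eventually_sequentially)
      have "L2_norm P (\<lambda>\<omega>. V m \<omega> - V n \<omega>) < e" if "m \<ge> N" "n \<ge> N" for m n
        unfolding iso
        using L2_norm_triangle_diff[OF L2_convD(1)[OF conv, of m] L2_convD(2)[OF conv] L2_convD(1)[OF conv, of n]]
          N[OF that(1)] N[OF that(2)] L2_norm_minus_commute[of time01 f "F n"] by linarith
      then show "\<exists>N. \<forall>m\<ge>N. \<forall>n\<ge>N. L2_norm P (\<lambda>\<omega>. V m \<omega> - V n \<omega>) < e" by blast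
    qed
    then obtain W where W: "L2_conv P V W" by blast
    have "(f, W) \<in> L2_graph_closure time01 P step_integrals"
      by (rule L2_graph_closure_closed[OF _ _ conv W])
        (use V step_integrals_L2 in \<open>auto simp: has_wiener_integral_def\<close>)
    then show "f \<in> H" by (auto simp: H_def has_wiener_integral_def)
  qed
  have H: "L2_closed_subspace time01 H"
    unfolding L2_closed_subspace_def
  proof (intro conjI ballI allI impI)
    show "H \<subseteq> L2_space time01" by (auto simp: H_def dest: has_wiener_integral_L2)
    have "has_wiener_integral P (\<lambda>s. 0 * indicator {0<..1::real} s) (\<lambda>\<omega>. 0 * (\<omega> 1 - \<omega> 0))"
      by (intro has_wiener_integral_cmult has_wiener_integral_step step_integrals_coordinate) simp
    then show "(\<lambda>x. 0) \<in> H" by (auto simp: H_def)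
    show "(\<lambda>x. f x + g x) \<in> H" if "f \<in> H" "g \<in> H" for f g
      using that has_wiener_integral_add unfolding H_def by blast
    show "(\<lambda>x. c * f x) \<in> H" if "f \<in> H" for c f
      using that has_wiener_integral_cmult unfolding H_def by blast
  qed (use closed in blast)
  \<comment> \<open>The set is [0, min t 1], while the step function lives on (0, min t 1]; they
    differ in the null set {0}. For negative t the set is empty.\<close>
  have ind: "indicator ({0..1} \<inter> {..t}) \<in> H" for t :: real
  proof (cases "t < 0")
    case True
    then have "{0..1} \<inter> {..t} = {}" by auto
    then have "indicator ({0..1} \<inter> {..t}) = (\<lambda>_. 0 :: real)" by auto
    then show ?thesis using L2_closed_subspaceD(2)[OF H] by simp
  next
    case False
    define s where "s = min t 1"
    have s: "s \<in> {0..1}" using False by (simp add: s_def)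
    have "indicator {0<..s} \<in> H"
      using has_wiener_integral_step[OF step_integrals_coordinate[OF s]] by (auto simp: H_def)
    then show ?thesis
    proof (rule L2_closed_subspace_AE_cong[OF H])
      show "(indicator ({0..1} \<inter> {..t}) :: real \<Rightarrow> real) \<in> borel_measurable time01"
        by (intro measurable_time01) simp
      show "AE x in time01. indicator {0<..s} x = (indicator ({0..1} \<inter> {..t}) x :: real)"
        using AE_time01_pos AE_space
        by eventually_elim (auto simp: indicator_def s_def space_time01)
    qed
  qed
  have E: "sets time01 = sigma_sets (space time01) (range (\<lambda>t. {0..1} \<inter> {..t}))"
  proof (rule sigma_sets_eq_setsI)
    show "range (\<lambda>t. {0..1} \<inter> {..t}) \<subseteq> sets time01"
      by (auto simp: time01_def sets_restrict_space)
    let ?S = "sigma (space time01) (range (\<lambda>t. {0..1} \<inter> {..t::real}))"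
    have sub: "range (\<lambda>t. {0..1} \<inter> {..t}) \<subseteq> Pow (space time01)" by (auto simp: space_time01)
    have sp: "space ?S = {0..1}" using sub by (simp add: space_time01)
    have "(\<lambda>x. x) \<in> measurable ?S (restrict_space lborel {0..1})"
    proof (rule measurable_restrict_space2)
      show "(\<lambda>x. x) \<in> space ?S \<rightarrow> {0..1::real}" unfolding sp by simp
      have "(\<lambda>x. x) \<in> borel_measurable ?S"
        unfolding borel_measurable_iff_le
      proof
        fix a :: real
        have "{x \<in> space ?S. x \<le> a} = {0..1} \<inter> {..a}" unfolding sp by auto
        then show "{x \<in> space ?S. x \<le> a} \<in> sets ?S"
          using sub by (auto intro: sigma_sets.Basic)
      qed
      then show "(\<lambda>x. x) \<in> measurable ?S lborel" by simp
    qed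
    then show "(\<lambda>x. x) \<in> measurable ?S time01" by (simp only: time01_def)
  qed
  have "H = L2_space time01"
  proof (rule time01.L2_closed_subspace_eq_UNIV[OF H _ _ E])
    show "Int_stable (range (\<lambda>t. {0..1} \<inter> {..t::real}))"
    proof (rule Int_stableI_image)
      fix s t :: real
      have "({0..1} \<inter> {..s}) \<inter> ({0..1} \<inter> {..t}) = {0..1} \<inter> {..min s t}" by auto
      then show "\<exists>u\<in>UNIV. ({0..1} \<inter> {..s}) \<inter> ({0..1} \<inter> {..t}) = {0..1} \<inter> {..u}" by blast
    qed
    show "range (\<lambda>t. {0..1} \<inter> {..t}) \<subseteq> Pow (space time01)" by (auto simp: space_time01)
    have "{0..1} = {0..1} \<inter> {..1::real}" by auto
    then show "indicator (space time01) \<in> H" unfolding space_time01 using ind[of 1] by simp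
  qed (use ind in auto)
  with assms show ?thesis by (auto simp: H_def)
qed

lemma AE_origin: "AE \<omega> in P. \<omega> 0 = 0"
  using wiener by (simp add: wiener_measure_def)

text \<open>Paths subject to finitely many constraints \<omega>(t) \<le> a form a stable generating
  class, and their indicators are limits of products of smoothed half-line indicators. Asking only
  for functions bounded by 1 lets the lemma serve for closability too, where the test variable must
  be a bounded multiplier.\<close>

lemma cylinder_total:
  assumes H: "L2_closed_subspace P H"
    and cyl: "\<And>m \<Phi> d t. C1_lipschitz m \<Phi> d \<Longrightarrow> (\<And>x. \<bar>\<Phi> x\<bar> \<le> 1) \<Longrightarrow> (\<And>i. i < m \<Longrightarrow> t i \<in> {0..1}) \<Longrightarrow>
      (\<lambda>\<omega>. \<Phi> (\<lambda>i. \<omega> (t i) - \<omega> 0)) \<in> H"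
  shows "H = L2_space P"
proof -
  \<comment> \<open>Indexing by sets of constraints makes stability immediate: intersection of
    events is union of constraints.\<close>
  define A where "A S = {\<omega> \<in> space P. \<forall>(t, a)\<in>S. \<omega> t \<le> a}" for S :: "(real \<times> real) set"
  define E where "E = A ` {S. finite S \<and> fst ` S \<subseteq> {0..1}}"
  have A_sets: "A S \<in> sets P" if "finite S" "fst ` S \<subseteq> {0..1}" for S
  proof -
    have "A S = space P \<inter> (\<Inter>p\<in>S. {\<omega> \<in> space P. \<omega> (fst p) \<le> snd p})" by (auto simp: A_def case_prod_beta)
    moreover have "{\<omega> \<in> space P. \<omega> (fst p) \<le> snd p} \<in> sets P" if "p \<in> S" for p
      using coordinate_measurable[of "fst p"] that \<open>fst ` S \<subseteq> {0..1}\<close>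
      by (auto simp: borel_measurable_iff_le)
    ultimately show ?thesis using that(1)
      by (cases "S = {}") (auto intro!: sets.Int sets.finite_INT)
  qed
  have sets_P: "sets P = sets (restrict_space (\<Pi>\<^sub>M t\<in>{0..1::real}. (borel :: real measure)) C01)"
    using wiener by (simp add: wiener_measure_def)
  have gen: "sets P = sigma_sets (space P) E"
  proof (rule sigma_sets_eq_setsI)
    show sub: "E \<subseteq> sets P" using A_sets by (auto simp: E_def)
    have Pow: "E \<subseteq> Pow (space P)" using sub sets.sets_into_space by blast
    let ?S = "sigma (space P) E"
    have sp: "space ?S = space P" using Pow by simp
    have coord: "(\<lambda>\<omega>. \<omega> t) \<in> borel_measurable ?S" if "t \<in> {0..1}" for t
      unfolding borel_measurable_iff_le
    proof
      fix a :: real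
      have "{\<omega> \<in> space ?S. \<omega> t \<le> a} = A {(t, a)}" unfolding sp by (auto simp: A_def)
      also have "\<dots> \<in> E" unfolding E_def using that by (intro imageI) auto
      finally show "{\<omega> \<in> space ?S. \<omega> t \<le> a} \<in> sets ?S"
        using Pow by (auto intro: sigma_sets.Basic)
    qed
    have "(\<lambda>\<omega>. \<omega>) \<in> measurable ?S (restrict_space (\<Pi>\<^sub>M t\<in>{0..1::real}. (borel :: real measure)) C01)"
    proof (rule measurable_restrict_space2)
      show "(\<lambda>\<omega>. \<omega>) \<in> space ?S \<rightarrow> C01" unfolding sp unfolding space_P by simp
      have "(\<lambda>\<omega> t. (\<lambda>\<omega>. \<omega> t) \<omega>) \<in> measurable ?S (\<Pi>\<^sub>M t\<in>{0..1::real}. (borel :: real measure))"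
      proof (rule measurable_PiM_single')
        show "(\<lambda>\<omega> i. \<omega> i) \<in> space ?S \<rightarrow> (\<Pi>\<^sub>E i\<in>{0..1::real}. space (borel :: real measure))"
          unfolding sp unfolding space_P by (auto simp: C01_def PiE_def)
      qed (rule coord)
      then show "(\<lambda>\<omega>. \<omega>) \<in> measurable ?S (\<Pi>\<^sub>M t\<in>{0..1::real}. (borel :: real measure))" by simp
    qed
    then show "(\<lambda>\<omega>. \<omega>) \<in> measurable ?S P" unfolding measurable_cong_sets[OF refl sets_P] .
  qed
  have ind: "indicator (A S) \<in> H" if S: "finite S" "fst ` S \<subseteq> {0..1}" for S
  proof -
    define m where "m = card S"
    obtain b where b: "bij_betw b {0..<m} S" using ex_bij_betw_nat_finite[OF S(1)] by (auto simp: m_def)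
    define t a where "t i = fst (b i)" and "a i = snd (b i)" for i
    have t: "t i \<in> {0..1}" if "i < m" for i
    proof -
      have "b i \<in> S" using bij_betwE[OF b] that by simp
      then show ?thesis using S(2) unfolding t_def by blast
    qed
    have AS: "A S = {\<omega> \<in> space P. \<forall>i<m. \<omega> (t i) \<le> a i}"
      using bij_betw_imp_surj_on[OF b] by (force simp: A_def t_def a_def)
    \<comment> \<open>Equal to 1 on the half-line and decaying to 0 off it as n grows;
      \<open>Suc n\<close> keeps the exponent's factor positive.\<close>
    define f where "f n i y = exp (- (real (Suc n) * (max 0 (y - a i))\<^sup>2))" for n i y
    define f' where "f' n i y = - (real (Suc n) * (2 * max 0 (y - a i))) * exp (- (real (Suc n) * (max 0 (y - a i))\<^sup>2))" for n i y
    have fd: "(f n i has_real_derivative f' n i y) (at y)" for n i y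
    proof -
      have "((\<lambda>y. (max 0 (y - a i))\<^sup>2) has_real_derivative 2 * max 0 (y - a i) * (1 - 0)) (at y)"
        by (rule DERIV_chain2[OF DERIV_pos_part_square]) (intro derivative_intros)
      then have "((\<lambda>y. - (real (Suc n) * (max 0 (y - a i))\<^sup>2)) has_real_derivative - (real (Suc n) * (2 * max 0 (y - a i)))) (at y)"
        by (intro DERIV_minus DERIV_cmult) simp
      from DERIV_fun_exp[OF this] show ?thesis
        by (simp add: f_def[abs_def] f'_def mult.commute del: of_nat_Suc)
    qed
    have fc: "continuous_on UNIV (f' n i)" for n i
      unfolding f'_def[abs_def] by (intro continuous_intros)
    have fb: "\<bar>f' n i y\<bar> \<le> 2 * real (Suc n)" for n i y
      unfolding f'_def by (rule exp_pos_part_deriv_bound) simp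
    have f1: "0 \<le> f n i y" "f n i y \<le> 1" for n i y by (simp_all add: f_def del: of_nat_Suc)
    have f1': "\<bar>f n i y\<bar> \<le> 1" for n i y using f1[of n i y] by simp
    have prod1: "\<bar>\<Prod>i<m. f n i (x i)\<bar> \<le> 1" for n x
      using f1 by (simp add: abs_prod f1' prod_le_1)
    have FH: "(\<lambda>\<omega>. \<Prod>i<m. f n i (\<omega> (t i) - \<omega> 0)) \<in> H" for n
      by (rule cyl[OF C1_lipschitz_prod[OF fd fc fb f1'] prod1 t])
    have "L2_conv P (\<lambda>n \<omega>. \<Prod>i<m. f n i (\<omega> (t i) - \<omega> 0)) (indicator (A S))"
    proof (rule L2_conv_dominated[where g="\<lambda>_. 1"])
      show "(\<lambda>\<omega>. \<Prod>i<m. f n i (\<omega> (t i) - \<omega> 0)) \<in> borel_measurable P" for n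
        using L2_closed_subspaceD(1)[OF H FH] by (rule L2_measurable)
      show "(indicator (A S) :: path \<Rightarrow> real) \<in> borel_measurable P" using A_sets[OF S] by simp
      show "(\<lambda>_. 1) \<in> L2_space P" by (simp add: L2_space_def)
      show "AE \<omega> in P. \<bar>\<Prod>i<m. f n i (\<omega> (t i) - \<omega> 0)\<bar> \<le> 1" for n by (simp add: prod1)
      show "AE \<omega> in P. (\<lambda>n. \<Prod>i<m. f n i (\<omega> (t i) - \<omega> 0)) \<longlonglongrightarrow> indicator (A S) \<omega>"
        using AE_origin AE_space
      proof eventually_elim
        case (elim \<omega>)
        have lim: "(\<lambda>n. f n i (\<omega> (t i) - \<omega> 0)) \<longlonglongrightarrow> of_bool (\<omega> (t i) \<le> a i)" for i
        proof (cases "\<omega> (t i) \<le> a i")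
          case True
          then show ?thesis using elim(1) by (simp add: f_def)
        next
          case False
          \<comment> \<open>Where the constraint fails the factors are the powers of a fixed number
            below 1.\<close>
          define q where "q = exp (- ((\<omega> (t i) - a i)\<^sup>2))"
          have "0 \<le> q" "q < 1" using False by (simp_all add: q_def)
          then have "(\<lambda>n. q ^ Suc n) \<longlonglongrightarrow> 0" by (intro LIMSEQ_Suc LIMSEQ_power_zero) simp
          moreover have "q ^ Suc n = f n i (\<omega> (t i) - \<omega> 0)" for n
            using False elim(1) unfolding q_def exp_of_nat_mult[symmetric] f_def by simp
          ultimately show ?thesis using False by simp
        qed
        have "(\<lambda>n. \<Prod>i<m. f n i (\<omega> (t i) - \<omega> 0)) \<longlonglongrightarrow> (\<Prod>i<m. of_bool (\<omega> (t i) \<le> a i))"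
          by (intro tendsto_prod lim)
        also have "(\<Prod>i<m. of_bool (\<omega> (t i) \<le> a i)) = (indicator (A S) \<omega> :: real)"
        proof (cases "\<omega> \<in> A S")
          case False
          then obtain i where "i < m" "\<not> \<omega> (t i) \<le> a i" using elim(2) unfolding AS by blast
          then have "(\<Prod>i<m. of_bool (\<omega> (t i) \<le> a i)) = (0::real)" by (intro prod_zero) auto
          then show ?thesis using False by simp
        qed (simp add: AS)
        finally show ?case .
      qed
    qed
    from L2_closed_subspaceD(5)[OF H FH this] show ?thesis .
  qed
  show ?thesis
  proof (rule L2_closed_subspace_eq_UNIV[OF H _ _ gen])
    show "Int_stable E"
      unfolding E_def
    proof (rule Int_stableI_image)
      fix S S' :: "(real \<times> real) set"
      assume "S \<in> {S. finite S \<and> fst ` S \<subseteq> {0..1}}" "S' \<in> {S. finite S \<and> fst ` S \<subseteq> {0..1}}"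
      then have "S \<union> S' \<in> {S. finite S \<and> fst ` S \<subseteq> {0..1}}" by auto
      moreover have "A S \<inter> A S' = A (S \<union> S')" by (auto simp: A_def)
      ultimately show "\<exists>T\<in>{S. finite S \<and> fst ` S \<subseteq> {0..1}}. A S \<inter> A S' = A T" by blast
    qed
    show "E \<subseteq> Pow (space P)" by (auto simp: E_def A_def)
    \<comment> \<open>The empty set of constraints gives the whole space.\<close>
    have "space P = A {}" by (simp add: A_def)
    then show "indicator (space P) \<in> H" using ind[of "{}"] by simp
  qed (use ind in \<open>auto simp: E_def\<close>)
qed

end

section \<open>The gradient of the Ornstein--Uhlenbeck structure\<close>

lemma L2_lift:
  assumes "prob_space M" "prob_space T"
  shows "f \<in> L2_space M \<Longrightarrow> (\<lambda>p. f (fst p)) \<in> L2_space (M \<Otimes>\<^sub>M T)"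
    "f \<in> borel_measurable M \<Longrightarrow> L2_norm (M \<Otimes>\<^sub>M T) (\<lambda>p. f (fst p)) = L2_norm M f"
    "g \<in> L2_space T \<Longrightarrow> (\<lambda>p. g (snd p)) \<in> L2_space (M \<Otimes>\<^sub>M T)"
proof -
  interpret M: prob_space M by fact
  interpret T: prob_space T by fact
  interpret pair_prob_space M T ..
  have d: "distr (M \<Otimes>\<^sub>M T) M fst = M" by (rule T.distr_pair_fst)
  show "(\<lambda>p. f (fst p)) \<in> L2_space (M \<Otimes>\<^sub>M T)" if f: "f \<in> L2_space M"
  proof (rule L2_spaceI)
    show "(\<lambda>p. f (fst p)) \<in> borel_measurable (M \<Otimes>\<^sub>M T)" using L2_measurable[OF f] by measurable
    have "integrable (distr (M \<Otimes>\<^sub>M T) M fst) (\<lambda>x. (f x)\<^sup>2)"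
      unfolding d by (rule L2_integrable_square[OF f])
    then show "integrable (M \<Otimes>\<^sub>M T) (\<lambda>p. (f (fst p))\<^sup>2)"
      by (rule integrable_distr[OF measurable_fst])
  qed
  show "L2_norm (M \<Otimes>\<^sub>M T) (\<lambda>p. f (fst p)) = L2_norm M f" if [measurable]: "f \<in> borel_measurable M"
  proof -
    have "(\<integral>p. (f (fst p))\<^sup>2 \<partial>(M \<Otimes>\<^sub>M T)) = (\<integral>x. (f x)\<^sup>2 \<partial>distr (M \<Otimes>\<^sub>M T) M fst)"
      by (rule integral_distr[symmetric]) measurable
    then show ?thesis unfolding L2_norm_def d by simp
  qed
  show "(\<lambda>p. g (snd p)) \<in> L2_space (M \<Otimes>\<^sub>M T)" if g: "g \<in> L2_space T"
  proof (rule L2_spaceI)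
    have [measurable]: "g \<in> borel_measurable T" using g by auto
    show "(\<lambda>p. g (snd p)) \<in> borel_measurable (M \<Otimes>\<^sub>M T)" by measurable
    have "(\<integral>\<^sup>+p. ennreal ((g (snd p))\<^sup>2) \<partial>(M \<Otimes>\<^sub>M T)) = (\<integral>\<^sup>+t. (\<integral>\<^sup>+x. ennreal ((g t)\<^sup>2) \<partial>M) \<partial>T)"
      using nn_integral_snd[of "\<lambda>p. ennreal ((g (snd p))\<^sup>2)"] by simp
    also have "\<dots> = (\<integral>\<^sup>+t. ennreal ((g t)\<^sup>2) \<partial>T)" by (simp add: M.emeasure_space_1)
    also have "\<dots> < \<infinity>" using L2_integrable_square[OF g] by (subst nn_integral_eq_integral) auto
    finally show "integrable (M \<Otimes>\<^sub>M T) (\<lambda>p. (g (snd p))\<^sup>2)"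
      by (intro integrableI_bounded) auto
  qed
qed

lemma L2_conv_lift:
  assumes "prob_space M" "prob_space T" "L2_conv M F f"
  shows "L2_conv (M \<Otimes>\<^sub>M T) (\<lambda>n p. F n (fst p)) (\<lambda>p. f (fst p))"
proof -
  have "L2_norm (M \<Otimes>\<^sub>M T) (\<lambda>p. F n (fst p) - f (fst p)) = L2_norm M (\<lambda>x. F n x - f x)" for n
    by (rule L2_lift(2)[OF assms(1,2), of "\<lambda>x. F n x - f x"])
      (rule L2_measurable[OF L2_diff[OF L2_convD(1,2)[OF assms(3)]]])
  then show ?thesis
    using L2_convD[OF assms(3)] L2_lift(1)[OF assms(1,2)] unfolding L2_conv_def by simp
qed

lemma L2_orthogonal_closed_subspace:
  assumes D: "D \<in> L2_space M"
  shows "L2_closed_subspace M {g \<in> L2_space M. (\<integral>x. D x * g x \<partial>M) = 0}"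
  unfolding L2_closed_subspace_def
proof (intro conjI ballI allI impI)
  show "(\<lambda>x. f x + g x) \<in> {g \<in> L2_space M. (\<integral>x. D x * g x \<partial>M) = 0}"
    if "f \<in> {g \<in> L2_space M. (\<integral>x. D x * g x \<partial>M) = 0}" "g \<in> {g \<in> L2_space M. (\<integral>x. D x * g x \<partial>M) = 0}" for f g
    using that L2_integrable_mult[OF D] by (auto simp: distrib_left intro: L2_add)
  show "(\<lambda>x. c * f x) \<in> {g \<in> L2_space M. (\<integral>x. D x * g x \<partial>M) = 0}"
    if "f \<in> {g \<in> L2_space M. (\<integral>x. D x * g x \<partial>M) = 0}" for c f
  proof -
    have "(\<lambda>x. D x * (c * f x)) = (\<lambda>x. c * (D x * f x))" by (auto simp: ac_simps)
    then show ?thesis using that by (auto intro: L2_cmult)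
  qed
  show "f \<in> {g \<in> L2_space M. (\<integral>x. D x * g x \<partial>M) = 0}"
    if F: "\<forall>n. F n \<in> {g \<in> L2_space M. (\<integral>x. D x * g x \<partial>M) = 0}" and c: "L2_conv M F f" for F f
  proof -
    have "(\<lambda>n. \<integral>x. D x * F n x \<partial>M) \<longlonglongrightarrow> (\<integral>x. D x * f x \<partial>M)"
      by (rule L2_conv_integral_mult[OF L2_conv_const[OF D] c])
    with F have "(\<lambda>n. 0) \<longlonglongrightarrow> (\<integral>x. D x * f x \<partial>M)" by simp
    then show ?thesis using L2_convD(2)[OF c] by (simp add: LIMSEQ_const_iff)
  qed
qed (auto simp: L2_zero)

text \<open>The functions orthogonal to \<open>D\<close> form a closed subspace; rectangles being a
  generating stable class, it is all of L2 and contains \<open>D\<close> itself.\<close>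

lemma L2_orthogonal_rectangles:
  assumes "prob_space M" "prob_space T" and D: "D \<in> L2_space (M \<Otimes>\<^sub>M T)"
    and 0: "\<And>A B. A \<in> sets M \<Longrightarrow> B \<in> sets T \<Longrightarrow> (\<integral>p. D p * indicator (A \<times> B) p \<partial>(M \<Otimes>\<^sub>M T)) = 0"
  shows "AE p in M \<Otimes>\<^sub>M T. D p = 0"
proof -
  interpret M: prob_space M by fact
  interpret T: prob_space T by fact
  interpret pair_prob_space M T ..
  let ?N = "M \<Otimes>\<^sub>M T"
  have ind: "indicator (A \<times> B) \<in> L2_space ?N" if "A \<in> sets M" "B \<in> sets T" for A B
    by (rule L2_bounded[where C=1]) (use that in \<open>auto simp: indicator_def\<close>)
  have "{g \<in> L2_space ?N. (\<integral>x. D x * g x \<partial>?N) = 0} = L2_space ?N"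
  proof (rule L2_closed_subspace_eq_UNIV[OF L2_orthogonal_closed_subspace[OF D] Int_stable_pair_measure_generator])
    show "{a \<times> b |a b. a \<in> sets M \<and> b \<in> sets T} \<subseteq> Pow (space ?N)"
      using sets.space_closed[of M] sets.space_closed[of T] by (auto simp: space_pair_measure)
    show "sets ?N = sigma_sets (space ?N) {a \<times> b |a b. a \<in> sets M \<and> b \<in> sets T}"
      by (simp add: sets_pair_measure space_pair_measure)
    show "indicator (space ?N) \<in> {g \<in> L2_space ?N. (\<integral>x. D x * g x \<partial>?N) = 0}"
      unfolding space_pair_measure using ind 0 by blast
  qed (use ind 0 in blast)
  with D have "(\<integral>x. D x * D x \<partial>?N) = 0" by blast
  then have "L2_norm ?N D = 0" by (simp add: L2_norm_def power2_eq_square)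
  then show ?thesis by (rule L2_norm_zero_AE[OF D])
qed

locale ou_structure = wiener_space P for P :: "path measure" +
  fixes k :: "real \<Rightarrow> real"
  assumes k_measurable[measurable]: "k \<in> borel_measurable time01"
    and k_pos: "AE t in time01. 0 < k t"
    and k_integrable: "integrable time01 k"
begin

sublocale N: pair_prob_space P time01 ..

abbreviation "N \<equiv> P \<Otimes>\<^sub>M time01"

abbreviation "admissible h X \<equiv>
  h \<in> L2_space (density time01 (\<lambda>t. ennreal (1 + k t))) \<and> has_wiener_integral P h X"

lemma admissible_sqrt_k:
  assumes "admissible h X"
  shows "h \<in> L2_space time01" "(\<lambda>t. h t * sqrt (k t)) \<in> L2_space time01"
proof -
  show "h \<in> L2_space time01" using assms has_wiener_integral_L2 by blast
  then have hm[measurable]: "h \<in> borel_measurable time01" by auto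
  have pos: "AE t in time01. 0 \<le> 1 + k t" using k_pos by eventually_elim simp
  have "integrable (density time01 (\<lambda>t. ennreal (1 + k t))) (\<lambda>t. (h t)\<^sup>2)"
    using assms by (auto simp: L2_space_def)
  then have int: "integrable time01 (\<lambda>t. (1 + k t) * (h t)\<^sup>2)"
    by (subst (asm) integrable_density) (use pos in auto)
  show "(\<lambda>t. h t * sqrt (k t)) \<in> L2_space time01"
  proof (rule L2_spaceI)
    show "integrable time01 (\<lambda>t. (h t * sqrt (k t))\<^sup>2)"
    proof (rule Bochner_Integration.integrable_bound[OF int])
      show "AE t in time01. norm ((h t * sqrt (k t))\<^sup>2) \<le> norm ((1 + k t) * (h t)\<^sup>2)"
        using k_pos
        by eventually_elim (simp add: power_mult_distrib abs_mult algebra_simps)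
    qed measurable
  qed measurable
qed

text \<open>Integrability of k enters here: the weight 1 + k has finite mass, so bounded integrands
  are admissible.\<close>

lemma bounded_admissible:
  assumes "has_wiener_integral P h X" "h \<in> borel_measurable borel" "\<And>t. \<bar>h t\<bar> \<le> C"
  shows "admissible h X"
proof -
  have [measurable]: "h \<in> borel_measurable time01" by (rule measurable_time01[OF assms(2)])
  have pos: "AE t in time01. 0 \<le> 1 + k t" using k_pos by eventually_elim simp
  have "integrable time01 (\<lambda>t. (1 + k t) * (h t)\<^sup>2)"
  proof (rule Bochner_Integration.integrable_bound)
    show "integrable time01 (\<lambda>t. C\<^sup>2 * (1 + k t))" using k_integrable by simp
    show "AE t in time01. norm ((1 + k t) * (h t)\<^sup>2) \<le> norm (C\<^sup>2 * (1 + k t))"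
      using pos
    proof eventually_elim
      case (elim t)
      have "(h t)\<^sup>2 \<le> C\<^sup>2" using power_mono[OF assms(3)[of t], of 2] by simp
      then have "(1 + k t) * (h t)\<^sup>2 \<le> (1 + k t) * C\<^sup>2" using elim by (rule mult_left_mono)
      then show ?case using elim by (simp add: abs_mult mult.commute)
    qed
  qed measurable
  then have "integrable (density time01 (\<lambda>t. ennreal (1 + k t))) (\<lambda>t. (h t)\<^sup>2)"
    by (subst integrable_density) (use pos in auto)
  then show ?thesis using assms(1) by (auto simp: L2_space_def)
qed

definition cyl_gradient ::
  "nat \<Rightarrow> (nat \<Rightarrow> (nat \<Rightarrow> real) \<Rightarrow> real) \<Rightarrow> (nat \<Rightarrow> real \<Rightarrow> real) \<Rightarrow> (nat \<Rightarrow> path \<Rightarrow> real) \<Rightarrow> path \<times> real \<Rightarrow> real"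
  where "cyl_gradient m d h X p = (\<Sum>i<m. d i (\<lambda>j. X j (fst p)) * (h i (snd p) * sqrt (k (snd p))))"

lemma ou_cylinder_graph_iff:
  "(F, H) \<in> ou_cylinder_graph P k \<longleftrightarrow> (\<exists>m \<Phi> d h X. C1_lipschitz m \<Phi> d \<and> (\<forall>i<m. admissible (h i) (X i)) \<and>
     F = (\<lambda>\<omega>. \<Phi> (\<lambda>i. X i \<omega>)) \<and> H = cyl_gradient m d h X)"
proof -
  have "(\<lambda>(\<omega>, t). \<Sum>i<m. d i (\<lambda>j. X j \<omega>) * h i t * sqrt (k t)) = cyl_gradient m d h X" for m d h X
    by (auto simp: cyl_gradient_def mult.assoc fun_eq_iff)
  then show ?thesis unfolding ou_cylinder_graph_def mem_Collect_eq prod.inject by (simp only:) blast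
qed

lemma ou_cylinder_L2:
  assumes C1: "C1_lipschitz m \<Phi> d" and hX: "\<forall>i<m. admissible (h i) (X i)"
  shows "(\<lambda>\<omega>. \<Phi> (\<lambda>i. X i \<omega>)) \<in> L2_space P" "cyl_gradient m d h X \<in> L2_space N"
proof -
  have XL: "X i \<in> L2_space P" if "i < m" for i using hX that has_wiener_integral_L2 by blast
  show "(\<lambda>\<omega>. \<Phi> (\<lambda>i. X i \<omega>)) \<in> L2_space P" by (rule C1_lipschitz_L2[OF C1 XL])
  obtain L where L: "\<And>i x. i < m \<Longrightarrow> \<bar>d i x\<bar> \<le> L" using C1_lipschitz_bound[OF C1] by metis
  show "cyl_gradient m d h X \<in> L2_space N"
    unfolding cyl_gradient_def[abs_def]
  proof (rule L2_sum)
    fix i assume "i \<in> {..<m}"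
    then have i: "i < m" by simp
    show "(\<lambda>p. d i (\<lambda>j. X j (fst p)) * (h i (snd p) * sqrt (k (snd p)))) \<in> L2_space N"
    proof (rule L2_bounded_mult)
      show "(\<lambda>p. h i (snd p) * sqrt (k (snd p))) \<in> L2_space N"
        by (rule L2_lift(3)[OF prob_space_axioms prob_space_time01 admissible_sqrt_k(2)])
          (use hX i in blast)
      have "(\<lambda>\<omega>. d i (\<lambda>j. X j \<omega>)) \<in> borel_measurable P"
        by (rule C1_lipschitz_measurable(2)[OF C1 L2_measurable[OF XL] i])
      then show "(\<lambda>p. d i (\<lambda>j. X j (fst p))) \<in> borel_measurable N"
        by (rule measurable_compose[OF measurable_fst])
      show "AE p in N. \<bar>d i (\<lambda>j. X j (fst p))\<bar> \<le> L" using L[OF i] by simp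
    qed
  qed
qed

lemma ou_cylinder_graph_L2:
  assumes "(F, H) \<in> ou_cylinder_graph P k"
  shows "F \<in> L2_space P \<and> H \<in> L2_space N"
  using assms unfolding ou_cylinder_graph_iff using ou_cylinder_L2 by blast

text \<open>The two summands use different families of Wiener integrals; concatenating the families
  represents both by functions of m + n variables.\<close>

lemma ou_cylinder_graph_add:
  assumes "(F, H) \<in> ou_cylinder_graph P k" "(F', H') \<in> ou_cylinder_graph P k"
  shows "(\<lambda>\<omega>. F \<omega> + F' \<omega>, \<lambda>p. H p + H' p) \<in> ou_cylinder_graph P k"
proof -
  obtain m \<Phi> d h X where 1: "C1_lipschitz m \<Phi> d" "\<forall>i<m. admissible (h i) (X i)"
    "F = (\<lambda>\<omega>. \<Phi> (\<lambda>i. X i \<omega>))" "H = cyl_gradient m d h X"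
    using assms(1) unfolding ou_cylinder_graph_iff by blast
  obtain n \<Psi> e g Y where 2: "C1_lipschitz n \<Psi> e" "\<forall>i<n. admissible (g i) (Y i)"
    "F' = (\<lambda>\<omega>. \<Psi> (\<lambda>i. Y i \<omega>))" "H' = cyl_gradient n e g Y"
    using assms(2) unfolding ou_cylinder_graph_iff by blast
  define h' X' where "h' i = (if i < m then h i else g (i - m))"
    and "X' i = (if i < m then X i else Y (i - m))" for i
  note C = C1_lipschitz_add[OF C1_lipschitz_shift_left[OF 1(1), of n] C1_lipschitz_shift_right[OF 2(1), of m]]
  have adm: "\<forall>i<m + n. admissible (h' i) (X' i)" using 1(2) 2(2) by (auto simp: h'_def X'_def)
  have XX: "\<Phi> (\<lambda>i. X' i \<omega>) = \<Phi> (\<lambda>i. X i \<omega>)" "i < m \<Longrightarrow> d i (\<lambda>i. X' i \<omega>) = d i (\<lambda>i. X i \<omega>)" for i \<omega>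
    using C1_lipschitz_cong[OF 1(1), of "\<lambda>i. X' i \<omega>" "\<lambda>i. X i \<omega>"] by (auto simp: X'_def)
  have YY: "(\<lambda>i. X' (i + m) \<omega>) = (\<lambda>i. Y i \<omega>)" for \<omega> by (auto simp: X'_def)
  have F: "(\<lambda>\<omega>. F \<omega> + F' \<omega>) = (\<lambda>\<omega>. \<Phi> (\<lambda>i. X' i \<omega>) + \<Psi> (\<lambda>i. X' (i + m) \<omega>))"
    unfolding 1(3) 2(3) XX YY ..
  have "(\<lambda>p. H p + H' p) = cyl_gradient (m + n)
      (\<lambda>i x. (if i < m then d i x else 0) + (if i < m then 0 else e (i - m) (\<lambda>i. x (i + m)))) h' X'"
    unfolding 1(4) 2(4) cyl_gradient_def sum_lessThan_add YY
    by (intro ext arg_cong2[where f="(+)"] sum.cong refl) (auto simp: h'_def XX)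
  then show ?thesis unfolding ou_cylinder_graph_iff F using C adm by blast
qed

lemma ou_cylinder_graph_chain:
  assumes "(F, H) \<in> ou_cylinder_graph P k" and \<psi>: "\<And>x. (\<psi> has_real_derivative \<psi>' x) (at x)"
    "continuous_on UNIV \<psi>'" "\<And>x. \<bar>\<psi>' x\<bar> \<le> L"
  shows "(\<lambda>\<omega>. \<psi> (F \<omega>), \<lambda>p. \<psi>' (F (fst p)) * H p) \<in> ou_cylinder_graph P k"
proof -
  obtain m \<Phi> d h X where 1: "C1_lipschitz m \<Phi> d" "\<forall>i<m. admissible (h i) (X i)"
    "F = (\<lambda>\<omega>. \<Phi> (\<lambda>i. X i \<omega>))" "H = cyl_gradient m d h X"
    using assms(1) unfolding ou_cylinder_graph_iff by blast
  have "(\<lambda>p. \<psi>' (F (fst p)) * H p) = cyl_gradient m (\<lambda>i x. \<psi>' (\<Phi> x) * d i x) h X"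
    unfolding 1(3,4) cyl_gradient_def by (simp add: sum_distrib_left mult.assoc)
  then show ?thesis unfolding ou_cylinder_graph_iff
    using C1_lipschitz_compose[OF 1(1) \<psi>] 1(2,3) by blast
qed

lemma ou_graphE:
  assumes "(u, Z) \<in> ou_graph P k"
  obtains F H where "\<And>n. (F n, H n) \<in> ou_cylinder_graph P k" "L2_conv P F u" "L2_conv N H Z"
  using assms unfolding ou_graph_def by (rule L2_graph_closureE) (use ou_cylinder_graph_L2 in blast)+

lemma ou_graphI:
  assumes "\<And>n. (F n, H n) \<in> ou_cylinder_graph P k" "L2_conv P F u" "L2_conv N H Z"
  shows "(u, Z) \<in> ou_graph P k"
  unfolding ou_graph_def by (rule L2_graph_closureI[OF assms])

lemma ou_cylinder_graph_subset: "(u, Z) \<in> ou_cylinder_graph P k \<Longrightarrow> (u, Z) \<in> ou_graph P k"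
  by (rule ou_graphI[of "\<lambda>_. u" "\<lambda>_. Z"]) (auto intro: L2_conv_const dest: ou_cylinder_graph_L2)

lemma ou_graph_L2:
  assumes "(u, Z) \<in> ou_graph P k" shows "u \<in> L2_space P" "Z \<in> L2_space N"
  using assms by (auto simp: ou_graph_def L2_graph_closure_def)

lemma ou_graph_closed:
  "(\<And>n. (F n, H n) \<in> ou_graph P k) \<Longrightarrow> L2_conv P F u \<Longrightarrow> L2_conv N H Z \<Longrightarrow> (u, Z) \<in> ou_graph P k"
  unfolding ou_graph_def by (rule L2_graph_closure_closed[OF ou_cylinder_graph_L2])

lemma ou_graph_add:
  assumes "(u, Z) \<in> ou_graph P k" "(v, Y) \<in> ou_graph P k"
  shows "(\<lambda>\<omega>. u \<omega> + v \<omega>, \<lambda>p. Z p + Y p) \<in> ou_graph P k"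
proof -
  obtain F H where 1: "\<And>n. (F n, H n) \<in> ou_cylinder_graph P k" "L2_conv P F u" "L2_conv N H Z"
    using ou_graphE[OF assms(1)] by metis
  obtain F' H' where 2: "\<And>n. (F' n, H' n) \<in> ou_cylinder_graph P k" "L2_conv P F' v" "L2_conv N H' Y"
    using ou_graphE[OF assms(2)] by metis
  show ?thesis
    by (rule ou_graphI[OF ou_cylinder_graph_add[OF 1(1) 2(1)] L2_conv_add[OF 1(2) 2(2)] L2_conv_add[OF 1(3) 2(3)]])
qed

text \<open>Kept apart from the chain rule for the closure because closability, proved later, needs
  the approximating sequence itself and not only its limit.\<close>

lemma ou_graph_chain_sequence:
  assumes FH: "\<And>n. (F n, H n) \<in> ou_cylinder_graph P k" "L2_conv P F u" "L2_conv N H Z"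
    and \<psi>: "\<And>x. (\<psi> has_real_derivative \<psi>' x) (at x)" "continuous_on UNIV \<psi>'" "\<And>x. \<bar>\<psi>' x\<bar> \<le> L"
  shows "\<exists>r. L2_conv P (\<lambda>n \<omega>. \<psi> (F (r n) \<omega>)) (\<lambda>\<omega>. \<psi> (u \<omega>)) \<and>
    L2_conv N (\<lambda>n p. \<psi>' (F (r n) (fst p)) * H (r n) p) (\<lambda>p. \<psi>' (u (fst p)) * Z p)"
proof -
  obtain r :: "nat \<Rightarrow> nat" where r: "strict_mono r" "AE \<omega> in P. (\<lambda>n. F (r n) \<omega>) \<longlonglongrightarrow> u \<omega>"
    using L2_conv_AE_subseq[OF FH(2)] by blast
  note Fr = L2_conv_subseq[OF FH(2) r(1)] and Hr = L2_conv_subseq[OF FH(3) r(1)]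
  note ZL = L2_convD(2)[OF FH(3)]
  have \<psi>'m: "\<psi>' \<in> borel_measurable borel" by (rule borel_measurable_continuous_onI[OF \<psi>(2)])
  have um: "u \<in> borel_measurable P" using L2_convD(2)[OF FH(2)] by auto
  have Fm: "F n \<in> borel_measurable P" for n using L2_convD(1)[OF FH(2)] by auto
  have lift: "(\<lambda>p. \<psi>' (f (fst p))) \<in> borel_measurable N" if "f \<in> borel_measurable P" for f
    by (rule measurable_compose[OF measurable_compose[OF measurable_fst that] \<psi>'m])
  have "L2_conv P (\<lambda>n \<omega>. \<psi> (F (r n) \<omega>)) (\<lambda>\<omega>. \<psi> (u \<omega>))"
    using C1_lipschitz_L2_conv[OF C1_lipschitz_compose[OF C1_lipschitz_coordinate \<psi>],
        of "\<lambda>n _. F (r n)" "\<lambda>_. u"] Fr by simp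
  \<comment> \<open>The derivative factors need not converge uniformly. One term has a bounded
    factor times \<open>H - Z\<close>; the other keeps \<open>Z\<close> fixed and is dominated by
    \<open>L * \<bar>Z p\<bar>\<close>, with almost everywhere convergence along the
    subsequence.\<close>
  moreover have "L2_conv N (\<lambda>n p. \<psi>' (F (r n) (fst p)) * (H (r n) p - Z p) + \<psi>' (F (r n) (fst p)) * Z p)
      (\<lambda>p. 0 + \<psi>' (u (fst p)) * Z p)"
  proof (rule L2_conv_add)
    show "L2_conv N (\<lambda>n p. \<psi>' (F (r n) (fst p)) * (H (r n) p - Z p)) (\<lambda>p. 0)"
      by (rule L2_conv_mult_bounded[OF Hr lift[OF Fm], where C=L]) (use \<psi>(3) in simp)
    show "L2_conv N (\<lambda>n p. \<psi>' (F (r n) (fst p)) * Z p) (\<lambda>p. \<psi>' (u (fst p)) * Z p)"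
    proof (rule L2_conv_dominated)
      show "(\<lambda>p. \<psi>' (F (r n) (fst p)) * Z p) \<in> borel_measurable N" for n
        by (intro borel_measurable_times lift[OF Fm] L2_measurable[OF ZL])
      show "(\<lambda>p. \<psi>' (u (fst p)) * Z p) \<in> borel_measurable N"
        by (intro borel_measurable_times lift[OF um] L2_measurable[OF ZL])
      show "(\<lambda>p. L * \<bar>Z p\<bar>) \<in> L2_space N"
        by (rule L2_cmult, rule L2_bound[OF _ ZL]) (use L2_measurable[OF ZL] in auto)
      show "AE p in N. \<bar>\<psi>' (F (r n) (fst p)) * Z p\<bar> \<le> L * \<bar>Z p\<bar>" for n
        using \<psi>(3) by (intro AE_I2) (simp add: abs_mult mult_right_mono)
      have "AE p in N. (\<lambda>n. F (r n) (fst p)) \<longlonglongrightarrow> u (fst p)"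
        by (rule AE_pair_fst[OF time01.sigma_finite_measure_axioms r(2)])
      then show "AE p in N. (\<lambda>n. \<psi>' (F (r n) (fst p)) * Z p) \<longlonglongrightarrow> \<psi>' (u (fst p)) * Z p"
      proof eventually_elim
        case (elim p)
        then have "(\<lambda>n. \<psi>' (F (r n) (fst p))) \<longlonglongrightarrow> \<psi>' (u (fst p))"
          using continuous_on_tendsto_compose[OF \<psi>(2)] by simp
        then show ?case by (rule tendsto_mult[OF _ tendsto_const])
      qed
    qed
  qed
  then have "L2_conv N (\<lambda>n p. \<psi>' (F (r n) (fst p)) * H (r n) p) (\<lambda>p. \<psi>' (u (fst p)) * Z p)"
    by (simp add: right_diff_distrib)
  ultimately show ?thesis by blast
qed

lemma ou_graph_chain:
  assumes "(u, Z) \<in> ou_graph P k"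
    and \<psi>: "\<And>x. (\<psi> has_real_derivative \<psi>' x) (at x)" "continuous_on UNIV \<psi>'" "\<And>x. \<bar>\<psi>' x\<bar> \<le> L"
  shows "(\<lambda>\<omega>. \<psi> (u \<omega>), \<lambda>p. \<psi>' (u (fst p)) * Z p) \<in> ou_graph P k"
proof -
  obtain F H where FH: "\<And>n. (F n, H n) \<in> ou_cylinder_graph P k" "L2_conv P F u" "L2_conv N H Z"
    using ou_graphE[OF assms(1)] by metis
  obtain r where r: "L2_conv P (\<lambda>n \<omega>. \<psi> (F (r n) \<omega>)) (\<lambda>\<omega>. \<psi> (u \<omega>))"
    "L2_conv N (\<lambda>n p. \<psi>' (F (r n) (fst p)) * H (r n) p) (\<lambda>p. \<psi>' (u (fst p)) * Z p)"
    using ou_graph_chain_sequence[OF FH \<psi>] by blast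
  show ?thesis by (rule ou_graphI[OF ou_cylinder_graph_chain[OF FH(1) \<psi>] r])
qed

text \<open>Scaling is the chain rule for a linear function.\<close>

lemma ou_graph_cmult:
  assumes "(u, Z) \<in> ou_graph P k"
  shows "(\<lambda>\<omega>. c * u \<omega>, \<lambda>p. c * Z p) \<in> ou_graph P k"
  by (rule ou_graph_chain[OF assms, of "\<lambda>x. c * x" "\<lambda>_. c" "\<bar>c\<bar>"])
    (auto intro!: derivative_eq_intros)

lemma ou_graph_zero: "(\<lambda>_. 0, \<lambda>_. 0) \<in> ou_graph P k"
proof -
  have "C1_lipschitz 0 (\<lambda>_. 0) (\<lambda>_ _. 0)" by (rule C1_lipschitzI[of 0]) auto
  moreover have "(\<lambda>_. 0) = cyl_gradient 0 (\<lambda>_ _. 0) (\<lambda>_ _. 0) (\<lambda>_ _. 0)"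
    by (auto simp: cyl_gradient_def)
  ultimately have "(\<lambda>_. 0, \<lambda>_. 0) \<in> ou_cylinder_graph P k"
    unfolding ou_cylinder_graph_iff
    by (intro exI[of _ 0] exI[of _ "\<lambda>_. 0"] exI[of _ "\<lambda>_ _. 0"]) auto
  then show ?thesis by (rule ou_cylinder_graph_subset)
qed

text \<open>Integration by parts against a bounded cylinder variable times \<open>1\<^sub>B(t)\<close>: since \<open>k\<close> is
  integrable, \<open>sqrt k * 1\<^sub>B\<close> is a legitimate direction.\<close>

lemma cylinder_duality:
  assumes C1: "C1_lipschitz m \<Phi> d" and hX: "\<forall>i<m. admissible (h i) (X i)" and \<Phi>: "\<And>x. \<bar>\<Phi> x\<bar> \<le> C"
    and C2: "C1_lipschitz n \<gamma> e" and \<gamma>: "\<And>x. \<bar>\<gamma> x\<bar> \<le> 1" and gY: "\<And>j. j < n \<Longrightarrow> has_wiener_integral P (g j) (Y j)"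
    and B: "B \<in> sets time01" and V: "has_wiener_integral P (\<lambda>t. indicator B t * sqrt (k t)) V"
  shows "(\<integral>\<omega>. \<Phi> (\<lambda>i. X i \<omega>) * (\<gamma> (\<lambda>j. Y j \<omega>) * V \<omega>) \<partial>P) =
    (\<integral>p. cyl_gradient m d h X p * (\<gamma> (\<lambda>j. Y j (fst p)) * indicator B (snd p)) \<partial>N) +
    (\<integral>\<omega>. \<Phi> (\<lambda>i. X i \<omega>) * (\<Sum>j<n. e j (\<lambda>j. Y j \<omega>) * (\<integral>t. g j t * (indicator B t * sqrt (k t)) \<partial>time01)) \<partial>P)"
proof -
  let ?v = "\<lambda>t. indicator B t * sqrt (k t)"
  define h' X' where "h' i = (if i < m then h i else g (i - m))"
    and "X' i = (if i < m then X i else Y (i - m))" for i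
  \<comment> \<open>The product uses the first m slots for \<open>\<Phi>\<close> and the remaining n
    for \<open>\<gamma>\<close>; boundedness of both keeps it Lipschitz.\<close>
  note C = C1_lipschitz_mult[OF C1_lipschitz_shift_left[OF C1, of n] C1_lipschitz_shift_right[OF C2, of m] \<Phi> \<gamma>]
  have W: "has_wiener_integral P (h' i) (X' i)" if "i < m + n" for i
    using that hX gY by (auto simp: h'_def X'_def)
  have XX: "\<Phi> (\<lambda>i. X' i \<omega>) = \<Phi> (\<lambda>i. X i \<omega>)" "i < m \<Longrightarrow> d i (\<lambda>i. X' i \<omega>) = d i (\<lambda>i. X i \<omega>)" for i \<omega>
    using C1_lipschitz_cong[OF C1, of "\<lambda>i. X' i \<omega>" "\<lambda>i. X i \<omega>"] by (auto simp: X'_def)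
  have YY: "(\<lambda>i. X' (i + m) \<omega>) = (\<lambda>i. Y i \<omega>)" for \<omega> by (auto simp: X'_def)
  have XL: "X i \<in> L2_space P" if "i < m" for i using hX that has_wiener_integral_L2 by blast
  have YL: "Y j \<in> L2_space P" if "j < n" for j using gY[OF that] has_wiener_integral_L2 by blast
  obtain L where L: "\<And>i x. i < m \<Longrightarrow> \<bar>d i x\<bar> \<le> L" using C1_lipschitz_bound[OF C1] by metis
  obtain K where K: "\<And>i x. i < n \<Longrightarrow> \<bar>e i x\<bar> \<le> K" using C1_lipschitz_bound[OF C2] by metis
  have dm: "(\<lambda>\<omega>. d i (\<lambda>i. X i \<omega>)) \<in> borel_measurable P" if "i < m" for i
    by (rule C1_lipschitz_measurable(2)[OF C1 L2_measurable[OF XL] that])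
  have em: "(\<lambda>\<omega>. e j (\<lambda>j. Y j \<omega>)) \<in> borel_measurable P" if "j < n" for j
    by (rule C1_lipschitz_measurable(2)[OF C2 L2_measurable[OF YL] that])
  have \<gamma>m: "(\<lambda>\<omega>. \<gamma> (\<lambda>j. Y j \<omega>)) \<in> borel_measurable P"
    by (rule C1_lipschitz_measurable(1)[OF C2 L2_measurable[OF YL]])
  have \<Phi>L: "(\<lambda>\<omega>. \<Phi> (\<lambda>i. X i \<omega>)) \<in> L2_space P" by (rule C1_lipschitz_L2[OF C1 XL])
  have eL: "(\<lambda>\<omega>. e j (\<lambda>j. Y j \<omega>)) \<in> L2_space P" if "j < n" for j
    by (rule L2_bounded[OF em[OF that], where C=K]) (use K[OF that] in simp)
  have d\<gamma>L: "(\<lambda>\<omega>. d i (\<lambda>i. X i \<omega>) * \<gamma> (\<lambda>j. Y j \<omega>)) \<in> L2_space P" if "i < m" for i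
  proof (rule L2_bounded)
    show "AE \<omega> in P. \<bar>d i (\<lambda>i. X i \<omega>) * \<gamma> (\<lambda>j. Y j \<omega>)\<bar> \<le> L * 1"
      unfolding abs_mult using L[OF that] \<gamma> by (intro AE_I2 mult_mono order_trans[OF abs_ge_zero L[OF that]]) auto
  qed (intro borel_measurable_times dm[OF that] \<gamma>m)
  have "(\<integral>\<omega>. \<Phi> (\<lambda>i. X i \<omega>) * (\<gamma> (\<lambda>j. Y j \<omega>) * V \<omega>) \<partial>P) =
      (\<integral>\<omega>. (\<Phi> (\<lambda>i. X' i \<omega>) * \<gamma> (\<lambda>i. X' (i + m) \<omega>)) * V \<omega> \<partial>P)"
    unfolding XX YY by (simp add: mult.assoc)
  also note wiener_integration_by_parts[OF C W V]
  also have "(\<Sum>i<m + n. (\<integral>\<omega>. (if i < m then d i (\<lambda>i. X' i \<omega>) else 0) * \<gamma> (\<lambda>i. X' (i + m) \<omega>) +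
        (if i < m then 0 else e (i - m) (\<lambda>i. X' (i + m) \<omega>)) * \<Phi> (\<lambda>i. X' i \<omega>) \<partial>P) *
        (\<integral>t. h' i t * ?v t \<partial>time01)) =
      (\<Sum>i<m. (\<integral>\<omega>. d i (\<lambda>i. X i \<omega>) * \<gamma> (\<lambda>j. Y j \<omega>) \<partial>P) * (\<integral>t. h i t * ?v t \<partial>time01)) +
      (\<Sum>j<n. (\<integral>\<omega>. e j (\<lambda>j. Y j \<omega>) * \<Phi> (\<lambda>i. X i \<omega>) \<partial>P) * (\<integral>t. g j t * ?v t \<partial>time01))"
    unfolding sum_lessThan_add YY XX(1)
    by (intro arg_cong2[where f="(+)"] sum.cong refl) (auto simp: h'_def XX)
  also have "(\<Sum>j<n. (\<integral>\<omega>. e j (\<lambda>j. Y j \<omega>) * \<Phi> (\<lambda>i. X i \<omega>) \<partial>P) * (\<integral>t. g j t * ?v t \<partial>time01)) =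
      (\<integral>\<omega>. (\<Sum>j<n. e j (\<lambda>j. Y j \<omega>) * \<Phi> (\<lambda>i. X i \<omega>) * (\<integral>t. g j t * ?v t \<partial>time01)) \<partial>P)"
    by (subst Bochner_Integration.integral_sum) (auto intro!: integrable_mult_left L2_integrable_mult eL \<Phi>L)
  also have "\<dots> = (\<integral>\<omega>. \<Phi> (\<lambda>i. X i \<omega>) * (\<Sum>j<n. e j (\<lambda>j. Y j \<omega>) * (\<integral>t. g j t * ?v t \<partial>time01)) \<partial>P)"
    by (simp add: sum_distrib_left ac_simps)
  \<comment> \<open>Fubini read backwards: an expectation times a deterministic time integral is one
    integral over N, which is how the gradient of the cylinder function appears.\<close>
  also have "(\<Sum>i<m. (\<integral>\<omega>. d i (\<lambda>i. X i \<omega>) * \<gamma> (\<lambda>j. Y j \<omega>) \<partial>P) * (\<integral>t. h i t * ?v t \<partial>time01)) =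
      (\<Sum>i<m. \<integral>p. (d i (\<lambda>i. X i (fst p)) * \<gamma> (\<lambda>j. Y j (fst p))) * (h i (snd p) * sqrt (k (snd p)) * indicator B (snd p)) \<partial>N)"
  proof (intro sum.cong refl)
    fix i assume "i \<in> {..<m}"
    then have i: "i < m" by simp
    have hk: "(\<lambda>t. indicator B t * (h i t * sqrt (k t))) \<in> L2_space time01"
      by (rule L2_bounded_mult[OF admissible_sqrt_k(2)[of "h i" "X i"], where C=1]) (use hX i B in \<open>auto simp: indicator_def\<close>)
    have int: "integrable N (\<lambda>p. (d i (\<lambda>i. X i (fst p)) * \<gamma> (\<lambda>j. Y j (fst p))) * (indicator B (snd p) * (h i (snd p) * sqrt (k (snd p)))))"
      using L2_integrable_mult[OF L2_lift(1)[OF prob_space_axioms prob_space_time01 d\<gamma>L[OF i]]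
          L2_lift(3)[OF prob_space_axioms prob_space_time01 hk]] .
    have "(\<integral>p. (d i (\<lambda>i. X i (fst p)) * \<gamma> (\<lambda>j. Y j (fst p))) * (indicator B (snd p) * (h i (snd p) * sqrt (k (snd p)))) \<partial>N)
      = (\<integral>\<omega>. (\<integral>t. (d i (\<lambda>i. X i \<omega>) * \<gamma> (\<lambda>j. Y j \<omega>)) * (indicator B t * (h i t * sqrt (k t))) \<partial>time01) \<partial>P)"
      using N.integral_fst'[OF int] by simp
    also have "\<dots> = (\<integral>\<omega>. (d i (\<lambda>i. X i \<omega>) * \<gamma> (\<lambda>j. Y j \<omega>)) * (\<integral>t. indicator B t * (h i t * sqrt (k t)) \<partial>time01) \<partial>P)"
      by simp
    also have "\<dots> = (\<integral>\<omega>. d i (\<lambda>i. X i \<omega>) * \<gamma> (\<lambda>j. Y j \<omega>) \<partial>P) * (\<integral>t. indicator B t * (h i t * sqrt (k t)) \<partial>time01)"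
      by simp
    finally show "(\<integral>\<omega>. d i (\<lambda>i. X i \<omega>) * \<gamma> (\<lambda>j. Y j \<omega>) \<partial>P) * (\<integral>t. h i t * ?v t \<partial>time01) =
      (\<integral>p. (d i (\<lambda>i. X i (fst p)) * \<gamma> (\<lambda>j. Y j (fst p))) * (h i (snd p) * sqrt (k (snd p)) * indicator B (snd p)) \<partial>N)"
      by (simp add: ac_simps)
  qed
  also have "\<dots> = (\<integral>p. (\<Sum>i<m. (d i (\<lambda>i. X i (fst p)) * \<gamma> (\<lambda>j. Y j (fst p))) * (h i (snd p) * sqrt (k (snd p)) * indicator B (snd p))) \<partial>N)"
  proof (rule Bochner_Integration.integral_sum[symmetric])
    fix i assume "i \<in> {..<m}"
    then have i: "i < m" by simp
    have hk: "(\<lambda>t. indicator B t * (h i t * sqrt (k t))) \<in> L2_space time01"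
      by (rule L2_bounded_mult[OF admissible_sqrt_k(2)[of "h i" "X i"], where C=1]) (use hX i B in \<open>auto simp: indicator_def\<close>)
    show "integrable N (\<lambda>p. (d i (\<lambda>i. X i (fst p)) * \<gamma> (\<lambda>j. Y j (fst p))) * (h i (snd p) * sqrt (k (snd p)) * indicator B (snd p)))"
      using L2_integrable_mult[OF L2_lift(1)[OF prob_space_axioms prob_space_time01 d\<gamma>L[OF i]]
          L2_lift(3)[OF prob_space_axioms prob_space_time01 hk]] by (simp add: ac_simps)
  qed
  also have "\<dots> = (\<integral>p. cyl_gradient m d h X p * (\<gamma> (\<lambda>j. Y j (fst p)) * indicator B (snd p)) \<partial>N)"
    unfolding cyl_gradient_def sum_distrib_right
    by (intro Bochner_Integration.integral_cong sum.cong refl) (simp only: ac_simps)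
  finally show ?thesis .
qed

end

section \<open>Closability and gradients of functions of the coordinates\<close>

context ou_structure
begin

text \<open>By duality, the pairing of the approximating gradients with a cylinder variable times
  \<open>indicator B\<close> equals expectations of the approximants against fixed L2 variables.
  Those tend to 0, so \<open>Z\<close> is orthogonal to a total class.\<close>

lemma ou_graph_zero_unique:
  assumes "(\<lambda>_. 0, Z) \<in> ou_graph P k"
  shows "AE p in N. Z p = 0"
proof (rule L2_orthogonal_rectangles[OF prob_space_axioms prob_space_time01])
  show ZL: "Z \<in> L2_space N" by (rule ou_graph_L2[OF assms])
  obtain F H where FH: "\<And>n. (F n, H n) \<in> ou_cylinder_graph P k" "L2_conv P F (\<lambda>_. 0)" "L2_conv N H Z"
    using ou_graphE[OF assms] by metis
  \<comment> \<open>Composing with the sine makes the approximants bounded without changing the limits.\<close>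
  have "\<exists>r. L2_conv P (\<lambda>n \<omega>. sin (F (r n) \<omega>)) (\<lambda>\<omega>. sin 0) \<and>
    L2_conv N (\<lambda>n p. cos (F (r n) (fst p)) * H (r n) p) (\<lambda>p. cos 0 * Z p)"
    by (rule ou_graph_chain_sequence[OF FH, of sin cos 1])
      (auto intro: DERIV_sin continuous_intros)
  then obtain r where r: "L2_conv P (\<lambda>n \<omega>. sin (F (r n) \<omega>)) (\<lambda>\<omega>. 0)"
    "L2_conv N (\<lambda>n p. cos (F (r n) (fst p)) * H (r n) p) Z" by auto
  fix A B assume A: "A \<in> sets P" and B: "B \<in> sets time01"
  \<comment> \<open>The direction is square integrable precisely because its square is at most k,
    which is integrable.\<close>
  have vL: "(\<lambda>t. indicator B t * sqrt (k t)) \<in> L2_space time01"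
  proof (rule L2_bounded_mult[where C=1])
    show "(\<lambda>t. sqrt (k t)) \<in> L2_space time01"
    proof (rule L2_spaceI)
      show "integrable time01 (\<lambda>t. (sqrt (k t))\<^sup>2)"
        by (rule integrable_cong_AE_imp[OF k_integrable]) (use k_pos in \<open>auto elim!: eventually_mono\<close>)
    qed measurable
  qed (use B in \<open>auto simp: indicator_def\<close>)
  then obtain V where V: "has_wiener_integral P (\<lambda>t. indicator B t * sqrt (k t)) V"
    using has_wiener_integral_exists by blast
  note VL = has_wiener_integral_L2(2)[OF V]
  have BN: "(\<lambda>p. indicator B (snd p) :: real) \<in> borel_measurable N"
    using B by measurable
  have lift: "(\<lambda>p. indicator B (snd p) * f (fst p)) \<in> L2_space N" if "f \<in> L2_space P" for f
    by (rule L2_bounded_mult[OF L2_lift(1)[OF prob_space_axioms prob_space_time01 that] BN, where C=1])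
      (simp add: indicator_def)
  \<comment> \<open>For fixed B the admissible test variables form a closed subspace, so bounded
    cylinder functions of increments suffice.\<close>
  define S where "S = {f \<in> L2_space P. (\<integral>p. Z p * (indicator B (snd p) * f (fst p)) \<partial>N) = 0}"
  have "S = L2_space P"
  proof (rule cylinder_total)
    let ?K = "{g \<in> L2_space N. (\<integral>p. Z p * g p \<partial>N) = 0}"
    note K = L2_orthogonal_closed_subspace[OF ZL]
    have iff: "f \<in> S \<longleftrightarrow> f \<in> L2_space P \<and> (\<lambda>p. indicator B (snd p) * f (fst p)) \<in> ?K" for f
      using lift by (auto simp: S_def)
    show "L2_closed_subspace P S"
      unfolding L2_closed_subspace_def
    proof (intro conjI ballI allI impI)
      show "(\<lambda>x. f x + g x) \<in> S" if "f \<in> S" "g \<in> S" for f g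
        using that L2_closed_subspaceD(3)[OF K, of "\<lambda>p. indicator B (snd p) * f (fst p)" "\<lambda>p. indicator B (snd p) * g (fst p)"]
        unfolding iff distrib_left by (blast intro: L2_add)
      show "(\<lambda>x. c * f x) \<in> S" if "f \<in> S" for c f
        using that L2_closed_subspaceD(4)[OF K, of "\<lambda>p. indicator B (snd p) * f (fst p)" c]
        unfolding iff mult.left_commute[of c] by (blast intro: L2_cmult)
      show "f \<in> S" if G: "\<forall>n. G n \<in> S" and c: "L2_conv P G f" for G f
      proof -
        have "L2_conv N (\<lambda>n p. indicator B (snd p) * G n (fst p)) (\<lambda>p. indicator B (snd p) * f (fst p))"
          by (rule L2_conv_cmult_fun[OF L2_conv_lift[OF prob_space_axioms prob_space_time01 c] BN, where C=1])
            (simp add: indicator_def)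
        then show ?thesis
          using L2_closed_subspaceD(5)[OF K, of "\<lambda>n p. indicator B (snd p) * G n (fst p)"] G L2_convD(2)[OF c]
          unfolding iff by blast
      qed
    qed (auto simp: S_def L2_zero)
    fix m :: nat and \<gamma> e and t :: "nat \<Rightarrow> real"
    assume C2: "C1_lipschitz m \<gamma> e" and \<gamma>: "\<And>x. \<bar>\<gamma> x\<bar> \<le> 1" and t: "\<And>i. i < m \<Longrightarrow> t i \<in> {0..1}"
    define Y where "Y i \<omega> = \<omega> (t i) - \<omega> 0" for i and \<omega> :: path
    define g where "g i = (indicator {0<..t i} :: real \<Rightarrow> real)" for i
    have gY: "has_wiener_integral P (g i) (Y i)" if "i < m" for i
      unfolding g_def Y_def by (rule has_wiener_integral_step[OF step_integrals_coordinate[OF t[OF that]]])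
    define \<Gamma> where "\<Gamma> \<omega> = \<gamma> (\<lambda>j. Y j \<omega>)" for \<omega>
    define K where "K \<omega> = (\<Sum>j<m. e j (\<lambda>j. Y j \<omega>) * (\<integral>t. g j t * (indicator B t * sqrt (k t)) \<partial>time01))" for \<omega>
    have YL: "Y j \<in> L2_space P" if "j < m" for j using has_wiener_integral_L2(2)[OF gY[OF that]] .
    have \<Gamma>m: "\<Gamma> \<in> borel_measurable P"
      unfolding \<Gamma>_def[abs_def] by (rule C1_lipschitz_measurable(1)[OF C2 L2_measurable[OF YL]])
    have \<Gamma>L: "\<Gamma> \<in> L2_space P"
      by (rule L2_bounded[OF \<Gamma>m, where C=1]) (simp add: \<Gamma>_def \<gamma>)
    have \<Gamma>VL: "(\<lambda>\<omega>. \<Gamma> \<omega> * V \<omega>) \<in> L2_space P"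
      by (rule L2_bounded_mult[OF VL \<Gamma>m, where C=1]) (simp add: \<Gamma>_def \<gamma>)
    obtain L where L: "\<And>i x. i < m \<Longrightarrow> \<bar>e i x\<bar> \<le> L" using C1_lipschitz_bound[OF C2] by metis
    have KL: "K \<in> L2_space P"
      unfolding K_def[abs_def]
    proof (intro L2_sum)
      fix j assume "j \<in> {..<m}"
      then have j: "j < m" by simp
      have "(\<lambda>\<omega>. e j (\<lambda>j. Y j \<omega>)) \<in> L2_space P"
        by (rule L2_bounded[OF C1_lipschitz_measurable(2)[OF C2 L2_measurable[OF YL] j], where C=L])
          (use L[OF j] in auto)
      from L2_cmult[OF this, of "\<integral>t. g j t * (indicator B t * sqrt (k t)) \<partial>time01"] show "(\<lambda>\<omega>. e j (\<lambda>j. Y j \<omega>) * (\<integral>t. g j t * (indicator B t * sqrt (k t)) \<partial>time01)) \<in> L2_space P"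
        by (simp only: mult.commute)
    qed
    \<comment> \<open>The test variable moves the gradient off \<open>sin (F n)\<close> at the price
      of a divergence, whose two parts \<open>\<Gamma> * V\<close> and \<open>K\<close> do not
      depend on n and lie in L2.\<close>
    have dual: "(\<integral>\<omega>. sin (F n \<omega>) * (\<Gamma> \<omega> * V \<omega>) \<partial>P) =
      (\<integral>p. cos (F n (fst p)) * H n p * (indicator B (snd p) * \<Gamma> (fst p)) \<partial>N) + (\<integral>\<omega>. sin (F n \<omega>) * K \<omega> \<partial>P)" for n
    proof -
      obtain m' \<Phi> d h X where 1: "C1_lipschitz m' \<Phi> d" "\<forall>i<m'. admissible (h i) (X i)"
        "F n = (\<lambda>\<omega>. \<Phi> (\<lambda>i. X i \<omega>))" "H n = cyl_gradient m' d h X"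
        using FH(1)[of n] unfolding ou_cylinder_graph_iff by blast
      have C1: "C1_lipschitz m' (\<lambda>x. sin (\<Phi> x)) (\<lambda>i x. cos (\<Phi> x) * d i x)"
        by (rule C1_lipschitz_compose[OF 1(1), where L=1]) (auto intro: DERIV_sin continuous_intros)
      have g: "cyl_gradient m' (\<lambda>i x. cos (\<Phi> x) * d i x) h X = (\<lambda>p. cos (F n (fst p)) * H n p)"
        unfolding 1(3,4) cyl_gradient_def by (simp add: sum_distrib_left mult.assoc)
      show ?thesis
        using cylinder_duality[OF C1 1(2) abs_sin_le_one C2 \<gamma> gY B V]
        unfolding g unfolding \<Gamma>_def K_def 1(3) by (simp only: mult.commute[of "\<gamma> _" "indicator B _"])
    qed
    \<comment> \<open>Both expectations involving the sine vanish in the limit, which leaves the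
      pairing of \<open>Z\<close> alone.\<close>
    have "(\<lambda>n. \<integral>\<omega>. sin (F (r n) \<omega>) * (\<Gamma> \<omega> * V \<omega>) \<partial>P) \<longlonglongrightarrow> (\<integral>\<omega>. 0 * (\<Gamma> \<omega> * V \<omega>) \<partial>P)"
      by (rule L2_conv_integral_mult[OF r(1) L2_conv_const[OF \<Gamma>VL]])
    moreover have "(\<lambda>n. (\<integral>p. cos (F (r n) (fst p)) * H (r n) p * (indicator B (snd p) * \<Gamma> (fst p)) \<partial>N)
        + (\<integral>\<omega>. sin (F (r n) \<omega>) * K \<omega> \<partial>P)) \<longlonglongrightarrow>
        (\<integral>p. Z p * (indicator B (snd p) * \<Gamma> (fst p)) \<partial>N) + (\<integral>\<omega>. 0 * K \<omega> \<partial>P)"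
      by (intro tendsto_add L2_conv_integral_mult r L2_conv_const lift \<Gamma>L KL)
    ultimately have "(\<integral>p. Z p * (indicator B (snd p) * \<Gamma> (fst p)) \<partial>N) = 0"
      unfolding dual using LIMSEQ_unique by fastforce
    then have "\<Gamma> \<in> S" using \<Gamma>L by (simp add: S_def)
    then show "(\<lambda>\<omega>. \<gamma> (\<lambda>i. \<omega> (t i) - \<omega> 0)) \<in> S" by (simp add: \<Gamma>_def[abs_def] Y_def)
  qed
  moreover have "indicator A \<in> L2_space P"     by (rule L2_bounded[where C=1]) (use A in \<open>auto simp: indicator_def\<close>)
  ultimately have "(\<integral>p. Z p * (indicator B (snd p) * indicator A (fst p)) \<partial>N) = 0" unfolding S_def by blast
  then show "(\<integral>p. Z p * indicator (A \<times> B) p \<partial>N) = 0"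
    by (simp add: indicator_times mult.commute)
qed

lemma ou_graph_unique:
  assumes "(u, Z) \<in> ou_graph P k" "(u, Y) \<in> ou_graph P k"
  shows "AE p in N. Z p = Y p"
proof -
  have "(\<lambda>_. 0, \<lambda>p. Z p - Y p) \<in> ou_graph P k"
    using ou_graph_add[OF assms(1) ou_graph_cmult[OF assms(2), of "-1"]] by simp
  from ou_graph_zero_unique[OF this] show ?thesis by simp
qed

lemma weighted_gradient_ou_graph:
  assumes "w \<in> borel_measurable N" "AE p in N. 1 \<le> w p"
  shows "weighted_gradient P time01 (ou_graph P k) w"
proof unfold_locales
  show "(\<lambda>x. \<psi> (u x), \<lambda>p. \<psi>' (u (fst p)) * Z p) \<in> ou_graph P k"
    if "(u, Z) \<in> ou_graph P k" "\<And>x. (\<psi> has_real_derivative \<psi>' x) (at x)"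
      "continuous_on UNIV \<psi>'" "\<And>x. \<bar>\<psi>' x\<bar> \<le> L" for u Z \<psi> \<psi>' L
    by (rule ou_graph_chain[OF that])
qed (rule assms ou_graph_L2 ou_graph_zero ou_graph_add ou_graph_cmult ou_graph_closed ou_graph_unique; assumption)+

text \<open>For increments the integrands are indicators, so the gradient is at most a constant
  times \<open>sqrt k\<close>. After multiplication by \<alpha>/k its square is controlled by
  \<alpha> alone.\<close>

lemma coordinate_cylinder_gradient:
  assumes C1: "C1_lipschitz m \<Phi> d" and t: "\<And>i. i < m \<Longrightarrow> t i \<in> {0..1}"
  shows "\<exists>Z C. (\<lambda>\<omega>. \<Phi> (\<lambda>i. \<omega> (t i) - \<omega> 0), Z) \<in> ou_graph P k \<and> (AE p in N. (Z p)\<^sup>2 \<le> C * k (snd p))"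
proof -
  define X where "X i \<omega> = \<omega> (t i) - \<omega> 0" for i and \<omega> :: path
  define h where "h i = (indicator {0<..t i} :: real \<Rightarrow> real)" for i
  have adm: "\<forall>i<m. admissible (h i) (X i)"
  proof (intro allI impI)
    fix i assume i: "i < m"
    have "has_wiener_integral P (h i) (X i)"
      unfolding h_def X_def by (rule has_wiener_integral_step[OF step_integrals_coordinate[OF t[OF i]]])
    then show "admissible (h i) (X i)"
      by (rule bounded_admissible[where C=1]) (auto simp: h_def indicator_def)
  qed
  obtain L where L: "\<And>i x. i < m \<Longrightarrow> \<bar>d i x\<bar> \<le> L" using C1_lipschitz_bound[OF C1] by metis
  have "(\<lambda>\<omega>. \<Phi> (\<lambda>i. X i \<omega>), cyl_gradient m d h X) \<in> ou_cylinder_graph P k"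
    unfolding ou_cylinder_graph_iff using C1 adm by blast
  then have 1: "(\<lambda>\<omega>. \<Phi> (\<lambda>i. \<omega> (t i) - \<omega> 0), cyl_gradient m d h X) \<in> ou_graph P k"
    unfolding X_def by (rule ou_cylinder_graph_subset)
  have "AE p in N. 0 < k (snd p)"
  proof -
    have "{t \<in> space time01. 0 < k t} \<in> sets time01" by measurable
    then have "AE p in N. p \<in> space N \<longrightarrow> 0 < k (snd p)"
      using k_pos by (intro N.AE_pair_measure) (auto intro!: AE_I2 elim!: eventually_mono)
    then show ?thesis using AE_space by eventually_elim blast
  qed
  \<comment> \<open>There are m terms, each with a partial derivative at most \<open>L\<close> and
    an integrand at most 1.\<close>
  then have 2: "AE p in N. (cyl_gradient m d h X p)\<^sup>2 \<le> (m * L)\<^sup>2 * k (snd p)"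
  proof eventually_elim
    case (elim p)
    have "\<bar>cyl_gradient m d h X p\<bar> \<le> (\<Sum>i<m. L * sqrt (k (snd p)))"
      unfolding cyl_gradient_def
    proof (rule order_trans[OF sum_abs sum_mono])
      fix i assume "i \<in> {..<m}"
      then have i: "\<bar>d i (\<lambda>j. X j (fst p))\<bar> \<le> L" using L by simp
      then have "0 \<le> L" by linarith
      with i have "\<bar>d i (\<lambda>j. X j (fst p))\<bar> * (\<bar>h i (snd p)\<bar> * sqrt (k (snd p))) \<le> L * (1 * sqrt (k (snd p)))"
        using elim by (intro mult_mono) (auto simp: h_def indicator_def)
      then show "\<bar>d i (\<lambda>j. X j (fst p)) * (h i (snd p) * sqrt (k (snd p)))\<bar> \<le> L * sqrt (k (snd p))"
        using elim by (simp add: abs_mult)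
    qed
    also have "\<dots> = m * L * sqrt (k (snd p))" by simp
    finally have "\<bar>cyl_gradient m d h X p\<bar>\<^sup>2 \<le> (m * L * sqrt (k (snd p)))\<^sup>2"
      by (rule power_mono) simp
    then show ?case using elim by (simp add: power_mult_distrib)
  qed
  show ?thesis using 1 2 by blast
qed

end

section \<open>Density of the domain and conclusion\<close>

lemma L2_dense_of_closure:
  assumes D: "L2_subspace M D"
    and total: "\<And>H. L2_closed_subspace M H \<Longrightarrow> D \<subseteq> H \<Longrightarrow> H = L2_space M"
  shows "L2_dense M D"
proof -
  have DL: "D \<subseteq> L2_space M" and D0: "(\<lambda>_. 0) \<in> D"
    and Dadd: "\<And>u v. u \<in> D \<Longrightarrow> v \<in> D \<Longrightarrow> (\<lambda>x. u x + v x) \<in> D"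
    and Dc: "\<And>c u. u \<in> D \<Longrightarrow> (\<lambda>x. c * u x) \<in> D"
    using D unfolding L2_subspace_def by blast+
  \<comment> \<open>The sequential closure of \<open>D\<close>. Once it is a closed subspace,
    \<open>total\<close> makes it everything, which reduces density to a totality statement such as
    \<open>cylinder_total\<close>.\<close>
  define H where "H = {f. \<exists>U. (\<forall>n. U n \<in> D) \<and> L2_conv M U f}"
  have approx: "\<exists>u\<in>D. L2_norm M (\<lambda>x. u x - f x) < e" if "f \<in> H" "0 < e" for f and e :: real
  proof -
    from that(1) obtain U where U: "\<forall>n. U n \<in> D" "L2_conv M U f" unfolding H_def by blast
    have "eventually (\<lambda>n. L2_norm M (\<lambda>x. U n x - f x) < e) sequentially"
      using order_tendstoD(2)[OF L2_convD(3)[OF U(2)] that(2)] .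
    with U(1) show ?thesis by (auto simp: eventually_sequentially)
  qed
  have "H = L2_space M"
  proof (rule total)
    show "D \<subseteq> H"
    proof
      fix u assume u: "u \<in> D"
      then have "L2_conv M (\<lambda>n. u) u" using DL by (intro L2_conv_const) auto
      then show "u \<in> H" unfolding H_def using u by auto
    qed
    then have "(\<lambda>x. 0) \<in> H" using D0 by blast
    moreover have "(\<lambda>x. f x + g x) \<in> H" if "f \<in> H" "g \<in> H" for f g
    proof -
      obtain U V where U: "\<And>n. U n \<in> D" "L2_conv M U f" and V: "\<And>n. V n \<in> D" "L2_conv M V g"
        using \<open>f \<in> H\<close> \<open>g \<in> H\<close> unfolding H_def by blast
      show ?thesis unfolding H_def
        by (intro CollectI exI[of _ "\<lambda>n x. U n x + V n x"] conjI allI L2_conv_add[OF U(2) V(2)] Dadd[OF U(1) V(1)])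
    qed
    moreover have "(\<lambda>x. c * f x) \<in> H" if "f \<in> H" for c f
    proof -
      from that obtain U where U: "\<And>n. U n \<in> D" "L2_conv M U f" unfolding H_def by blast
      show ?thesis unfolding H_def
        by (intro CollectI exI[of _ "\<lambda>n x. c * U n x"] conjI allI L2_conv_cmult[OF U(2)] Dc[OF U(1)])
    qed
    \<comment> \<open>A limit of limits: each \<open>F n\<close> is replaced by an element of
      \<open>D\<close> within 1/(n+1), and the triangle inequality handles the rest.\<close>
    moreover have "f \<in> H" if F: "\<forall>n. F n \<in> H" and c: "L2_conv M F f" for F f
    proof -
      have "\<exists>u\<in>D. L2_norm M (\<lambda>x. u x - F n x) < 1 / Suc n" for n
        by (rule approx) (use F in auto)
      then obtain u where u: "\<And>n. u n \<in> D" "\<And>n. L2_norm M (\<lambda>x. u n x - F n x) < 1 / Suc n" by metis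
      have uL: "u n \<in> L2_space M" for n using u(1) DL by blast
      have "L2_conv M u f"
      proof (rule L2_conv_bound[OF uL L2_convD(2)[OF c]])
        show "(\<lambda>n. 1 / Suc n + L2_norm M (\<lambda>x. F n x - f x)) \<longlonglongrightarrow> 0"
          using tendsto_add[OF LIMSEQ_Suc[OF lim_const_over_n[of 1]] L2_convD(3)[OF c]] by simp
        show "L2_norm M (\<lambda>x. u n x - f x) \<le> 1 / Suc n + L2_norm M (\<lambda>x. F n x - f x)" for n
          by (rule order_trans[OF L2_norm_triangle_diff[OF uL L2_convD(1,2)[OF c]] add_right_mono])
            (rule less_imp_le[OF u(2)])
      qed
      then show ?thesis unfolding H_def using u(1) by blast
    qed
    ultimately show "L2_closed_subspace M H"
      unfolding L2_closed_subspace_def by (auto simp: H_def dest: L2_convD(2))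
  qed
  then show ?thesis
    unfolding L2_dense_def using DL approx by (metis L2_norm_minus_commute)
qed

theorem mainTheorem1:
  fixes P :: "path measure" and \<alpha> :: "path \<Rightarrow> real \<Rightarrow> real" and k :: "real \<Rightarrow> real"
  assumes "wiener_measure P"
    and "(\<lambda>(\<omega>, t). \<alpha> \<omega> t) \<in> borel_measurable (P \<Otimes>\<^sub>M time01)"
    and "\<And>\<omega> t. \<omega> \<in> space P \<Longrightarrow> t \<in> {0..1} \<Longrightarrow> 0 \<le> \<alpha> \<omega> t"
    and "(\<integral>\<^sup>+\<omega>. (\<integral>\<^sup>+t. ennreal (\<alpha> \<omega> t) \<partial>time01) \<partial>P) < \<infinity>"
    and "k \<in> borel_measurable time01"
    and "AE (\<omega>, t) in P \<Otimes>\<^sub>M time01. k t \<le> \<alpha> \<omega> t \<and> 0 < k t"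
  shows "L2_dense P (random_weight_domain P k \<alpha>) \<and>
    dirichlet_form P (random_weight_domain P k \<alpha>) (random_weight_form P k \<alpha>) \<and>
    carre_du_champ P (random_weight_domain P k \<alpha>) (random_weight_form P k \<alpha>)
      (random_weight_gamma P k \<alpha>)"
  proof -
  interpret wiener_space P
    using assms(1) by (simp add: wiener_space_def wiener_space_axioms_def wiener_measure_def)
  interpret pair: pair_prob_space P time01 ..
  let ?N = "P \<Otimes>\<^sub>M time01"
  define w where "w p = \<alpha> (fst p) (snd p) / k (snd p)" for p
  have k[measurable]: "k \<in> borel_measurable time01" by (rule assms(5))
  have \<alpha>[measurable]: "(\<lambda>p. \<alpha> (fst p) (snd p)) \<in> borel_measurable ?N"
    using assms(2) by (simp add: split_beta')
  have ae: "AE p in ?N. k (snd p) \<le> \<alpha> (fst p) (snd p) \<and> 0 < k (snd p)"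
    using assms(6) by (simp add: split_beta')
  have ae_t: "AE \<omega> in P. AE t in time01. k t \<le> \<alpha> \<omega> t \<and> 0 < k t"
    using pair.AE_pair[OF ae] by simp
  \<comment> \<open>The property does not depend on \<omega>, and an almost sure statement about a
    constant proposition is that proposition, \<open>P\<close> being a probability measure.\<close>
  have k_pos: "AE t in time01. 0 < k t"
  proof -
    have "AE \<omega> in P. AE t in time01. 0 < k t"
      using ae_t by eventually_elim (auto elim: eventually_mono)
    then show ?thesis by simp
  qed
  \<comment> \<open>As k is deterministic, averaging over paths changes nothing; domination by
    \<alpha> then bounds its integral.\<close>
  have "(\<integral>\<^sup>+t. ennreal (k t) \<partial>time01) = (\<integral>\<^sup>+\<omega>. (\<integral>\<^sup>+t. ennreal (k t) \<partial>time01) \<partial>P)"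
    by (simp add: emeasure_space_1)
  also have "\<dots> \<le> (\<integral>\<^sup>+\<omega>. (\<integral>\<^sup>+t. ennreal (\<alpha> \<omega> t) \<partial>time01) \<partial>P)"
  proof (rule nn_integral_mono_AE)
    show "AE \<omega> in P. (\<integral>\<^sup>+t. ennreal (k t) \<partial>time01) \<le> (\<integral>\<^sup>+t. ennreal (\<alpha> \<omega> t) \<partial>time01)"
      using ae_t
    proof eventually_elim
      case (elim \<omega>)
      then have "AE t in time01. ennreal (k t) \<le> ennreal (\<alpha> \<omega> t)"
        by eventually_elim (simp add: ennreal_leI)
      then show ?case by (rule nn_integral_mono_AE)
    qed
  qed
  also have "\<dots> < \<infinity>" by (rule assms(4))
  finally have k_fin: "(\<integral>\<^sup>+t. ennreal (k t) \<partial>time01) < \<infinity>" .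
  have k_int: "integrable time01 k"
    by (rule integrableI_nonneg) (use k_fin k_pos in \<open>auto elim!: eventually_mono\<close>)
  interpret ou_structure P k
    by unfold_locales (use k_pos k_int in auto)
  have \<alpha>_int: "integrable ?N (\<lambda>p. \<alpha> (fst p) (snd p))"
  proof (rule integrableI_nonneg)
    show "AE p in ?N. 0 \<le> \<alpha> (fst p) (snd p)" using ae by eventually_elim simp
    show "(\<integral>\<^sup>+p. ennreal (\<alpha> (fst p) (snd p)) \<partial>?N) < \<infinity>"
      using assms(4) by (subst time01.nn_integral_fst[symmetric]) auto
  qed measurable
  interpret G: weighted_gradient P time01 "ou_graph P k" w
  proof (rule weighted_gradient_ou_graph)
    show "w \<in> borel_measurable ?N" unfolding w_def[abs_def] by measurable
    show "AE p in ?N. 1 \<le> w p" using ae by eventually_elim (simp add: w_def)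
  qed
  \<comment> \<open>Both sides unfold to the same expression: the same choice of gradient and the
    quotient \<alpha>/k.\<close>
  have dom: "random_weight_domain P k \<alpha> = G.dom"
    unfolding random_weight_domain_def ou_domain_def ou_gradient_def G.dom_def G.grad_def w_def by simp
  have form: "random_weight_form P k \<alpha> = G.form"
    unfolding random_weight_form_def[abs_def] ou_gradient_def G.form_def[abs_def] G.grad_def w_def by simp
  have gam: "random_weight_gamma P k \<alpha> = G.gam"
    unfolding random_weight_gamma_def[abs_def] ou_gradient_def G.gam_def[abs_def] G.grad_def w_def by simp
  \<comment> \<open>Every closed subspace containing the domain contains the cylinder functions of
    increments, hence is all of L2.\<close>
  have dense: "L2_dense P G.dom"
  proof (rule L2_dense_of_closure[OF G.dom_subspace])
    fix H assume H: "L2_closed_subspace P H" "G.dom \<subseteq> H"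
    show "H = L2_space P"
    proof (rule cylinder_total[OF H(1)])
      fix m \<Phi> d and t :: "nat \<Rightarrow> real"
      assume "C1_lipschitz m \<Phi> d" "\<And>i. i < m \<Longrightarrow> t i \<in> {0..1}"
      then have "\<exists>Z C. (\<lambda>\<omega>. \<Phi> (\<lambda>i. \<omega> (t i) - \<omega> 0), Z) \<in> ou_graph P k \<and>
          (AE p in ?N. (Z p)\<^sup>2 \<le> C * k (snd p))"
        by (rule coordinate_cylinder_gradient)
      then obtain Z C where Z: "(\<lambda>\<omega>. \<Phi> (\<lambda>i. \<omega> (t i) - \<omega> 0), Z) \<in> ou_graph P k"
          "AE p in ?N. (Z p)\<^sup>2 \<le> C * k (snd p)" by blast
      have [measurable]: "Z \<in> borel_measurable ?N" using ou_graph_L2(2)[OF Z(1)] by auto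
      \<comment> \<open>The factor k in the bound on the squared gradient cancels against the
        denominator of the weight, leaving C times \<alpha>, which is integrable.\<close>
      have "(\<lambda>p. sqrt (w p) * Z p) \<in> L2_space ?N"
      proof (rule L2_spaceI)
        show "(\<lambda>p. sqrt (w p) * Z p) \<in> borel_measurable ?N" by measurable
        show "integrable ?N (\<lambda>p. (sqrt (w p) * Z p)\<^sup>2)"
        proof (rule Bochner_Integration.integrable_bound)
          show "integrable ?N (\<lambda>p. C * \<alpha> (fst p) (snd p))" using \<alpha>_int by simp
          show "AE p in ?N. norm ((sqrt (w p) * Z p)\<^sup>2) \<le> norm (C * \<alpha> (fst p) (snd p))"
            using ae Z(2)
          proof eventually_elim
            case (elim p)
            then have pos: "0 < k (snd p)" "0 < \<alpha> (fst p) (snd p)" by auto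
            then have "(sqrt (w p) * Z p)\<^sup>2 = \<alpha> (fst p) (snd p) / k (snd p) * (Z p)\<^sup>2"
              by (simp add: power_mult_distrib w_def)
            also have "\<dots> \<le> \<alpha> (fst p) (snd p) / k (snd p) * (C * k (snd p))"
              using elim(2) pos by (intro mult_left_mono) auto
            also have "\<dots> = C * \<alpha> (fst p) (snd p)" using pos by simp
            finally show ?case by simp
          qed
        qed measurable
      qed
      then have "(\<lambda>\<omega>. \<Phi> (\<lambda>i. \<omega> (t i) - \<omega> 0)) \<in> G.dom"
        unfolding G.dom_iff G.wgrad_def using Z(1) by auto
      then show "(\<lambda>\<omega>. \<Phi> (\<lambda>i. \<omega> (t i) - \<omega> 0)) \<in> H" using H(2) by blast
    qed
  qed
  show ?thesis
    unfolding dom form gam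
    using dense G.dirichlet_form_dom[OF dense] G.gam_carre_du_champ by blast
qed


end
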